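(* Let $V_{i'}=\sum_j[g_{i',j}]_+^2$ for every level $i'$ (Setting (Q)) and assume the regularity conditions (R1)–(R5) listed in the context. Let level $i$ satisfy $V_i(z^\star_{\mathrm{lex}})=0$, and let $\lambda^\star(w_{-i})>0$ denote the limiting multipliers of its boundary-binding hinges for $w_{-i}$ in a compact set $K\subset\mathbb R_{++}^{L-1}$. Then there is $\overline w_i<\infty$ and, for every $w_{-i}\in K$ and $w_i\ge\overline w_i$, a locally unique strict-local-minimizer branch $z_{\mathrm{loc}}(w_i,w_{-i})$ (of the penalized objective $F_w=J+\sum_{i'}w_{i'}V_{i'}$) near $z^\star_{\mathrm{lex}}$ such that, uniformly over $K$, $$g_{i,j}\bigl(z_{\mathrm{loc}}(w_i,w_{-i})\bigr)=\frac{\lambda_j^\star(w_{-i})}{2w_i}+O(w_i^{-2})\quad(j\in\mathcal B),$$ $$V_i\bigl(z_{\mathrm{loc}}(w_i,w_{-i})\bigr)=\frac{\|\lambda^\star(w_{-i})\|_2^2}{4w_i^2}+O(w_i^{-3}).$$ Moreover, if $\lambda^\star(w_{-i})\ne0$, then $z^\star_{\mathrm{lex}}$ is not a stationary point of the finite-weight smooth penalized problem for any $w_i<\infty$, and each component with $\lambda_j^\star>0$ is strictly violated along the local branch for all sufficiently large finite $w_i$.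
   Context: Control problem: $x_{k+1}=f(x_k,u_k)$ is a discrete-time system over a horizon of $N$ steps, $x_k\in\mathbb R^n$, $u_k\in\mathbb R^m$; a trajectory is $z=(x_{0:N},u_{0:N-1})\in\mathbb R^d$, $d=n(N+1)+mN$. The dynamics-feasible set is $\mathcal Z=\{z\in\mathbb R^d: x_{k+1}=f(x_k,u_k),\ x_0=\bar x_0,\ u_k\in\mathcal U_{\mathrm{hard}}\}$, with given initial state $\bar x_0$ and a set $\mathcal U_{\mathrm{hard}}$ of physical actuator limits. The performance objective is $J(z)=\sum_{k=0}^{N-1}\ell(x_k,u_k)+\ell_f(x_N)$ with stage cost $\ell$ and terminal cost $\ell_f$. There are $L$ priority levels, level $1$ having the highest priority, with rule constraints $g_{i,j}(z)\le0$, $j=1,\dots,m_i$, at level $i$. Write $[a]_+=\max(0,a)$, $\mathbb R_{++}=(0,\infty)$, and $V_i(z)=\sum_{j=1}^{m_i}[g_{i,j}(z)]_+^2$ (squared hinges); in Setting (Q) each $V_i$ is continuously differentiable. Lexicographic cascade: $\mathcal F_0=\mathcal Z$ and, for $i=1,\dots,L$, $V_i^\star=\min_{z\in\mathcal F_{i-1}}V_i(z)$, $\mathcal F_i=\{z\in\mathcal F_{i-1}:V_i(z)=V_i^\star\}$; the lexicographic optimum is $z^\star:=z^\star_{\mathrm{lex}}\in\arg\min_{z\in\mathcal F_L}J(z)$. The weighted-sum problem is $\min_{z\in\mathcal Z}J(z)+\sum_iw_iV_i(z)$, $w\in\mathbb R_{++}^L$. Assumptions adopted throughout: (A1) $\mathcal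 Z$ is compact, the cascade minima are attained, $\arg\min_{\mathcal F_L}J$ is non-empty, and the weighted-sum problem has a minimizer for every $w\in\mathbb R_{++}^L$; (A2) $z^\star_{\mathrm{lex}}$ is unique and its image $(V_1^\star,\dots,V_L^\star,J(z^\star))$ is uniquely determined; (A3) $\mathcal Z$, each $g_{i,j}$ and $J$ are convex. Fix level $i$ with $V_i(z^\star)=0$, and write $w=(w_i,w_{-i})$, $w_{-i}\in\mathbb R_{++}^{L-1}$ being the other weights. Put $\mathcal B=\{j:g_{i,j}(z^\star)=0\}$ (boundary-binding hinges of level $i$), $\eta=1/w_i$, $\Psi(z;w_{-i})=J(z)+\sum_{i'\ne i}w_{i'}V_{i'}(z)$, and $F_w(z)=\Psi(z;w_{-i})+w_iV_i(z)$, the objective of the finite-weight smooth penalized problem. $G(z)$ stacks the gradients $\nabla g_{i,j}(z)$, $j\in\mathcal B$, as rows, and $G=G(z^\star)$. The limit problem is $(\mathrm P_\infty)$: $\min_z\Psi(z;w_{-i})$ subject to $g_{i,j}(z)\le0$, $j\in\mathcal B$; its multipliers $\lambda^\star(w_{-i})$ at $z^\star$ are the limiting multipliers. The solution path is the path $\eta\mapsto(z(\eta),\lambda(\eta))$ with $z(0)=z^\star$, $\lambda(0)=\lambda^\star(w_{-i})$ of solutions of $\nabla\Psi(z;w_{-i})+G(z)^\top\lambda=0$, $g_{i,j}(z)=\tfrac{\eta}{2}\lambda_j$ ($j\in\mathcal B$). Regularity conditions. (R1) Stable sign classes: on a neighbourhood of $z^\star$ intersected with the solution path, every hinge outside $\mathcal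 B$ retains its sign class (strictly violated, boundary-binding or strictly satisfied, i.e. the sign of the constraint function) while each hinge in $\mathcal B$ passes from binding to strictly violated, so that $\Psi$ is twice continuously differentiable there along the branch. (R2) Linear independence: the gradients $\nabla g_{i,j}(z^\star)$, $j\in\mathcal B$, are nonzero and linearly independent. (R3)–(R5) Regular limit problem: for every $w_{-i}$ in the compact set $K$, $z^\star$ is the locally unique solution of $(\mathrm P_\infty)$, with unique multipliers $\lambda^\star(w_{-i})>0$, second-order sufficiency on the tangent space $\ker G$ (the Hessian at $z^\star$ of the Lagrangian $\Psi(z;w_{-i})+\sum_{j\in\mathcal B}\lambda_j^\star g_{i,j}(z)$ is positive definite on $\ker G$), and strict complementarity. Scope declared by the paper for its local $\ell_2$ development: the proof is stated for $z^\star\in\operatorname{int}\mathcal Z$; if a fixed set of smooth hard constraints is active, the same argument applies in local coordinates on their active manifold under joint linear independence of the constraint gradients (LICQ) and second-order sufficiency; no claim is made across active-set changes. *)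

theory Defs
  imports "HOL-Analysis.Analysis"
begin

definition grad :: "('a::euclidean_space \<Rightarrow> real) \<Rightarrow> 'a \<Rightarrow> 'a" where
  "grad f z = (THE D. GDERIV f z :> D)"

lemma grad_eqI:
  assumes "GDERIV f z :> D"
  shows "grad f z = D"
  unfolding grad_def
proof (rule the_equality[where P = "gderiv f z", OF assms])
  fix D' assume "GDERIV f z :> D'"
  then have "(\<lambda>h. h \<bullet> D') = (\<lambda>h. h \<bullet> D)"
    using assms unfolding gderiv_def by (rule has_derivative_unique)
  then have "\<forall>h. h \<bullet> D' = h \<bullet> D" by metis
  then show "D' = D" by (simp only: vector_eq_ldot)
qed

lemma gderiv_grad:
  assumes "f differentiable (at z)"
  shows "GDERIV f z :> grad f z"
proof -
  from assms obtain f' where f': "(f has_derivative f') (at z)"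
    unfolding differentiable_def by blast
  then have lin: "linear f'" by (rule has_derivative_linear)
  have "f' h = h \<bullet> (\<Sum>b\<in>Basis. f' b *\<^sub>R b)" for h
  proof -
    have "f' h = f' (\<Sum>b\<in>Basis. (h \<bullet> b) *\<^sub>R b)" by (simp add: euclidean_representation)
    also have "\<dots> = (\<Sum>b\<in>Basis. (h \<bullet> b) * f' b)"
      using lin by (simp add: linear_sum linear_cmul o_def)
    finally show ?thesis by (simp add: inner_sum_right mult.commute)
  qed
  then have "f' = (\<lambda>h. h \<bullet> (\<Sum>b\<in>Basis. f' b *\<^sub>R b))" by blast
  with f' have "GDERIV f z :> (\<Sum>b\<in>Basis. f' b *\<^sub>R b)"
    unfolding gderiv_def by simp
  with grad_eqI[OF this] show ?thesis by simp
qed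

definition hess :: "('a::euclidean_space \<Rightarrow> real) \<Rightarrow> 'a \<Rightarrow> 'a \<Rightarrow> 'a" where
  "hess f z = frechet_derivative (grad f) (at z)"

definition C1_on :: "'a::euclidean_space set \<Rightarrow> ('a \<Rightarrow> real) \<Rightarrow> bool" where
  "C1_on U f \<longleftrightarrow> (\<forall>z\<in>U. f differentiable (at z)) \<and> continuous_on U (grad f)"

definition C2_on :: "'a::euclidean_space set \<Rightarrow> ('a \<Rightarrow> real) \<Rightarrow> bool" where
  "C2_on U f \<longleftrightarrow> C1_on U f \<and> (\<forall>z\<in>U. grad f differentiable (at z)) \<and>
     (\<forall>d. continuous_on U (\<lambda>z. hess f z d))"

definition local_min_on :: "('a::topological_space \<Rightarrow> real) \<Rightarrow> 'a set \<Rightarrow> 'a \<Rightarrow> bool" where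
  "local_min_on F S z \<longleftrightarrow> z \<in> S \<and> (\<exists>T. open T \<and> z \<in> T \<and> (\<forall>y\<in>S \<inter> T. F z \<le> F y))"

definition strict_local_min_on :: "('a::topological_space \<Rightarrow> real) \<Rightarrow> 'a set \<Rightarrow> 'a \<Rightarrow> bool" where
  "strict_local_min_on F S z \<longleftrightarrow>
     z \<in> S \<and> (\<exists>T. open T \<and> z \<in> T \<and> (\<forall>y\<in>S \<inter> T. y \<noteq> z \<longrightarrow> F z < F y))"

definition lin_indep_family :: "'k set \<Rightarrow> ('k \<Rightarrow> 'a::real_vector) \<Rightarrow> bool" where
  "lin_indep_family I v \<longleftrightarrow> (\<forall>a. (\<Sum>k\<in>I. a k *\<^sub>R v k) = 0 \<longrightarrow> (\<forall>k\<in>I. a k = 0))"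

text \<open>
  A trajectory has type \<open>(real^'n)^'p \<times> (real^'m)^'q\<close>.  The finite types \<open>'p\<close> and \<open>'q\<close> index the
  \<open>N + 1\<close> states and the \<open>N\<close> inputs; \<open>sx\<close> and \<open>su\<close> enumerate them by \<open>{0..N}\<close> and \<open>{..<N}\<close>.
\<close>

type_synonym ('n, 'm, 'p, 'q) traj = "((real^'n)^'p) \<times> ((real^'m)^'q)"

definition dyn_feasible ::
  "(nat \<Rightarrow> 'p::finite) \<Rightarrow> (nat \<Rightarrow> 'q::finite) \<Rightarrow> nat \<Rightarrow> (real^'n \<Rightarrow> real^'m \<Rightarrow> real^'n) \<Rightarrow> real^'n
    \<Rightarrow> (real^'m) set \<Rightarrow> ('n::finite, 'm::finite, 'p, 'q) traj set" where
  "dyn_feasible sx su N f x0 Uhard =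
     {(x, u). (\<forall>k<N. x $ sx (Suc k) = f (x $ sx k) (u $ su k)) \<and> x $ sx 0 = x0 \<and>
        (\<forall>k<N. u $ su k \<in> Uhard)}"

definition performance ::
  "(nat \<Rightarrow> 'p::finite) \<Rightarrow> (nat \<Rightarrow> 'q::finite) \<Rightarrow> nat \<Rightarrow> (real^'n \<Rightarrow> real^'m \<Rightarrow> real)
    \<Rightarrow> (real^'n \<Rightarrow> real) \<Rightarrow> ('n::finite, 'm::finite, 'p, 'q) traj \<Rightarrow> real" where
  "performance sx su N l lf =
     (\<lambda>(x, u). (\<Sum>k<N. l (x $ sx k) (u $ su k)) + lf (x $ sx N))"

definition violation :: "(nat \<Rightarrow> nat) \<Rightarrow> (nat \<Rightarrow> nat \<Rightarrow> 'z \<Rightarrow> real) \<Rightarrow> nat \<Rightarrow> 'z \<Rightarrow> real" where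
  "violation ms g i z = (\<Sum>j=1..ms i. (max 0 (g i j z))\<^sup>2)"

text \<open>The infimum stands for \<open>V\<^sub>i\<^sup>\<star>\<close>; that it is attained is a hypothesis wherever the cascade is used.\<close>

primrec cascade :: "(nat \<Rightarrow> 'z \<Rightarrow> real) \<Rightarrow> 'z set \<Rightarrow> nat \<Rightarrow> 'z set" where
  "cascade V Z 0 = Z"
| "cascade V Z (Suc i) =
     {z \<in> cascade V Z i. V (Suc i) z = (INF y\<in>cascade V Z i. V (Suc i) y)}"

definition weighted_sum ::
  "('z \<Rightarrow> real) \<Rightarrow> (nat \<Rightarrow> 'z \<Rightarrow> real) \<Rightarrow> nat \<Rightarrow> (nat \<Rightarrow> real) \<Rightarrow> 'z \<Rightarrow> real" where
  "weighted_sum J V L w z = J z + (\<Sum>i=1..L. w i * V i z)"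

definition Psi ::
  "('z \<Rightarrow> real) \<Rightarrow> (nat \<Rightarrow> 'z \<Rightarrow> real) \<Rightarrow> nat \<Rightarrow> nat \<Rightarrow> (nat \<Rightarrow> real) \<Rightarrow> 'z \<Rightarrow> real" where
  "Psi J V L i w z = J z + (\<Sum>i'\<in>{1..L} - {i}. w i' * V i' z)"

definition binding :: "(nat \<Rightarrow> nat) \<Rightarrow> (nat \<Rightarrow> nat \<Rightarrow> 'z \<Rightarrow> real) \<Rightarrow> nat \<Rightarrow> 'z \<Rightarrow> nat set" where
  "binding ms g i z = {j \<in> {1..ms i}. g i j z = 0}"

text \<open>
  The initial condition \<open>x\<^sub>0 = x0\<close> leaves the dynamics-feasible set \<open>Z\<close> without interior points in the
  full trajectory space.  The local theory is therefore set on the manifold of the hard constraints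
  active at \<open>zs\<close>: near \<open>zs\<close> the set \<open>Z\<close> is described by equalities \<open>h c z = 0\<close> for \<open>c \<in> E\<close>
  (such as the dynamics) and active inequalities \<open>h c z \<le> 0\<close> for \<open>c \<in> A\<close>.
  For \<open>E = A = {}\<close> the condition says exactly that \<open>zs\<close> is an interior point of \<open>Z\<close>; all multipliers
  \<open>\<mu>\<close> below then disappear, and the manifold is \<open>Z\<close> itself.
\<close>

definition active_hard_constraints ::
  "'z::topological_space set \<Rightarrow> nat set \<Rightarrow> nat set \<Rightarrow> (nat \<Rightarrow> 'z \<Rightarrow> real) \<Rightarrow> 'z \<Rightarrow> bool" where
  "active_hard_constraints Z E A h zs \<longleftrightarrow>
     finite E \<and> finite A \<and> E \<inter> A = {} \<and> zs \<in> Z \<and> (\<forall>c\<in>A. h c zs = 0) \<and>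
     (\<exists>U. open U \<and> zs \<in> U \<and>
        Z \<inter> U = {z \<in> U. (\<forall>c\<in>E. h c z = 0) \<and> (\<forall>c\<in>A. h c z \<le> 0)})"

definition active_manifold :: "'z set \<Rightarrow> nat set \<Rightarrow> (nat \<Rightarrow> 'z \<Rightarrow> real) \<Rightarrow> 'z set" where
  "active_manifold Z A h = {z \<in> Z. \<forall>c\<in>A. h c z = 0}"

definition stationary_on ::
  "nat set \<Rightarrow> (nat \<Rightarrow> 'z::euclidean_space \<Rightarrow> real) \<Rightarrow> ('z \<Rightarrow> real) \<Rightarrow> 'z \<Rightarrow> bool" where
  "stationary_on C h F z \<longleftrightarrow> (\<exists>\<mu>. grad F z + (\<Sum>c\<in>C. \<mu> c *\<^sub>R grad (h c) z) = 0)"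

definition Lagrangian_stationary ::
  "('z::euclidean_space \<Rightarrow> real) \<Rightarrow> nat set \<Rightarrow> (nat \<Rightarrow> 'z \<Rightarrow> real) \<Rightarrow> nat set \<Rightarrow> (nat \<Rightarrow> 'z \<Rightarrow> real)
    \<Rightarrow> 'z \<Rightarrow> (nat \<Rightarrow> real) \<Rightarrow> (nat \<Rightarrow> real) \<Rightarrow> bool" where
  "Lagrangian_stationary \<Psi> B gi C h z lam \<mu> \<longleftrightarrow>
     grad \<Psi> z + (\<Sum>j\<in>B. lam j *\<^sub>R grad (gi j) z) + (\<Sum>c\<in>C. \<mu> c *\<^sub>R grad (h c) z) = 0"

definition limit_multipliers ::
  "('z::euclidean_space \<Rightarrow> real) \<Rightarrow> nat set \<Rightarrow> (nat \<Rightarrow> 'z \<Rightarrow> real) \<Rightarrow> nat set \<Rightarrow> (nat \<Rightarrow> 'z \<Rightarrow> real)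
    \<Rightarrow> 'z \<Rightarrow> (nat \<Rightarrow> real) \<Rightarrow> (nat \<Rightarrow> real) \<Rightarrow> bool" where
  "limit_multipliers \<Psi> B gi C h z lam \<mu> \<longleftrightarrow>
     Lagrangian_stationary \<Psi> B gi C h z lam \<mu> \<and> (\<forall>j\<in>B. lam j \<ge> 0 \<and> lam j * gi j z = 0)"

definition second_order_sufficient ::
  "('z::euclidean_space \<Rightarrow> real) \<Rightarrow> nat set \<Rightarrow> (nat \<Rightarrow> 'z \<Rightarrow> real) \<Rightarrow> nat set \<Rightarrow> (nat \<Rightarrow> 'z \<Rightarrow> real)
    \<Rightarrow> 'z \<Rightarrow> (nat \<Rightarrow> real) \<Rightarrow> (nat \<Rightarrow> real) \<Rightarrow> bool" where
  "second_order_sufficient \<Psi> B gi C h z lam \<mu> \<longleftrightarrow>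
     (\<forall>d. d \<noteq> 0 \<and> (\<forall>j\<in>B. grad (gi j) z \<bullet> d = 0) \<and> (\<forall>c\<in>C. grad (h c) z \<bullet> d = 0) \<longrightarrow>
        d \<bullet> hess (\<lambda>y. \<Psi> y + (\<Sum>j\<in>B. lam j * gi j y) + (\<Sum>c\<in>C. \<mu> c * h c y)) z d > 0)"

definition solution_path ::
  "('z::euclidean_space \<Rightarrow> real) \<Rightarrow> nat set \<Rightarrow> (nat \<Rightarrow> 'z \<Rightarrow> real) \<Rightarrow> nat set \<Rightarrow> (nat \<Rightarrow> 'z \<Rightarrow> real)
    \<Rightarrow> 'z \<Rightarrow> (nat \<Rightarrow> real) \<Rightarrow> real \<Rightarrow> (real \<Rightarrow> 'z) \<Rightarrow> (real \<Rightarrow> nat \<Rightarrow> real) \<Rightarrow> bool" where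
  "solution_path \<Psi> B gi C h zs lams \<eta>max zp lp \<longleftrightarrow>
     continuous_on {0..\<eta>max} zp \<and> (\<forall>j\<in>B. continuous_on {0..\<eta>max} (\<lambda>\<eta>. lp \<eta> j)) \<and>
     zp 0 = zs \<and> (\<forall>j\<in>B. lp 0 j = lams j) \<and>
     (\<forall>\<eta>\<in>{0..\<eta>max}.
        (\<exists>\<mu>. Lagrangian_stationary \<Psi> B gi C h (zp \<eta>) (lp \<eta>) \<mu>) \<and>
        (\<forall>j\<in>B. gi j (zp \<eta>) = \<eta> / 2 * lp \<eta> j) \<and> (\<forall>c\<in>C. h c (zp \<eta>) = 0))"

text \<open>
  Equal values of \<open>sgn\<close> mean equal sign class: strictly violated, boundary-binding or strictly
  satisfied.  The condition ranges over every solution path inside \<open>U\<close> and does not assert that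
  one exists.
\<close>

definition stable_sign_classes ::
  "('z::euclidean_space \<Rightarrow> real) \<Rightarrow> nat set \<Rightarrow> nat set \<Rightarrow> (nat \<Rightarrow> 'z \<Rightarrow> real) \<Rightarrow> nat \<Rightarrow> (nat \<Rightarrow> nat)
    \<Rightarrow> (nat \<Rightarrow> nat \<Rightarrow> 'z \<Rightarrow> real) \<Rightarrow> nat \<Rightarrow> 'z \<Rightarrow> (nat \<Rightarrow> real) \<Rightarrow> 'z set \<Rightarrow> bool" where
  "stable_sign_classes \<Psi> B C h L ms g i zs lams U \<longleftrightarrow>
     (\<forall>\<eta>max zp lp.
        solution_path \<Psi> B (g i) C h zs lams \<eta>max zp lp \<and> zp ` {0..\<eta>max} \<subseteq> U \<longrightarrow>
        (\<forall>\<eta>\<in>{0..\<eta>max}.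
           (\<forall>i'\<in>{1..L}. \<forall>j\<in>{1..ms i'}. \<not> (i' = i \<and> j \<in> B) \<longrightarrow>
              sgn (g i' j (zp \<eta>)) = sgn (g i' j zs)) \<and>
           (\<eta> > 0 \<longrightarrow> (\<forall>j\<in>B. g i j (zp \<eta>) > 0))))"

end

theory Submission
  imports Defs
begin

text \<open>
  The branch is obtained without the implicit function theorem.  Three facts about the limit problem,
  each uniform over the compact set of weights, carry the argument.

  Stability.  Write \<open>\<eta>\<close> for the inverse penalty weight.  Stationary points of the
  penalized objective at which the hinges of \<open>B\<close> are violated, together with the hinge derivatives as multipliers, solve an optimality system
  in which \<open>g i j z = \<eta> / 2 * lam j\<close> for \<open>j \<in> B\<close>.  Second-order sufficiency and linear independence make the
  saddle-point matrix of this system invertible at \<open>zs\<close>, with an inverse bounded over the compact parameter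
  set (\<open>finsler\<close>, \<open>saddle_point_estimate\<close>).  Since gradients of twice continuously differentiable
  functions are strictly differentiable, two solutions near \<open>zs\<close> for \<open>\<eta>\<close> and \<open>\<theta>\<close> differ by at most a constant
  times \<open>\<bar>\<eta> - \<theta>\<bar>\<close> (\<open>kkt_stability\<close>).  For \<open>\<eta> = \<theta>\<close> this is uniqueness, for \<open>\<theta> = 0\<close> it says that point and
  multipliers are \<open>O(\<eta>)\<close>-close to \<open>zs\<close> and the limiting multipliers, and in general it is continuity of the branch.
  The expansion of \<open>g i j\<close> is then the equation \<open>g i j z = \<eta> / 2 * lam j\<close> itself, and the expansion of \<open>V i\<close> is the
  sum of its squares.

  Necessity.  Every local minimizer near \<open>zs\<close> solves the optimality system (\<open>local_min_imp_kkt\<close>): the Lagrange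
  multiplier rule applies on the manifold of active hard constraints, and linear independence forces the
  multipliers to be near the limiting ones, which are positive; so every binding hinge is strictly violated and
  the point where the squared hinge fails to be twice differentiable is avoided.

  Existence.  The Lagrangian augmented by squared constraints grows quadratically at \<open>zs\<close>
  (\<open>quadratic_growth\<close>).  Hence the minimizer of the penalized objective over a small ball in the manifold moves
  to \<open>zs\<close> as the penalty weight grows and lies in the interior of the ball
  (\<open>penalized_minimizer_exists\<close>).  It is strict because local minimizers in the ball are unique
  (\<open>local_branch\<close>).

  The limit point \<open>zs\<close> itself is not stationary when the limiting multipliers are nonzero: the squared hinges of level \<open>i\<close> have zero gradient there, so
  stationarity would make zero the unique limiting multiplier.

  Uniformity over the weights needs the Hessian of the residual objective to be jointly continuous in
  weights and point, while only each single residual objective is known to be twice continuously differentiable.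
  The residual objectives are affine in the weights, so finitely many of them span the whole
  family with continuous coefficients (\<open>Psi_finite_combination\<close>).
\<close>

section \<open>Gradients and Hessians of combinations\<close>

lemma GDERIV_linear_combination:
  fixes f :: "'k \<Rightarrow> 'a::euclidean_space \<Rightarrow> real"
  assumes "\<And>k. k \<in> P \<Longrightarrow> f k differentiable (at z)"
  shows "GDERIV (\<lambda>y. \<Sum>k\<in>P. s k * f k y) z :> (\<Sum>k\<in>P. s k *\<^sub>R grad (f k) z)"
proof -
  have 1: "(f k has_derivative (\<lambda>d. d \<bullet> grad (f k) z)) (at z)" if "k \<in> P" for k
    using gderiv_grad[OF assms[OF that]] by (simp only: gderiv_def)
  have "((\<lambda>y. \<Sum>k\<in>P. s k * f k y) has_derivative (\<lambda>d. \<Sum>k\<in>P. s k * (d \<bullet> grad (f k) z))) (at z)"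
    by (rule has_derivative_sum, rule has_derivative_mult_right, rule 1)
  then show ?thesis
    by (simp add: gderiv_def inner_sum_right)
qed

lemma grad_linear_combination:
  fixes f :: "'k \<Rightarrow> 'a::euclidean_space \<Rightarrow> real"
  assumes "\<And>k. k \<in> P \<Longrightarrow> f k differentiable (at z)"
  shows "grad (\<lambda>y. \<Sum>k\<in>P. s k * f k y) z = (\<Sum>k\<in>P. s k *\<^sub>R grad (f k) z)"
  by (rule grad_eqI, rule GDERIV_linear_combination, rule assms)

lemma C2_onD:
  assumes "C2_on U f" "z \<in> U"
  shows "f differentiable (at z)" "grad f differentiable (at z)"
    "(grad f has_derivative hess f z) (at z)"
  using assms frechet_derivative_works[of "grad f" "at z"]
  unfolding C2_on_def C1_on_def hess_def by auto

lemma linear_hess: "C2_on U f \<Longrightarrow> z \<in> U \<Longrightarrow> linear (hess f z)"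
  by (rule has_derivative_linear, rule C2_onD)

lemma C1_onD_derivative:
  assumes "C1_on U f" "z \<in> U"
  shows "(f has_derivative (\<lambda>d. d \<bullet> grad f z)) (at z)"
  using assms gderiv_grad[of f z] by (auto simp: C1_on_def gderiv_def)

lemma C1_on_continuous: "C1_on U f \<Longrightarrow> continuous_on U f"
  unfolding C1_on_def
  by (intro continuous_at_imp_continuous_on ballI differentiable_imp_continuous_within) auto

lemma C2_imp_C1: "C2_on U f \<Longrightarrow> C1_on U f"
  by (simp add: C2_on_def)

lemma grad_continuous: "C2_on U f \<Longrightarrow> continuous_on U (grad f)"
  by (simp add: C2_on_def C1_on_def)

lemma C2_on_subset: "C2_on U f \<Longrightarrow> S \<subseteq> U \<Longrightarrow> C2_on S f"
  by (auto simp: C2_on_def C1_on_def intro: continuous_on_subset)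

lemma hess_linear_combination:
  fixes f :: "'k \<Rightarrow> 'a::euclidean_space \<Rightarrow> real"
  assumes U: "open U" "z \<in> U" and f: "\<And>k. k \<in> P \<Longrightarrow> C2_on U (f k)"
  shows "hess (\<lambda>y. \<Sum>k\<in>P. s k * f k y) z d = (\<Sum>k\<in>P. s k *\<^sub>R hess (f k) z d)"
proof -
  have "((\<lambda>y. \<Sum>k\<in>P. s k *\<^sub>R grad (f k) y) has_derivative (\<lambda>d. \<Sum>k\<in>P. s k *\<^sub>R hess (f k) z d)) (at z)"
    by (rule has_derivative_sum, rule has_derivative_scaleR_right, rule C2_onD(3)[OF f U(2)])
  moreover have "(\<Sum>k\<in>P. s k *\<^sub>R grad (f k) y) = grad (\<lambda>y. \<Sum>k\<in>P. s k * f k y) y" if "y \<in> U" for y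
  proof (rule grad_linear_combination[symmetric])
    show "f k differentiable (at y)" if "k \<in> P" for k
      using C2_onD(1)[OF f[OF that] \<open>y \<in> U\<close>] .
  qed
  ultimately have "(grad (\<lambda>y. \<Sum>k\<in>P. s k * f k y) has_derivative
      (\<lambda>d. \<Sum>k\<in>P. s k *\<^sub>R hess (f k) z d)) (at z)"
    by (rule has_derivative_transform_within_open[OF _ U])
  from frechet_derivative_at[OF this] show ?thesis
    by (simp add: hess_def fun_eq_iff)
qed

section \<open>Strict differentiability\<close>

lemma eventually_cball_at_right:
  fixes z :: "'a::metric_space"
  assumes "eventually P (nhds z)"
  shows "\<forall>\<^sub>F r in at_right 0. \<forall>y\<in>cball z r. P y"
proof -
  obtain e where e: "e > 0" "\<And>y. dist y z < e \<Longrightarrow> P y"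
    using assms by (auto simp: eventually_nhds_metric)
  have "\<forall>\<^sub>F r in at_right 0. r \<in> {0<..<e}"
    using e by (intro eventually_at_right_real)
  then show ?thesis
    by eventually_elim (use e in \<open>auto simp: dist_commute\<close>)
qed

lemma linearization_bound:
  fixes f :: "'a::euclidean_space \<Rightarrow> 'b::real_normed_vector"
  assumes f: "\<And>x. x \<in> cball z0 r \<Longrightarrow> (f has_derivative f' x) (at x)"
    and T: "bounded_linear T"
    and e: "\<And>x d. x \<in> cball z0 r \<Longrightarrow> norm (f' x d - T d) \<le> e * norm d"
    and yz: "y \<in> cball z0 r" "z \<in> cball z0 r"
  shows "norm (f y - f z - T (y - z)) \<le> e * norm (y - z)"
proof -
  interpret T: bounded_linear T by (rule T)
  have "norm ((\<lambda>x. f x - T x) y - (\<lambda>x. f x - T x) z) \<le> e * norm (y - z)"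
  proof (rule differentiable_bound[OF convex_cball[of z0 r]])
    fix x assume x: "x \<in> cball z0 r"
    have "((\<lambda>x. f x - T x) has_derivative (\<lambda>d. f' x d - T d)) (at x)"
      using f[OF x] by (intro has_derivative_diff T.has_derivative) auto
    then show "((\<lambda>x. f x - T x) has_derivative (\<lambda>d. f' x d - T d)) (at x within cball z0 r)"
      by (rule has_derivative_at_withinI)
    show "onorm (\<lambda>d. f' x d - T d) \<le> e"
    proof (rule onorm_le)
      show "norm (f' x d - T d) \<le> e * norm d" for d by (rule e[OF x])
    qed
  qed (use yz in auto)
  then show ?thesis
    by (simp add: T.diff algebra_simps)
qed

lemma C1_strict_differentiability:
  fixes f :: "'a::euclidean_space \<Rightarrow> real"
  assumes U: "open U" "z0 \<in> U" and f: "C1_on U f" and e: "e > 0"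
  shows "\<forall>\<^sub>F r in at_right 0. \<forall>y\<in>cball z0 r. \<forall>z\<in>cball z0 r.
           \<bar>f y - f z - (y - z) \<bullet> grad f z0\<bar> \<le> e * norm (y - z)"
proof -
  have "(grad f \<longlongrightarrow> grad f z0) (nhds z0)"
    using f U unfolding C1_on_def by (metis continuous_on_eq_continuous_at isCont_def tendsto_at_iff_tendsto_nhds)
  then have "\<forall>\<^sub>F y in nhds z0. y \<in> U \<and> dist (grad f y) (grad f z0) < e"
    using U e by (intro eventually_conj eventually_nhds_in_open) (auto dest: tendstoD)
  from eventually_cball_at_right[OF this] show ?thesis
  proof eventually_elim
    case (elim r)
    have "norm (f y - f z - (y - z) \<bullet> grad f z0) \<le> e * norm (y - z)"
      if "y \<in> cball z0 r" "z \<in> cball z0 r" for y z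
    proof (rule linearization_bound[of z0 r f "\<lambda>x d. d \<bullet> grad f x", OF _ _ _ that])
      fix x d assume x: "x \<in> cball z0 r"
      have "norm (d \<bullet> grad f x - d \<bullet> grad f z0) \<le> norm d * norm (grad f x - grad f z0)"
        unfolding inner_diff_right[symmetric] real_norm_def by (rule Cauchy_Schwarz_ineq2)
      also have "\<dots> \<le> norm d * e"
        using elim x by (intro mult_left_mono) (auto simp: dist_norm less_imp_le)
      finally show "norm (d \<bullet> grad f x - d \<bullet> grad f z0) \<le> e * norm d" by (simp add: mult.commute)
      show "(f has_derivative (\<lambda>d. d \<bullet> grad f x)) (at x)"
        using elim x by (intro C1_onD_derivative[OF f]) auto
    qed (rule bounded_linear_inner_left)
    then show ?case by (auto simp: real_norm_def)
  qed
qed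

text \<open>Pointwise continuity of \<open>hess f\<close> on basis vectors gives continuity in operator norm, because
  the dimension is finite.\<close>

lemma C2_strict_differentiability:
  fixes f :: "'a::euclidean_space \<Rightarrow> real"
  assumes U: "open U" "z0 \<in> U" and f: "C2_on U f" and e: "e > 0"
  shows "\<forall>\<^sub>F r in at_right 0. \<forall>y\<in>cball z0 r. \<forall>z\<in>cball z0 r.
           norm (grad f y - grad f z - hess f z0 (y - z)) \<le> e * norm (y - z)"
proof -
  define e' where "e' = e / DIM('a)"
  have e': "e' > 0" using e by (simp add: e'_def)
  have "((\<lambda>y. hess f y b) \<longlongrightarrow> hess f z0 b) (nhds z0)" for b
    using f U unfolding C2_on_def
    by (metis (no_types, lifting) continuous_on_eq_continuous_at isCont_def tendsto_at_iff_tendsto_nhds)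
  then have "\<forall>\<^sub>F y in nhds z0. y \<in> U \<and> (\<forall>b\<in>Basis. dist (hess f y b) (hess f z0 b) < e')"
    using U e' by (intro eventually_conj eventually_nhds_in_open eventually_ball_finite) (auto dest: tendstoD)
  from eventually_cball_at_right[OF this] show ?thesis
  proof eventually_elim
    case (elim r)
    show ?case
    proof (intro ballI)
      fix y z assume yz: "y \<in> cball z0 r" "z \<in> cball z0 r"
      show "norm (grad f y - grad f z - hess f z0 (y - z)) \<le> e * norm (y - z)"
      proof (rule linearization_bound[of z0 r "grad f" "hess f", OF _ _ _ yz])
        fix x d assume x: "x \<in> cball z0 r"
        then have xU: "x \<in> U" using elim by blast
        show "(grad f has_derivative hess f x) (at x)"
          using C2_onD(3)[OF f xU] .
        have lin: "linear (\<lambda>d. hess f x d - hess f z0 d)"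
          using linear_hess[OF f xU] linear_hess[OF f U(2)] by (rule linear_compose_sub)
        have "hess f x d - hess f z0 d = (\<lambda>d. hess f x d - hess f z0 d) (\<Sum>b\<in>Basis. (d \<bullet> b) *\<^sub>R b)"
          by (simp add: euclidean_representation)
        also have "\<dots> = (\<Sum>b\<in>Basis. (d \<bullet> b) *\<^sub>R (hess f x b - hess f z0 b))"
          unfolding linear_sum[OF lin] by (simp only: linear_cmul[OF lin])
        finally have "norm (hess f x d - hess f z0 d) \<le> (\<Sum>b\<in>Basis. norm ((d \<bullet> b) *\<^sub>R (hess f x b - hess f z0 b)))"
          by (simp only: norm_sum)
        also have "\<dots> \<le> (\<Sum>b\<in>(Basis::'a set). norm d * e')"
        proof (rule sum_mono)
          fix b :: 'a assume b: "b \<in> Basis"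
          then have "norm (hess f x b - hess f z0 b) \<le> e'"
            using elim x by (auto simp: dist_norm less_imp_le)
          then show "norm ((d \<bullet> b) *\<^sub>R (hess f x b - hess f z0 b)) \<le> norm d * e'"
            using Basis_le_norm[OF b, of d] by (auto intro: mult_mono)
        qed
        also have "\<dots> = e * norm d" by (simp add: e'_def)
        finally show "norm (hess f x d - hess f z0 d) \<le> e * norm d" .
      qed (use linear_hess[OF f U(2)] linear_conv_bounded_linear in blast)
    qed
  qed
qed

text \<open>Taylor's lower bound: a derivative close to a linear map \<open>H\<close> integrates along segments to the
  quadratic form of \<open>H\<close>.\<close>

lemma quadratic_lower_bound:
  fixes f :: "'a::euclidean_space \<Rightarrow> real"
  assumes f: "\<And>y. y \<in> cball z0 r \<Longrightarrow> (f has_derivative (\<lambda>d. d \<bullet> G y)) (at y)"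
    and H: "linear H"
    and e: "\<And>y. y \<in> cball z0 r \<Longrightarrow> norm (G y - H (y - z0)) \<le> e * norm (y - z0)"
    and z: "z \<in> cball z0 r"
  shows "f z - f z0 \<ge> ((z - z0) \<bullet> H (z - z0) - e * (norm (z - z0))\<^sup>2) / 2"
proof -
  define d where "d = z - z0"
  define q where "q = d \<bullet> H d - e * (norm d)\<^sup>2"
  define p where "p s = f (z0 + s *\<^sub>R d) - s\<^sup>2 / 2 * q" for s :: real
  have "p 0 \<le> p 1"
  proof (rule DERIV_nonneg_imp_nondecreasing[where f = p and a = 0 and b = 1])
    fix s :: real assume s: "0 \<le> s" "s \<le> 1"
    define y where "y = z0 + s *\<^sub>R d"
    have "s * norm d \<le> 1 * norm d" using s by (intro mult_right_mono) auto
    then have y: "y \<in> cball z0 r"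
      using z s by (auto simp: y_def d_def dist_norm norm_minus_commute)
    have "((\<lambda>s. f (z0 + s *\<^sub>R d)) has_derivative (\<lambda>u. (u *\<^sub>R d) \<bullet> G y)) (at s)"
    proof (rule has_derivative_compose[where g=f and f="\<lambda>s. z0 + s *\<^sub>R d"])
      show "((\<lambda>s. z0 + s *\<^sub>R d) has_derivative (\<lambda>u. u *\<^sub>R d)) (at s)"
        by (auto intro!: derivative_eq_intros)
      show "(f has_derivative (\<lambda>d. d \<bullet> G y)) (at (z0 + s *\<^sub>R d))"
        using f[OF y] by (simp add: y_def)
    qed
    then have "((\<lambda>s. f (z0 + s *\<^sub>R d)) has_real_derivative d \<bullet> G y) (at s)"
      by (simp add: has_field_derivative_def mult_commute_abs)
    then have p': "(p has_real_derivative d \<bullet> G y - s * q) (at s)"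
      unfolding p_def by (auto intro!: derivative_eq_intros)
    have Hy: "H (y - z0) = s *\<^sub>R H d"
      using H by (simp add: y_def linear_cmul)
    have "\<bar>d \<bullet> (G y - H (y - z0))\<bar> \<le> norm d * norm (G y - H (y - z0))"
      by (rule Cauchy_Schwarz_ineq2)
    also have "\<dots> \<le> norm d * (e * norm (y - z0))"
      using e[OF y] by (intro mult_left_mono) auto
    also have "\<dots> = s * (e * (norm d)\<^sup>2)"
      using s by (simp add: y_def power2_eq_square)
    finally have "d \<bullet> G y - s * q \<ge> 0"
      unfolding Hy q_def by (simp add: inner_diff_right algebra_simps abs_le_iff)
    with p' show "\<exists>y. (p has_real_derivative y) (at s) \<and> 0 \<le> y" by blast
  qed simp
  then have "f z0 \<le> f z - q / 2" by (simp add: p_def d_def)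
  then show ?thesis unfolding q_def d_def by linarith
qed

section \<open>Linearly independent families\<close>

lemma lin_indep_family_dual:
  fixes a :: "'k \<Rightarrow> 'a::euclidean_space"
  assumes I: "finite I" and a: "lin_indep_family I a"
  obtains b where "\<And>k l. k \<in> I \<Longrightarrow> l \<in> I \<Longrightarrow> b k \<bullet> a l = (if k = l then 1 else 0)"
proof -
  have "\<exists>v. \<forall>l\<in>I. v \<bullet> a l = (if k = l then 1 else 0)" if k: "k \<in> I" for k
  proof -
    define S where "S = (\<lambda>s. \<Sum>l\<in>I-{k}. s l *\<^sub>R a l) ` (UNIV :: ('k \<Rightarrow> real) set)"
    have sub: "subspace S"
      unfolding subspace_def S_def
    proof (intro conjI ballI allI)
      show "0 \<in> range (\<lambda>s. \<Sum>l\<in>I-{k}. s l *\<^sub>R a l)"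
        by (rule image_eqI[of _ _ "\<lambda>_. 0"]) auto
    next
      fix x y assume "x \<in> range (\<lambda>s. \<Sum>l\<in>I-{k}. s l *\<^sub>R a l)" "y \<in> range (\<lambda>s. \<Sum>l\<in>I-{k}. s l *\<^sub>R a l)"
      then obtain s t where "x = (\<Sum>l\<in>I-{k}. s l *\<^sub>R a l)" "y = (\<Sum>l\<in>I-{k}. t l *\<^sub>R a l)" by auto
      then show "x + y \<in> range (\<lambda>s. \<Sum>l\<in>I-{k}. s l *\<^sub>R a l)"
        by (intro image_eqI[of _ _ "\<lambda>l. s l + t l"]) (auto simp: scaleR_left_distrib sum.distrib)
    next
      fix c :: real and x assume "x \<in> range (\<lambda>s. \<Sum>l\<in>I-{k}. s l *\<^sub>R a l)"
      then obtain s where "x = (\<Sum>l\<in>I-{k}. s l *\<^sub>R a l)" by auto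
      then show "c *\<^sub>R x \<in> range (\<lambda>s. \<Sum>l\<in>I-{k}. s l *\<^sub>R a l)"
        by (intro image_eqI[of _ _ "\<lambda>l. c * s l"]) (auto simp: scaleR_sum_right)
    qed
    obtain y v where y: "y \<in> span S" and v: "\<And>w. w \<in> span S \<Longrightarrow> orthogonal v w"
      and yv: "a k = y + v"
      using orthogonal_subspace_decomp_exists[of S "a k"] by metis
    have spanS: "span S = S" using sub by (rule span_eq_iff[THEN iffD2])
    have "v \<noteq> 0"
    proof
      assume "v = 0"
      then have "a k \<in> S" using y yv spanS by simp
      then obtain s where s: "a k = (\<Sum>l\<in>I-{k}. s l *\<^sub>R a l)"
        unfolding S_def by blast
      define t where "t = s(k := -1)"
      have "(\<Sum>l\<in>I. t l *\<^sub>R a l) = t k *\<^sub>R a k + (\<Sum>l\<in>I-{k}. t l *\<^sub>R a l)"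
        using I k by (rule sum.remove)
      also have "(\<Sum>l\<in>I-{k}. t l *\<^sub>R a l) = (\<Sum>l\<in>I-{k}. s l *\<^sub>R a l)"
        by (rule sum.cong) (auto simp: t_def)
      finally have "(\<Sum>l\<in>I. t l *\<^sub>R a l) = 0" using s by (simp add: t_def)
      then have "t k = 0" using a k unfolding lin_indep_family_def by blast
      then show False by (simp add: t_def)
    qed
    have "v \<bullet> a l = 0" if "l \<in> I" "l \<noteq> k" for l
    proof -
      have "a l = (\<Sum>j\<in>I-{k}. (if j = l then 1 else 0) *\<^sub>R a j)"
        using that I by (subst sum.remove[of _ l]) (auto intro!: sum.neutral)
      then have "a l \<in> S" unfolding S_def by (intro image_eqI[of _ _ "\<lambda>j. if j = l then 1 else 0"]) auto
      then show ?thesis using v spanS by (auto simp: orthogonal_def)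
    qed
    moreover have "v \<bullet> a k = v \<bullet> v"
      using v[OF y] yv by (simp add: inner_add_right orthogonal_def)
    ultimately show ?thesis
      using \<open>v \<noteq> 0\<close> by (intro exI[of _ "v /\<^sub>R (v \<bullet> v)"]) auto
  qed
  then obtain b where "\<forall>k\<in>I. \<forall>l\<in>I. b k \<bullet> a l = (if k = l then 1 else 0)" by metis
  then show ?thesis using that by blast
qed

lemma dual_coefficient:
  assumes "finite I" "\<And>l. l \<in> I \<Longrightarrow> b k \<bullet> a l = (if k = l then 1 else 0)" "k \<in> I"
  shows "b k \<bullet> (\<Sum>l\<in>I. m l *\<^sub>R a l) = (m k :: real)"
proof -
  have "b k \<bullet> (\<Sum>l\<in>I. m l *\<^sub>R a l) = (\<Sum>l\<in>I. if k = l then m l else 0)"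
    unfolding inner_sum_right by (rule sum.cong) (auto simp: assms(2))
  then show ?thesis using assms by simp
qed

text \<open>Testing the relation with the dual vectors bounds the coefficients, and the bound survives a
  small perturbation of the family.  For \<open>v = 0\<close> this is the stability of linear independence.\<close>

lemma perturbed_coefficients_bound:
  fixes a :: "'k \<Rightarrow> 'a::euclidean_space"
  assumes I: "finite I"
    and b: "\<And>k l. k \<in> I \<Longrightarrow> l \<in> I \<Longrightarrow> b k \<bullet> a l = (if k = l then 1 else 0)"
    and beta: "(\<Sum>k\<in>I. norm (b k)) \<le> \<beta>" "\<beta> * e \<le> 1 / 2"
    and near: "\<And>k. k \<in> I \<Longrightarrow> norm (a' k - a k) \<le> e"
    and eq: "v + (\<Sum>k\<in>I. m k *\<^sub>R a' k) = 0"
  shows "(\<Sum>k\<in>I. \<bar>m k\<bar>) \<le> 2 * \<beta> * norm v"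
proof -
  define M where "M = (\<Sum>k\<in>I. \<bar>m k\<bar>)"
  have "(\<Sum>k\<in>I. norm (b k)) \<ge> 0" by (intro sum_nonneg) auto
  with beta have "\<beta> \<ge> 0" by simp
  have M0: "M \<ge> 0" by (auto simp: M_def intro: sum_nonneg)
  define u where "u = v + (\<Sum>k\<in>I. m k *\<^sub>R (a' k - a k))"
  have u: "(\<Sum>k\<in>I. m k *\<^sub>R a k) = - u"
    using eq by (simp add: u_def scaleR_diff_right sum_subtractf algebra_simps eq_neg_iff_add_eq_0)
  have "norm (\<Sum>k\<in>I. m k *\<^sub>R (a' k - a k)) \<le> (\<Sum>k\<in>I. \<bar>m k\<bar> * e)"
    by (rule sum_norm_le) (auto intro: mult_left_mono near)
  also have "\<dots> = M * e" by (simp add: M_def sum_distrib_right)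
  finally have nu: "norm u \<le> norm v + M * e"
    unfolding u_def by (meson add_left_mono norm_triangle_le)
  have "\<bar>m k\<bar> \<le> norm (b k) * norm u" if "k \<in> I" for k
  proof -
    have "m k = b k \<bullet> (- u)"
      unfolding u[symmetric] using dual_coefficient[of I b k a m] I b that by simp
    then show ?thesis using Cauchy_Schwarz_ineq2[of "b k" "-u"] by simp
  qed
  then have "M \<le> (\<Sum>k\<in>I. norm (b k)) * norm u"
    unfolding M_def sum_distrib_right by (rule sum_mono)
  also have "\<dots> \<le> \<beta> * (norm v + M * e)"
    using beta nu \<open>\<beta> \<ge> 0\<close> by (intro mult_mono) auto
  also have "\<dots> = \<beta> * norm v + (\<beta> * e) * M" by (simp add: algebra_simps)
  also have "\<dots> \<le> \<beta> * norm v + 1 / 2 * M"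
    using beta M0 by (intro add_left_mono mult_right_mono)
  finally show ?thesis by (simp add: M_def)
qed

section \<open>Penalty on compact sets and Lagrange multipliers\<close>

text \<open>A penalty term that vanishes only where \<open>q\<close> is positive lifts \<open>q\<close> above a positive constant.
  On the part of \<open>X\<close> where \<open>q \<le> 0\<close> the penalty is bounded away from zero.\<close>

lemma compact_penalty:
  fixes q s :: "'x::t2_space \<Rightarrow> real"
  assumes X: "compact X" and q: "continuous_on X q" and s: "continuous_on X s"
    and s0: "\<And>x. x \<in> X \<Longrightarrow> s x \<ge> 0" and pos: "\<And>x. x \<in> X \<Longrightarrow> s x = 0 \<Longrightarrow> q x > 0"
  obtains \<rho> \<gamma> where "\<rho> \<ge> 0" "\<gamma> > 0" "\<And>x. x \<in> X \<Longrightarrow> q x + \<rho> * s x \<ge> \<gamma>"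
proof -
  have positive: "\<exists>\<rho>\<ge>0. \<forall>x\<in>X. q x + \<rho> * s x > 0"
  proof (cases "{x \<in> X. q x \<le> 0} = {}")
    case True
    then show ?thesis by (intro exI[of _ 0]) (auto simp: not_le)
  next
    case False
    let ?Y = "{x \<in> X. q x \<le> 0}"
    have "closed ?Y"
      using X q by (intro continuous_on_closed_Collect_le compact_imp_closed) auto
    then have "compact (X \<inter> ?Y)" using X by (rule compact_Int_closed[rotated])
    moreover have "X \<inter> ?Y = ?Y" by auto
    ultimately have Y: "compact ?Y" by simp
    obtain x1 where x1: "x1 \<in> ?Y" "\<And>x. x \<in> ?Y \<Longrightarrow> s x1 \<le> s x"
      using continuous_attains_inf[OF Y False continuous_on_subset[OF s]] by auto
    obtain x2 where x2: "x2 \<in> ?Y" "\<And>x. x \<in> ?Y \<Longrightarrow> q x2 \<le> q x"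
      using continuous_attains_inf[OF Y False continuous_on_subset[OF q]] by auto
    have s1: "s x1 > 0" using x1(1) s0[of x1] pos[of x1] by (auto simp: order_less_le)
    define \<rho> where "\<rho> = (1 - q x2) / s x1"
    have r: "\<rho> \<ge> 0" using s1 x2(1) by (auto simp: \<rho>_def)
    moreover have "q x + \<rho> * s x > 0" if "x \<in> X" for x
    proof (cases "q x \<le> 0")
      case True
      have "\<rho> * s x1 \<le> \<rho> * s x" using x1(2) True that r by (intro mult_left_mono) auto
      moreover have "\<rho> * s x1 = 1 - q x2" using s1 by (simp add: \<rho>_def)
      ultimately show ?thesis using x2(2)[of x] True that by auto
    next
      case False
      then show ?thesis using r s0[OF that] by (auto intro!: add_pos_nonneg)
    qed
    ultimately show ?thesis by blast
  qed
  then obtain \<rho> where r: "\<rho> \<ge> 0" "\<And>x. x \<in> X \<Longrightarrow> q x + \<rho> * s x > 0" by blast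
  show ?thesis
  proof (cases "X = {}")
    case True
    then show ?thesis using that[of 0 1] by auto
  next
    case False
    have "continuous_on X (\<lambda>x. q x + \<rho> * s x)" by (intro continuous_intros q s)
    then obtain x0 where "x0 \<in> X" "\<And>x. x \<in> X \<Longrightarrow> q x0 + \<rho> * s x0 \<le> q x + \<rho> * s x"
      using continuous_attains_inf[OF X False] by blast
    then show ?thesis using that[of \<rho> "q x0 + \<rho> * s x0"] r by auto
  qed
qed

text \<open>On a small sphere around \<open>z\<close> the proximal term makes \<open>F\<close> exceed \<open>F z\<close> on the constraint set, so
  a large quadratic penalty forces the minimizer over the ball into its interior.\<close>

lemma penalized_stationary_point:
  fixes F :: "'a::euclidean_space \<Rightarrow> real"
  assumes C: "finite C" and d: "\<delta> > 0" "cball z \<delta> \<subseteq> U"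
    and F: "C1_on U F" and h: "\<And>c. c \<in> C \<Longrightarrow> C1_on U (h c)"
    and hz: "\<And>c. c \<in> C \<Longrightarrow> h c z = 0"
    and min: "\<And>y. y \<in> U \<Longrightarrow> (\<And>c. c \<in> C \<Longrightarrow> h c y = 0) \<Longrightarrow> F z \<le> F y"
  obtains y m where "y \<in> ball z \<delta>"
    "(grad F y + 2 *\<^sub>R (y - z)) + (\<Sum>c\<in>C. m c *\<^sub>R grad (h c) y) = 0"
proof -
  define q where "q y = F y - F z + (y - z) \<bullet> (y - z)" for y
  define s where "s y = (\<Sum>c\<in>C. (h c y)\<^sup>2)" for y
  have contF: "continuous_on (cball z \<delta>) F" and conth: "\<And>c. c \<in> C \<Longrightarrow> continuous_on (cball z \<delta>) (h c)"
    using F h d(2) by (blast intro: continuous_on_subset C1_on_continuous)+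
  have q: "continuous_on (cball z \<delta>) q" and s: "continuous_on (cball z \<delta>) s"
    unfolding q_def s_def by (intro continuous_intros contF conth; assumption)+
  have s_sphere: "q y > 0" if y: "y \<in> sphere z \<delta>" "s y = 0" for y
  proof -
    have "h c y = 0" if "c \<in> C" for c
      using y C that by (auto simp: s_def sum_nonneg_eq_0_iff)
    moreover have "y \<in> U" using y d by auto
    ultimately have "F z \<le> F y" by (intro min)
    moreover have "y \<noteq> z" using y d by auto
    ultimately show ?thesis by (auto simp: q_def add_nonneg_pos)
  qed
  obtain \<rho> \<gamma> where rg: "\<rho> \<ge> 0" "\<gamma> > 0" "\<And>y. y \<in> sphere z \<delta> \<Longrightarrow> q y + \<rho> * s y \<ge> \<gamma>"
  proof (rule compact_penalty[of "sphere z \<delta>" q s])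
    show "continuous_on (sphere z \<delta>) q" "continuous_on (sphere z \<delta>) s"
      using q s by (auto intro: continuous_on_subset)
  qed (use s_sphere in \<open>auto simp: s_def intro: sum_nonneg\<close>)
  have "continuous_on (cball z \<delta>) (\<lambda>x. q x + \<rho> * s x)"
    by (intro continuous_intros q s)
  moreover have "cball z \<delta> \<noteq> {}" using d by auto
  ultimately obtain y where y: "y \<in> cball z \<delta>"
      "\<And>x. x \<in> cball z \<delta> \<Longrightarrow> q y + \<rho> * s y \<le> q x + \<rho> * s x"
    using continuous_attains_inf[OF compact_cball] by blast
  have "q y + \<rho> * s y \<le> 0"
    using y(2)[of z] d C hz by (simp add: q_def s_def)
  then have "y \<notin> sphere z \<delta>" using rg(2,3) by force
  then have yb: "y \<in> ball z \<delta>" using y by auto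
  have yU: "y \<in> U" using y d by auto
  have "((\<lambda>x. q x + \<rho> * s x) has_derivative
      (\<lambda>v. v \<bullet> grad F y + ((y - z) \<bullet> v + v \<bullet> (y - z)) + \<rho> * (\<Sum>c\<in>C. 2 * (v \<bullet> grad (h c) y) * h c y))) (at y)"
    unfolding q_def s_def
    by (auto intro!: derivative_eq_intros C1_onD_derivative[OF F yU] C1_onD_derivative[OF h yU])
  then have "(\<lambda>v. v \<bullet> grad F y + ((y - z) \<bullet> v + v \<bullet> (y - z)) + \<rho> * (\<Sum>c\<in>C. 2 * (v \<bullet> grad (h c) y) * h c y)) = (\<lambda>v. 0)"
    by (rule differential_zero_maxmin[OF yb open_ball]) (use y(2) in auto)
  then have v0: "v \<bullet> grad F y + ((y - z) \<bullet> v + v \<bullet> (y - z)) + \<rho> * (\<Sum>c\<in>C. 2 * (v \<bullet> grad (h c) y) * h c y) = 0" for v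
    by meson
  have "v \<bullet> (grad F y + 2 *\<^sub>R (y - z) + (\<Sum>c\<in>C. (2 * \<rho> * h c y) *\<^sub>R grad (h c) y)) = 0" for v
  proof -
    have "\<rho> * (\<Sum>c\<in>C. 2 * (v \<bullet> grad (h c) y) * h c y) = v \<bullet> (\<Sum>c\<in>C. (2 * \<rho> * h c y) *\<^sub>R grad (h c) y)"
      unfolding inner_sum_right sum_distrib_left by (intro sum.cong) (auto simp: mult_ac)
    then show ?thesis using v0[of v] by (simp add: inner_add_right inner_commute[of "y - z" v])
  qed
  then have "(grad F y + 2 *\<^sub>R (y - z)) + (\<Sum>c\<in>C. (2 * \<rho> * h c y) *\<^sub>R grad (h c) y) = 0"
    by (metis inner_eq_zero_iff)
  with yb show ?thesis by (rule that)
qed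

text \<open>As the ball shrinks, the multipliers of the penalized stationary points stay bounded by
  linear independence.  The oblique projection \<open>P\<close> along the gradients \<open>grad (h c) z\<close> annihilates
  their contribution in the limit and leaves \<open>P (grad F z) = 0\<close>.\<close>

theorem lagrange_multipliers:
  fixes F :: "'a::euclidean_space \<Rightarrow> real"
  assumes C: "finite C" and U: "open U" "z \<in> U"
    and F: "C1_on U F" and h: "\<And>c. c \<in> C \<Longrightarrow> C1_on U (h c)"
    and licq: "lin_indep_family C (\<lambda>c. grad (h c) z)"
    and hz: "\<And>c. c \<in> C \<Longrightarrow> h c z = 0"
    and min: "\<And>y. y \<in> U \<Longrightarrow> (\<And>c. c \<in> C \<Longrightarrow> h c y = 0) \<Longrightarrow> F z \<le> F y"
  shows "\<exists>\<mu>. grad F z + (\<Sum>c\<in>C. \<mu> c *\<^sub>R grad (h c) z) = 0"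
proof -
  obtain b where b: "\<And>k l. k \<in> C \<Longrightarrow> l \<in> C \<Longrightarrow> b k \<bullet> grad (h l) z = (if k = l then 1 else 0)"
    using lin_indep_family_dual[OF C licq] by blast
  define \<beta> where "\<beta> = (\<Sum>c\<in>C. norm (b c))"
  have b0: "\<beta> \<ge> 0" by (auto simp: \<beta>_def intro: sum_nonneg)
  define P where "P v = v - (\<Sum>c\<in>C. (b c \<bullet> v) *\<^sub>R grad (h c) z)" for v
  define \<pi> where "\<pi> = 1 + (\<Sum>c\<in>C. norm (b c) * norm (grad (h c) z))"
  have P_lin: "linear P"
    unfolding P_def by (intro linearI)
      (simp_all add: inner_add_right scaleR_left_distrib sum.distrib scaleR_diff_right scaleR_sum_right)
  have P_norm: "norm (P v) \<le> \<pi> * norm v" for v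
  proof -
    have "norm (\<Sum>c\<in>C. (b c \<bullet> v) *\<^sub>R grad (h c) z) \<le> (\<Sum>c\<in>C. norm (b c) * norm (grad (h c) z) * norm v)"
    proof (rule sum_norm_le)
      fix c
      have "\<bar>b c \<bullet> v\<bar> * norm (grad (h c) z) \<le> (norm (b c) * norm v) * norm (grad (h c) z)"
        by (intro mult_right_mono Cauchy_Schwarz_ineq2) auto
      then show "norm ((b c \<bullet> v) *\<^sub>R grad (h c) z) \<le> norm (b c) * norm (grad (h c) z) * norm v"
        by (simp add: mult_ac)
    qed
    then have "norm (P v) \<le> norm v + (\<Sum>c\<in>C. norm (b c) * norm (grad (h c) z) * norm v)"
      unfolding P_def by (meson add_left_mono norm_triangle_ineq4 order_trans)
    then show ?thesis by (simp add: \<pi>_def algebra_simps sum_distrib_left)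
  qed
  have pi0: "\<pi> \<ge> 0" by (auto simp: \<pi>_def intro!: add_nonneg_nonneg sum_nonneg)
  have P_grad: "P (grad (h c) z) = 0" if "c \<in> C" for c
  proof -
    have "(\<Sum>l\<in>C. (b l \<bullet> grad (h c) z) *\<^sub>R grad (h l) z) = (\<Sum>l\<in>C. if l = c then grad (h l) z else 0)"
      by (rule sum.cong) (auto simp: b that)
    then show ?thesis using C that by (simp add: P_def)
  qed
  define R where "R = 2 * \<beta> * (norm (grad F z) + 2)"
  have R0: "R \<ge> 0" using b0 by (auto simp: R_def intro!: mult_nonneg_nonneg)
  have small: "norm (P (grad F z)) \<le> (\<pi> * (2 + R)) * e" if e: "e > 0" "e \<le> 1" "\<beta> * e \<le> 1 / 2" for e
  proof -
    have lim: "(grad f \<longlongrightarrow> grad f z) (nhds z)" if "C1_on U f" for f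
      using that U unfolding C1_on_def
      by (metis continuous_on_eq_continuous_at isCont_def tendsto_at_iff_tendsto_nhds)
    have "\<forall>\<^sub>F y in nhds z. \<forall>c\<in>C. dist (grad (h c) y) (grad (h c) z) < e"
    proof (rule eventually_ball_finite[OF C], rule ballI)
      show "\<forall>\<^sub>F y in nhds z. dist (grad (h c) y) (grad (h c) z) < e" if "c \<in> C" for c
        by (rule tendstoD[OF lim[OF h[OF that]] e(1)])
    qed
    moreover have "\<forall>\<^sub>F y in nhds z. dist y z < e / 2"
      unfolding eventually_nhds_metric using e by (intro exI[of _ "e / 2"]) auto
    moreover note tendstoD[OF lim[OF F] e(1)] eventually_nhds_in_open[OF U]
    ultimately have "\<forall>\<^sub>F y in nhds z. y \<in> U \<and> dist y z < e / 2 \<and> dist (grad F y) (grad F z) < e \<and>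
        (\<forall>c\<in>C. dist (grad (h c) y) (grad (h c) z) < e)"
      by eventually_elim blast
    then obtain r where r: "r > 0" and near: "\<And>y. y \<in> cball z r \<Longrightarrow> y \<in> U \<and> dist y z < e / 2 \<and>
        dist (grad F y) (grad F z) < e \<and> (\<forall>c\<in>C. dist (grad (h c) y) (grad (h c) z) < e)"
      unfolding eventually_nhds_metric_le by (auto simp: dist_commute)
    have rU: "cball z r \<subseteq> U" using near by blast
    obtain y m where y: "y \<in> ball z r"
      and eq: "(grad F y + 2 *\<^sub>R (y - z)) + (\<Sum>c\<in>C. m c *\<^sub>R grad (h c) y) = 0"
      using penalized_stationary_point[of C r z U F h, OF C r rU F h hz min] .
    have yn: "norm (y - z) \<le> e / 2" "norm (grad F y - grad F z) \<le> e"
        "\<And>c. c \<in> C \<Longrightarrow> norm (grad (h c) y - grad (h c) z) \<le> e"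
      using near[of y] y by (auto simp: dist_norm less_imp_le)
    define w where "w = (grad F y - grad F z) + 2 *\<^sub>R (y - z)"
    have w: "norm w \<le> 2 * e"
      unfolding w_def using yn by (intro norm_triangle_le) auto
    have eqw: "grad F z + w = grad F y + 2 *\<^sub>R (y - z)" by (simp add: w_def)
    have "(\<Sum>c\<in>C. \<bar>m c\<bar>) \<le> 2 * \<beta> * norm (grad F z + w)"
      by (rule perturbed_coefficients_bound[of C b "\<lambda>c. grad (h c) z" \<beta> e "\<lambda>c. grad (h c) y"])
        (use C b yn e eq eqw \<beta>_def in auto)
    also have "\<dots> \<le> R"
      unfolding R_def using b0 w e norm_triangle_ineq[of "grad F z" w] by (intro mult_left_mono) auto
    finally have m: "(\<Sum>c\<in>C. \<bar>m c\<bar>) \<le> R" .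
    define u where "u = (\<Sum>c\<in>C. m c *\<^sub>R (grad (h c) y - grad (h c) z))"
    have "norm u \<le> (\<Sum>c\<in>C. \<bar>m c\<bar> * e)"
      unfolding u_def by (rule sum_norm_le) (auto intro: mult_left_mono yn)
    also have "\<dots> \<le> R * e"
      unfolding sum_distrib_right[symmetric] using m e by (intro mult_right_mono) auto
    finally have u: "norm u \<le> R * e" .
    have "P (\<Sum>c\<in>C. m c *\<^sub>R grad (h c) z) = 0"
      by (simp add: linear_sum[OF P_lin] linear_cmul[OF P_lin] P_grad)
    moreover have "grad F z + (\<Sum>c\<in>C. m c *\<^sub>R grad (h c) z) = - (w + u)"
      using eq unfolding eqw[symmetric] u_def
      by (simp add: scaleR_diff_right sum_subtractf algebra_simps eq_neg_iff_add_eq_0)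
    then have "P (grad F z + (\<Sum>c\<in>C. m c *\<^sub>R grad (h c) z)) = P (- (w + u))" by simp
    ultimately have "P (grad F z) = P (- (w + u))"
      by (simp only: linear_add[OF P_lin]) simp
    then have "norm (P (grad F z)) \<le> \<pi> * norm (w + u)"
      using P_norm[of "- (w + u)"] by (simp only: norm_minus_cancel)
    also have "\<dots> \<le> \<pi> * ((2 + R) * e)"
      using w u pi0 norm_triangle_ineq[of w u] by (intro mult_left_mono) (auto simp: algebra_simps)
    finally show ?thesis by (simp add: mult.assoc)
  qed
  have "norm (P (grad F z)) \<le> 0"
  proof (rule field_le_epsilon)
    fix x :: real assume x: "x > 0"
    define D where "D = \<pi> * (2 + R)"
    have D: "D \<ge> 0" using pi0 R0 by (simp add: D_def)
    define e where "e = min 1 (min (1 / (2 * (\<beta> + 1))) (x / (D + 1)))"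
    have e: "e > 0" "e \<le> 1" "e \<le> 1 / (2 * (\<beta> + 1))" "e \<le> x / (D + 1)"
      using x D b0 by (auto simp: e_def)
    have "\<beta> * e \<le> \<beta> * (1 / (2 * (\<beta> + 1)))" using e b0 by (intro mult_left_mono)
    also have "\<dots> \<le> 1 / 2" using b0 by (simp add: field_simps)
    finally have "norm (P (grad F z)) \<le> D * e" unfolding D_def using small[of e] e by simp
    also have "\<dots> \<le> D * (x / (D + 1))" using e D by (intro mult_left_mono)
    also have "\<dots> \<le> x" using D x by (simp add: field_simps)
    finally show "norm (P (grad F z)) \<le> 0 + x" by simp
  qed
  then have "grad F z + (\<Sum>c\<in>C. (- (b c \<bullet> grad F z)) *\<^sub>R grad (h c) z) = 0"
    by (simp add: P_def sum_negf)
  then show ?thesis by (rule exI[of _ "\<lambda>c. - (b c \<bullet> grad F z)"])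
qed

section \<open>The penalty method for a regular parametrized problem\<close>

lemma compact_family_bound:
  fixes f :: "'k \<Rightarrow> 'w::topological_space \<Rightarrow> real"
  assumes W: "compact W" and f: "\<And>k. k \<in> I \<Longrightarrow> continuous_on W (f k)"
  shows "\<exists>N\<ge>0. \<forall>w\<in>W. (\<Sum>k\<in>I. \<bar>f k w\<bar>) \<le> N"
proof -
  have "continuous_on W (\<lambda>w. \<Sum>k\<in>I. \<bar>f k w\<bar>)" by (intro continuous_intros f)
  then have "bounded ((\<lambda>w. \<Sum>k\<in>I. \<bar>f k w\<bar>) ` W)"
    using W compact_continuous_image compact_imp_bounded by blast
  then obtain N where "\<And>w. w \<in> W \<Longrightarrow> norm (\<Sum>k\<in>I. \<bar>f k w\<bar>) \<le> N"
    unfolding bounded_iff by blast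
  then have "(\<Sum>k\<in>I. \<bar>f k w\<bar>) \<le> max 0 N" if "w \<in> W" for w
    using that by (fastforce simp: le_max_iff_disj)
  then show ?thesis by (intro exI[of _ "max 0 N"]) simp
qed

lemma DERIV_squared_hinge: "((\<lambda>x. (max 0 x)\<^sup>2) has_real_derivative 2 * max 0 x) (at x)"
proof -
  consider "x < 0" | "x > 0" | "x = 0" by linarith
  then show ?thesis
  proof cases
    case 1
    have "((\<lambda>x. 0) has_real_derivative 2 * max 0 x) (at x)" using 1 by (auto intro!: derivative_eq_intros)
    then show ?thesis
      by (rule has_field_derivative_transform_within_open[of _ _ _ "{..<0}"]) (use 1 in auto)
  next
    case 2
    have "((\<lambda>x. x\<^sup>2) has_real_derivative 2 * max 0 x) (at x)" using 2 by (auto intro!: derivative_eq_intros)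
    then show ?thesis
      by (rule has_field_derivative_transform_within_open[of _ _ _ "{0<..}"]) (use 2 in auto)
  next
    case 3
    have "((\<lambda>h. (max 0 h)\<^sup>2 / h) \<longlongrightarrow> 0) (at (0::real))"
    proof (rule Lim_null_comparison)
      have "norm ((max 0 h)\<^sup>2 / h) \<le> \<bar>h\<bar>" for h :: real
        by (cases "h > 0") (auto simp: max_def power2_eq_square)
      then show "\<forall>\<^sub>F h in at 0. norm ((max 0 h)\<^sup>2 / h) \<le> \<bar>h\<bar>" by simp
      show "(abs \<longlongrightarrow> 0) (at (0::real))" by (auto intro!: tendsto_eq_intros)
    qed
    then show ?thesis unfolding 3 DERIV_def by simp
  qed
qed

text \<open>
  The local problem without control-theoretic structure: minimize \<open>\<Psi> w\<close> subject to \<open>c k z = 0\<close> for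
  \<open>k \<in> I - B\<close> and \<open>c k z \<le> 0\<close> for \<open>k \<in> B\<close>, where the constraints of \<open>B\<close> are to be replaced by a
  penalty.  The representation of \<open>\<Psi> w\<close> through finitely many fixed functions \<open>\<phi> p\<close> with
  continuous coefficients is what makes the Hessians jointly continuous in \<open>w\<close> and \<open>z\<close>; continuity in
  \<open>z\<close> alone, for each \<open>w\<close>, would not give estimates uniform over \<open>W\<close>.
\<close>

locale regular_penalty =
  fixes U :: "'a::euclidean_space set" and z0 :: 'a
    and \<Psi> :: "'w::t2_space \<Rightarrow> 'a \<Rightarrow> real" and W :: "'w set"
    and P :: "'p set" and \<phi> :: "'p \<Rightarrow> 'a \<Rightarrow> real" and t :: "'p \<Rightarrow> 'w \<Rightarrow> real"
    and I B :: "'k set" and c :: "'k \<Rightarrow> 'a \<Rightarrow> real" and \<nu>s :: "'w \<Rightarrow> 'k \<Rightarrow> real"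
  assumes U: "open U" "z0 \<in> U" and W: "compact W" and P: "finite P" and I: "finite I" and BI: "B \<subseteq> I"
    and phi_C2: "\<And>p. p \<in> P \<Longrightarrow> C2_on U (\<phi> p)"
    and t_cont: "\<And>p. p \<in> P \<Longrightarrow> continuous_on W (t p)"
    and Psi_eq: "\<And>w. w \<in> W \<Longrightarrow> \<Psi> w = (\<lambda>z. \<Sum>p\<in>P. t p w * \<phi> p z)"
    and Psi_C2: "\<And>w. w \<in> W \<Longrightarrow> C2_on U (\<Psi> w)"
    and c_C2: "\<And>k. k \<in> I \<Longrightarrow> C2_on U (c k)"
    and c_z0: "\<And>k. k \<in> I \<Longrightarrow> c k z0 = 0"
    and licq: "lin_indep_family I (\<lambda>k. grad (c k) z0)"
    and stationary: "\<And>w. w \<in> W \<Longrightarrow> grad (\<Psi> w) z0 + (\<Sum>k\<in>I. \<nu>s w k *\<^sub>R grad (c k) z0) = 0"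
    and positive: "\<And>w k. w \<in> W \<Longrightarrow> k \<in> B \<Longrightarrow> \<nu>s w k > 0"
    and second_order: "\<And>w d. w \<in> W \<Longrightarrow> d \<noteq> 0 \<Longrightarrow> (\<And>k. k \<in> I \<Longrightarrow> grad (c k) z0 \<bullet> d = 0) \<Longrightarrow>
      d \<bullet> (hess (\<Psi> w) z0 d + (\<Sum>k\<in>I. \<nu>s w k *\<^sub>R hess (c k) z0 d)) > 0"
begin

definition lagr_hess :: "'w \<Rightarrow> 'a \<Rightarrow> 'a" where
  "lagr_hess w d = hess (\<Psi> w) z0 d + (\<Sum>k\<in>I. \<nu>s w k *\<^sub>R hess (c k) z0 d)"

text \<open>For \<open>\<eta> = 1 / \<omega>\<close> the multiplier \<open>\<nu> k = 2 * \<omega> * c k z\<close> of a violated quadratic penalty satisfies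
  the middle equation, and \<open>\<eta> = 0\<close> is the optimality system of the limit problem.  Both regimes are
  thus one family that is regular at \<open>\<eta> = 0\<close>.\<close>

definition kkt :: "'w \<Rightarrow> real \<Rightarrow> 'a \<Rightarrow> ('k \<Rightarrow> real) \<Rightarrow> bool" where
  "kkt w \<eta> z \<nu> \<longleftrightarrow> grad (\<Psi> w) z + (\<Sum>k\<in>I. \<nu> k *\<^sub>R grad (c k) z) = 0 \<and>
     (\<forall>k\<in>B. c k z = \<eta> / 2 * \<nu> k) \<and> (\<forall>k\<in>I - B. c k z = 0)"

definition pen :: "'w \<Rightarrow> real \<Rightarrow> 'a \<Rightarrow> real" where
  "pen w \<omega> z = \<Psi> w z + \<omega> * (\<Sum>k\<in>B. (max 0 (c k z))\<^sup>2)"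

definition surface :: "'a set" where
  "surface = {z \<in> U. \<forall>k\<in>I - B. c k z = 0}"

text \<open>All smallness requirements on the neighbourhood of \<open>z0\<close> are collected in one predicate that is
  monotone in \<open>e\<close>.  Each estimate below supplies its own threshold for \<open>e\<close>, and the minimum of the
  thresholds serves all of them.\<close>

definition linearized :: "real \<Rightarrow> real \<Rightarrow> bool" where
  "linearized e r \<longleftrightarrow> r > 0 \<and> r \<le> e \<and> cball z0 r \<subseteq> U \<and>
     (\<forall>y\<in>cball z0 r. \<forall>z\<in>cball z0 r.
       (\<forall>w\<in>W. norm (grad (\<Psi> w) y - grad (\<Psi> w) z - hess (\<Psi> w) z0 (y - z)) \<le> e * norm (y - z)) \<and>
       (\<forall>k\<in>I. norm (grad (c k) y - grad (c k) z - hess (c k) z0 (y - z)) \<le> e * norm (y - z)) \<and>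
       (\<forall>k\<in>I. \<bar>c k y - c k z - (y - z) \<bullet> grad (c k) z0\<bar> \<le> e * norm (y - z))) \<and>
     (\<forall>y\<in>cball z0 r.
       (\<forall>w\<in>W. norm (grad (\<Psi> w) y - grad (\<Psi> w) z0) \<le> e) \<and>
       (\<forall>k\<in>I. norm (grad (c k) y - grad (c k) z0) \<le> e))"

lemma linearizedD:
  assumes "linearized e r"
  shows "r > 0" "r \<le> e" "cball z0 r \<subseteq> U"
    and "\<And>y z w. y \<in> cball z0 r \<Longrightarrow> z \<in> cball z0 r \<Longrightarrow> w \<in> W \<Longrightarrow>
      norm (grad (\<Psi> w) y - grad (\<Psi> w) z - hess (\<Psi> w) z0 (y - z)) \<le> e * norm (y - z)"
    and "\<And>y z k. y \<in> cball z0 r \<Longrightarrow> z \<in> cball z0 r \<Longrightarrow> k \<in> I \<Longrightarrow>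
      norm (grad (c k) y - grad (c k) z - hess (c k) z0 (y - z)) \<le> e * norm (y - z)"
    and "\<And>y z k. y \<in> cball z0 r \<Longrightarrow> z \<in> cball z0 r \<Longrightarrow> k \<in> I \<Longrightarrow>
      \<bar>c k y - c k z - (y - z) \<bullet> grad (c k) z0\<bar> \<le> e * norm (y - z)"
    and "\<And>y w. y \<in> cball z0 r \<Longrightarrow> w \<in> W \<Longrightarrow> norm (grad (\<Psi> w) y - grad (\<Psi> w) z0) \<le> e"
    and "\<And>y k. y \<in> cball z0 r \<Longrightarrow> k \<in> I \<Longrightarrow> norm (grad (c k) y - grad (c k) z0) \<le> e"
  using assms unfolding linearized_def by blast+

lemma linearized_mono:
  assumes lin: "linearized e r" and e: "e \<le> e'"
  shows "linearized e' r"
proof -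
  have "e * norm x \<le> e' * norm x" for x :: 'a using e by (intro mult_right_mono) auto
  then show ?thesis
    using lin e unfolding linearized_def by (meson order_trans)
qed

lemma grad_Psi: "w \<in> W \<Longrightarrow> z \<in> U \<Longrightarrow> grad (\<Psi> w) z = (\<Sum>p\<in>P. t p w *\<^sub>R grad (\<phi> p) z)"
  unfolding Psi_eq by (rule grad_linear_combination) (blast intro: C2_onD phi_C2)

lemma hess_Psi: "w \<in> W \<Longrightarrow> hess (\<Psi> w) z0 d = (\<Sum>p\<in>P. t p w *\<^sub>R hess (\<phi> p) z0 d)"
  unfolding Psi_eq by (rule hess_linear_combination[OF U phi_C2])

text \<open>Only finitely many functions \<open>\<phi> p\<close> and \<open>c k\<close> have to be linearized.  The coefficients \<open>t p w\<close>
  are bounded on the compact set \<open>W\<close>, which makes the radius independent of \<open>w\<close>.\<close>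

lemma linearized_exists:
  assumes e: "e > 0"
  shows "\<exists>r. linearized e r"
proof -
  obtain T where T: "T \<ge> 0" "\<And>w. w \<in> W \<Longrightarrow> (\<Sum>p\<in>P. \<bar>t p w\<bar>) \<le> T"
    using compact_family_bound[of W P t, OF W t_cont] by blast
  define e1 where "e1 = e / (T + 1)"
  have e1: "e1 > 0" "T * e1 \<le> e" using e T(1) by (auto simp: e1_def field_simps)
  have near: "\<forall>\<^sub>F r in at_right 0. \<forall>y\<in>cball z0 r. norm (grad f y - grad f z0) \<le> x"
    if "C2_on U f" "x > 0" for f :: "'a \<Rightarrow> real" and x
  proof -
    have "continuous_on U (grad f)" using that by (simp add: C2_on_def C1_on_def)
    then have "(grad f \<longlongrightarrow> grad f z0) (nhds z0)"
      using U by (metis continuous_on_eq_continuous_at isCont_def tendsto_at_iff_tendsto_nhds)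
    from eventually_cball_at_right[OF tendstoD[OF this that(2)]] show ?thesis
      by eventually_elim (auto simp: dist_norm less_imp_le)
  qed
  have "\<forall>\<^sub>F r in at_right 0. \<forall>p\<in>P. \<forall>y\<in>cball z0 r. \<forall>z\<in>cball z0 r.
      norm (grad (\<phi> p) y - grad (\<phi> p) z - hess (\<phi> p) z0 (y - z)) \<le> e1 * norm (y - z)"
    using P by (rule eventually_ball_finite) (use C2_strict_differentiability[OF U phi_C2 e1(1)] in blast)
  moreover have "\<forall>\<^sub>F r in at_right 0. \<forall>p\<in>P. \<forall>y\<in>cball z0 r. norm (grad (\<phi> p) y - grad (\<phi> p) z0) \<le> e1"
    using P by (rule eventually_ball_finite) (use near[OF phi_C2 e1(1)] in blast)
  moreover have "\<forall>\<^sub>F r in at_right 0. \<forall>k\<in>I. \<forall>y\<in>cball z0 r. \<forall>z\<in>cball z0 r.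
      norm (grad (c k) y - grad (c k) z - hess (c k) z0 (y - z)) \<le> e * norm (y - z)"
    using I by (rule eventually_ball_finite) (use C2_strict_differentiability[OF U c_C2 e] in blast)
  moreover have "\<forall>\<^sub>F r in at_right 0. \<forall>k\<in>I. \<forall>y\<in>cball z0 r. \<forall>z\<in>cball z0 r.
      \<bar>c k y - c k z - (y - z) \<bullet> grad (c k) z0\<bar> \<le> e * norm (y - z)"
    using I by (rule eventually_ball_finite)
      (use C1_strict_differentiability[OF U C2_imp_C1[OF c_C2] e] in blast)
  moreover have "\<forall>\<^sub>F r in at_right 0. \<forall>k\<in>I. \<forall>y\<in>cball z0 r. norm (grad (c k) y - grad (c k) z0) \<le> e"
    using I by (rule eventually_ball_finite) (use near[OF c_C2 e] in blast)
  moreover have "\<forall>\<^sub>F r in at_right 0. \<forall>y\<in>cball z0 r. y \<in> U"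
    by (rule eventually_cball_at_right) (rule eventually_nhds_in_open[OF U])
  moreover have "\<forall>\<^sub>F r in at_right 0. r \<in> {0<..<e}"
    using e by (intro eventually_at_right_real)
  ultimately have "\<forall>\<^sub>F r in at_right 0. linearized e r"
  proof eventually_elim
    case (elim r)
    have comb: "norm (\<Sum>p\<in>P. t p w *\<^sub>R x p) \<le> e * s"
      if "w \<in> W" "s \<ge> 0" "\<And>p. p \<in> P \<Longrightarrow> norm (x p) \<le> e1 * s" for w s and x :: "'p \<Rightarrow> 'a"
    proof -
      have "norm (\<Sum>p\<in>P. t p w *\<^sub>R x p) \<le> (\<Sum>p\<in>P. \<bar>t p w\<bar> * (e1 * s))"
        by (rule sum_norm_le) (auto intro: mult_left_mono that)
      also have "\<dots> \<le> T * (e1 * s)"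
        unfolding sum_distrib_right[symmetric] using T that e1 by (intro mult_right_mono) auto
      also have "\<dots> = (T * e1) * s" by simp
      also have "\<dots> \<le> e * s" using e1 that by (intro mult_right_mono)
      finally show ?thesis .
    qed
    have "norm (grad (\<Psi> w) y - grad (\<Psi> w) z - hess (\<Psi> w) z0 (y - z)) \<le> e * norm (y - z)"
      if "w \<in> W" "y \<in> cball z0 r" "z \<in> cball z0 r" for w y z
    proof -
      have "norm (\<Sum>p\<in>P. t p w *\<^sub>R (grad (\<phi> p) y - grad (\<phi> p) z - hess (\<phi> p) z0 (y - z))) \<le> e * norm (y - z)"
        using elim that by (intro comb) auto
      moreover have "y \<in> U" "z \<in> U" using elim that by auto
      ultimately show ?thesis
        using that by (simp add: grad_Psi hess_Psi scaleR_diff_right sum_subtractf)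
    qed
    moreover have "norm (grad (\<Psi> w) y - grad (\<Psi> w) z0) \<le> e" if "w \<in> W" "y \<in> cball z0 r" for w y
    proof -
      have "norm (\<Sum>p\<in>P. t p w *\<^sub>R (grad (\<phi> p) y - grad (\<phi> p) z0)) \<le> e * 1"
        using elim that by (intro comb) auto
      moreover have "y \<in> U" using elim that by auto
      ultimately show ?thesis
        using that U by (simp add: grad_Psi scaleR_diff_right sum_subtractf)
    qed
    ultimately show ?case
      using elim unfolding linearized_def by auto
  qed
  then show ?thesis
    using eventually_happens' trivial_limit_at_right_real by blast
qed

subsection \<open>Uniform constants\<close>

lemma dual_exists: "\<exists>b. \<forall>k\<in>I. \<forall>l\<in>I. b k \<bullet> grad (c l) z0 = (if k = l then 1 else 0)"
  using lin_indep_family_dual[OF I licq] by metis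

definition dual :: "'k \<Rightarrow> 'a" where
  "dual = (SOME b. \<forall>k\<in>I. \<forall>l\<in>I. b k \<bullet> grad (c l) z0 = (if k = l then 1 else 0))"

lemma dual: "k \<in> I \<Longrightarrow> l \<in> I \<Longrightarrow> dual k \<bullet> grad (c l) z0 = (if k = l then 1 else 0)"
  using someI_ex[OF dual_exists] unfolding dual_def by blast

definition \<beta> :: real where "\<beta> = (\<Sum>k\<in>I. norm (dual k))"

lemma beta_nonneg: "\<beta> \<ge> 0"
  by (auto simp: \<beta>_def intro: sum_nonneg)

text \<open>The limiting multipliers are unique and depend continuously on \<open>w\<close>, since the dual vectors read
  them off from \<open>grad (\<Psi> w) z0\<close>.\<close>

lemma nus_continuous:
  assumes k: "k \<in> I"
  shows "continuous_on W (\<lambda>w. \<nu>s w k)"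
proof -
  have "\<nu>s w k = - (dual k \<bullet> (\<Sum>p\<in>P. t p w *\<^sub>R grad (\<phi> p) z0))" if w: "w \<in> W" for w
  proof -
    have "\<nu>s w k = dual k \<bullet> (\<Sum>l\<in>I. \<nu>s w l *\<^sub>R grad (c l) z0)"
      using dual_coefficient[of I dual k "\<lambda>l. grad (c l) z0" "\<nu>s w"] I dual k by simp
    also have "(\<Sum>l\<in>I. \<nu>s w l *\<^sub>R grad (c l) z0) = - grad (\<Psi> w) z0"
      using stationary[OF w] by (simp add: eq_neg_iff_add_eq_0 add.commute)
    finally show ?thesis using w U by (simp add: grad_Psi)
  qed
  then show ?thesis
    by (subst continuous_on_cong[OF refl]) (auto intro!: continuous_intros t_cont)
qed

lemma nus_bound: obtains N where "N \<ge> 0" "\<And>w. w \<in> W \<Longrightarrow> (\<Sum>k\<in>I. \<bar>\<nu>s w k\<bar>) \<le> N"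
  using compact_family_bound[of W I "\<lambda>k w. \<nu>s w k", OF W nus_continuous] by blast

lemma nus_positive: obtains lam0 where "lam0 > 0" "\<And>w k. w \<in> W \<Longrightarrow> k \<in> B \<Longrightarrow> \<nu>s w k \<ge> lam0"
proof -
  have "\<exists>x>0. \<forall>w\<in>W. \<nu>s w k \<ge> x" if k: "k \<in> B" for k
  proof (cases "W = {}")
    case True
    then show ?thesis by (intro exI[of _ 1]) auto
  next
    case False
    obtain w0 where "w0 \<in> W" "\<forall>w\<in>W. \<nu>s w0 k \<le> \<nu>s w k"
      using continuous_attains_inf[OF W False nus_continuous] k BI by blast
    then show ?thesis using positive k by blast
  qed
  then obtain x where x: "\<And>k. k \<in> B \<Longrightarrow> x k > 0" "\<And>k w. k \<in> B \<Longrightarrow> w \<in> W \<Longrightarrow> \<nu>s w k \<ge> x k"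
    by metis
  have fin: "finite B" using I BI finite_subset by blast
  define lam0 where "lam0 = Min (insert 1 (x ` B))"
  have "lam0 > 0" unfolding lam0_def using fin x(1) by (subst Min_gr_iff) auto
  moreover have "lam0 \<le> x k" if "k \<in> B" for k
    unfolding lam0_def using fin that by (intro Min_le) auto
  ultimately show ?thesis using that x(2) by (meson order_trans)
qed

lemma lagr_hess_linear: "w \<in> W \<Longrightarrow> linear (lagr_hess w)"
  unfolding lagr_hess_def
  by (intro linear_compose_add linear_compose_sum linear_compose_scale_right ballI linear_hess[OF Psi_C2 U(2)] linear_hess[OF c_C2 U(2)])

lemma lagr_hess_continuous: "continuous_on (W \<times> S) (\<lambda>x. lagr_hess (fst x) (snd x))"
proof -
  have cont: "continuous_on X (\<lambda>x. hess f z0 (snd x))" if "C2_on U f" for f and X :: "('w \<times> 'a) set"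
    by (rule bounded_linear.continuous_on[OF linear_hess[OF that U(2), unfolded linear_conv_bounded_linear]])
      (intro continuous_intros)
  have "continuous_on (W \<times> S) (\<lambda>x. (\<Sum>p\<in>P. t p (fst x) *\<^sub>R hess (\<phi> p) z0 (snd x)) +
      (\<Sum>k\<in>I. \<nu>s (fst x) k *\<^sub>R hess (c k) z0 (snd x)))"
    by (intro continuous_intros cont phi_C2 c_C2
        continuous_on_compose2[OF t_cont continuous_on_fst[OF continuous_on_id]]
        continuous_on_compose2[OF nus_continuous continuous_on_fst[OF continuous_on_id]]) auto
  then show ?thesis
    by (rule continuous_on_eq) (auto simp: lagr_hess_def hess_Psi)
qed

lemma lagr_hess_bound: obtains Q where "Q \<ge> 0" "\<And>w d. w \<in> W \<Longrightarrow> norm (lagr_hess w d) \<le> Q * norm d"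
proof -
  have "bounded ((\<lambda>x. lagr_hess (fst x) (snd x)) ` (W \<times> sphere 0 1))"
    using W by (intro compact_imp_bounded compact_continuous_image lagr_hess_continuous compact_Times) auto
  then obtain Q where "\<forall>x\<in>W \<times> sphere 0 1. norm (lagr_hess (fst x) (snd x)) \<le> Q"
    unfolding bounded_iff by blast
  then have Q: "norm (lagr_hess w d) \<le> Q" if "w \<in> W" "norm d = 1" for w d
    using that by force
  have "norm (lagr_hess w d) \<le> max 0 Q * norm d" if w: "w \<in> W" for w d
  proof (cases "d = 0")
    case True
    then show ?thesis using linear_0[OF lagr_hess_linear[OF w]] by simp
  next
    case False
    have "norm (lagr_hess w (d /\<^sub>R norm d)) \<le> Q" using False by (intro Q w) auto
    then have "norm (lagr_hess w d) / norm d \<le> max 0 Q"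
      by (simp add: linear_cmul[OF lagr_hess_linear[OF w]] divide_inverse mult.commute)
    then show ?thesis using False by (simp add: divide_le_eq)
  qed
  then show ?thesis using that[of "max 0 Q"] by simp
qed

lemma hess_c_bound: obtains Q where "Q \<ge> 0" "\<And>k d. k \<in> I \<Longrightarrow> norm (hess (c k) z0 d) \<le> Q * norm d"
proof -
  have "\<exists>q\<ge>0. \<forall>d. norm (hess (c k) z0 d) \<le> q * norm d" if "k \<in> I" for k
    using linear_bounded_pos[OF linear_hess[OF c_C2[OF that] U(2)]] by (metis less_imp_le)
  then obtain q where q: "\<And>k. k \<in> I \<Longrightarrow> q k \<ge> 0" "\<And>k d. k \<in> I \<Longrightarrow> norm (hess (c k) z0 d) \<le> q k * norm d"
    by metis
  have "norm (hess (c k) z0 d) \<le> (\<Sum>k\<in>I. q k) * norm d" if "k \<in> I" for k d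
  proof -
    have "q k \<le> (\<Sum>k\<in>I. q k)" using that I q by (intro member_le_sum) auto
    then have "q k * norm d \<le> (\<Sum>k\<in>I. q k) * norm d" by (intro mult_right_mono) auto
    then show ?thesis using q(2)[OF that, of d] by simp
  qed
  moreover have "(\<Sum>k\<in>I. q k) \<ge> 0" using q by (intro sum_nonneg) auto
  ultimately show ?thesis using that by blast
qed

text \<open>Finsler's lemma, uniformly in \<open>w\<close>: compactness of \<open>W\<close> times the unit sphere turns positivity on the
  tangent space into coercivity of the Hessian augmented by the squared constraint derivatives.\<close>

lemma finsler:
  obtains \<gamma> \<rho> where "\<gamma> > 0" "\<rho> \<ge> 0"
    "\<And>w d. w \<in> W \<Longrightarrow> d \<bullet> lagr_hess w d + \<rho> * (\<Sum>k\<in>I. (grad (c k) z0 \<bullet> d)\<^sup>2) \<ge> \<gamma> * (norm d)\<^sup>2"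
proof -
  let ?X = "W \<times> sphere (0::'a) 1"
  obtain \<rho> \<gamma> where rg: "\<rho> \<ge> 0" "\<gamma> > 0" "\<And>x. x \<in> ?X \<Longrightarrow>
      snd x \<bullet> lagr_hess (fst x) (snd x) + \<rho> * (\<Sum>k\<in>I. (grad (c k) z0 \<bullet> snd x)\<^sup>2) \<ge> \<gamma>"
  proof (rule compact_penalty[of ?X "\<lambda>x. snd x \<bullet> lagr_hess (fst x) (snd x)" "\<lambda>x. \<Sum>k\<in>I. (grad (c k) z0 \<bullet> snd x)\<^sup>2"])
    show "compact ?X" using W by (intro compact_Times) auto
    show "continuous_on ?X (\<lambda>x. snd x \<bullet> lagr_hess (fst x) (snd x))"
      by (intro continuous_intros lagr_hess_continuous)
    show "continuous_on ?X (\<lambda>x. \<Sum>k\<in>I. (grad (c k) z0 \<bullet> snd x)\<^sup>2)"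
      by (intro continuous_intros)
    show "(\<Sum>k\<in>I. (grad (c k) z0 \<bullet> snd x)\<^sup>2) \<ge> 0" for x :: "'w \<times> 'a"
      by (intro sum_nonneg) auto
    show "snd x \<bullet> lagr_hess (fst x) (snd x) > 0"
      if x: "x \<in> ?X" "(\<Sum>k\<in>I. (grad (c k) z0 \<bullet> snd x)\<^sup>2) = 0" for x
      unfolding lagr_hess_def
    proof (rule second_order)
      show "fst x \<in> W" "snd x \<noteq> 0" using x by auto
      show "grad (c k) z0 \<bullet> snd x = 0" if "k \<in> I" for k
        using x(2) I that by (simp add: sum_nonneg_eq_0_iff)
    qed
  qed blast
  have "d \<bullet> lagr_hess w d + \<rho> * (\<Sum>k\<in>I. (grad (c k) z0 \<bullet> d)\<^sup>2) \<ge> \<gamma> * (norm d)\<^sup>2" if w: "w \<in> W" for w d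
  proof (cases "d = 0")
    case False
    define u where "u = d /\<^sub>R norm d"
    have d: "d = norm d *\<^sub>R u" using False by (simp add: u_def)
    have "(w, u) \<in> ?X" using w False by (simp add: u_def)
    from rg(3)[OF this] have "\<gamma> * (norm d)\<^sup>2 \<le> (u \<bullet> lagr_hess w u + \<rho> * (\<Sum>k\<in>I. (grad (c k) z0 \<bullet> u)\<^sup>2)) * (norm d)\<^sup>2"
      by (intro mult_right_mono) auto
    also have "\<dots> = (norm d *\<^sub>R u) \<bullet> lagr_hess w (norm d *\<^sub>R u) + \<rho> * (\<Sum>k\<in>I. (grad (c k) z0 \<bullet> (norm d *\<^sub>R u))\<^sup>2)"
      by (simp add: linear_cmul[OF lagr_hess_linear[OF w]] power_mult_distrib sum_distrib_left
          sum_distrib_right power2_eq_square algebra_simps)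
    finally show ?thesis unfolding d[symmetric] .
  qed (auto simp: sum_nonneg rg linear_0[OF lagr_hess_linear[OF w]])
  then show ?thesis using that rg by blast
qed

subsection \<open>Stability of the optimality system\<close>

text \<open>Invertibility of the saddle-point matrix as an inequality: the dual vectors recover the
  multiplier part \<open>m\<close>, after which coercivity controls \<open>d\<close>.\<close>

lemma saddle_point_estimate:
  obtains C where "C > 0"
    "\<And>w d m. w \<in> W \<Longrightarrow> norm d + (\<Sum>k\<in>I. \<bar>m k\<bar>) \<le>
       C * (norm (lagr_hess w d + (\<Sum>k\<in>I. m k *\<^sub>R grad (c k) z0)) + (\<Sum>k\<in>I. \<bar>grad (c k) z0 \<bullet> d\<bar>))"
proof -
  obtain \<gamma> \<rho> where fin: "\<gamma> > 0" "\<rho> \<ge> 0"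
    "\<And>w d. w \<in> W \<Longrightarrow> d \<bullet> lagr_hess w d + \<rho> * (\<Sum>k\<in>I. (grad (c k) z0 \<bullet> d)\<^sup>2) \<ge> \<gamma> * (norm d)\<^sup>2"
    using finsler by blast
  obtain Q where Q: "Q \<ge> 0" "\<And>w d. w \<in> W \<Longrightarrow> norm (lagr_hess w d) \<le> Q * norm d"
    using lagr_hess_bound by blast
  note b = beta_nonneg
  \<comment> \<open>\<open>D\<close> solves the quadratic inequality \<open>\<gamma> * x\<^sup>2 \<le> (1 + \<beta> * Q) * x * y + (\<beta> + \<rho>) * y\<^sup>2\<close> for \<open>x \<le> D * y\<close>.\<close>
  define A where "A = 1 + \<beta> * Q + \<beta> + \<rho>"
  define D where "D = A / \<gamma> + 1"
  have A: "A \<ge> 1" using b Q(1) fin(2) by (simp add: A_def)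
  have D: "D \<ge> 1" using A fin(1) by (simp add: D_def)
  have "norm d + (\<Sum>k\<in>I. \<bar>m k\<bar>) \<le> (D + \<beta> * (1 + Q * D)) *
       (norm (lagr_hess w d + (\<Sum>k\<in>I. m k *\<^sub>R grad (c k) z0)) + (\<Sum>k\<in>I. \<bar>grad (c k) z0 \<bullet> d\<bar>))"
    if w: "w \<in> W" for w d m
  proof -
    define v where "v = lagr_hess w d + (\<Sum>k\<in>I. m k *\<^sub>R grad (c k) z0)"
    define s where "s k = grad (c k) z0 \<bullet> d" for k
    define S where "S = (\<Sum>k\<in>I. \<bar>s k\<bar>)"
    define M where "M = (\<Sum>k\<in>I. \<bar>m k\<bar>)"
    define x where "x = norm d"
    define y where "y = norm v + S"
    have S0: "S \<ge> 0" and M0: "M \<ge> 0" by (auto simp: S_def M_def intro: sum_nonneg)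
    have s_le: "\<bar>s k\<bar> \<le> S" if "k \<in> I" for k
      unfolding S_def using I that by (intro member_le_sum) auto
    have m_eq: "m k = dual k \<bullet> (v - lagr_hess w d)" if k: "k \<in> I" for k
      using dual_coefficient[of I dual k "\<lambda>l. grad (c l) z0" m] I dual k by (simp add: v_def)
    have "\<bar>m k\<bar> \<le> norm (dual k) * (norm v + Q * x)" if k: "k \<in> I" for k
    proof -
      have "\<bar>m k\<bar> \<le> norm (dual k) * norm (v - lagr_hess w d)"
        unfolding m_eq[OF k] by (rule Cauchy_Schwarz_ineq2)
      also have "norm (v - lagr_hess w d) \<le> norm v + Q * x"
        using norm_triangle_ineq4[of v "lagr_hess w d"] Q(2)[OF w, of d] by (simp add: x_def)
      finally show ?thesis by (simp add: mult_left_mono)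
    qed
    then have M: "M \<le> \<beta> * (norm v + Q * x)"
      unfolding M_def \<beta>_def sum_distrib_right by (rule sum_mono)
    have "(s k)\<^sup>2 \<le> \<bar>s k\<bar> * S" if "k \<in> I" for k
      using mult_left_mono[OF s_le[OF that], of "\<bar>s k\<bar>"] by (simp add: power2_eq_square)
    then have "(\<Sum>k\<in>I. (s k)\<^sup>2) \<le> (\<Sum>k\<in>I. \<bar>s k\<bar> * S)"
      by (rule sum_mono)
    then have s2: "(\<Sum>k\<in>I. (s k)\<^sup>2) \<le> S\<^sup>2"
      by (simp add: sum_distrib_right[symmetric] S_def power2_eq_square)
    have "\<bar>\<Sum>k\<in>I. m k * s k\<bar> \<le> (\<Sum>k\<in>I. \<bar>m k\<bar> * S)"
      by (rule order_trans[OF sum_abs sum_mono]) (auto simp: abs_mult intro: mult_left_mono s_le)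
    then have ms: "\<bar>\<Sum>k\<in>I. m k * s k\<bar> \<le> M * S"
      by (simp add: sum_distrib_right[symmetric] M_def)
    have "d \<bullet> lagr_hess w d = d \<bullet> v - (\<Sum>k\<in>I. m k * s k)"
      by (simp add: v_def s_def inner_add_right inner_sum_right inner_commute)
    moreover have "d \<bullet> v \<le> x * norm v"
      using norm_cauchy_schwarz[of d v] by (simp add: x_def)
    ultimately have dH: "d \<bullet> lagr_hess w d \<le> x * norm v + M * S" using ms by linarith
    have "\<gamma> * x\<^sup>2 \<le> x * norm v + M * S + \<rho> * S\<^sup>2"
      using fin(3)[OF w, of d] dH mult_left_mono[OF s2 fin(2)] by (simp add: x_def s_def)
    also have "\<dots> \<le> x * norm v + \<beta> * (norm v + Q * x) * S + \<rho> * S\<^sup>2"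
      using M S0 by (simp add: mult_right_mono)
    also have "\<dots> \<le> x * y + \<beta> * (y + Q * x) * y + \<rho> * y\<^sup>2"
      using S0 b Q(1) fin(2) by (intro add_mono mult_mono power_mono mult_left_mono mult_nonneg_nonneg)
        (auto simp: x_def y_def)
    also have "\<dots> = (1 + \<beta> * Q) * x * y + (\<beta> + \<rho>) * y\<^sup>2" by (simp add: algebra_simps power2_eq_square)
    finally have key: "\<gamma> * x\<^sup>2 \<le> (1 + \<beta> * Q) * x * y + (\<beta> + \<rho>) * y\<^sup>2" .
    have y0: "y \<ge> 0" using S0 by (simp add: y_def)
    have x: "x \<le> D * y"
    proof (rule ccontr)
      assume "\<not> x \<le> D * y"
      then have less: "D * y < x" by simp
      have "1 * y \<le> D * y" using D y0 by (intro mult_right_mono)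
      with less have yx: "y \<le> x" by simp
      have x0: "x > 0" using less D y0 by (smt (verit) mult_nonneg_nonneg)
      have "(\<beta> + \<rho>) * y\<^sup>2 \<le> (\<beta> + \<rho>) * (x * y)"
        using yx y0 b fin(2) by (intro mult_left_mono) (auto simp: power2_eq_square mult_right_mono)
      then have "(\<gamma> * x) * x \<le> (A * y) * x"
        using key by (simp add: A_def algebra_simps power2_eq_square)
      then have "\<gamma> * x \<le> A * y" using x0 by simp
      then have "x \<le> A / \<gamma> * y" using fin(1) by (simp add: field_simps)
      also have "\<dots> \<le> D * y" using y0 by (intro mult_right_mono) (auto simp: D_def)
      finally show False using less by simp
    qed
    have "M \<le> \<beta> * (y + Q * (D * y))"
    proof (rule order_trans[OF M], rule mult_left_mono[OF _ b])
      show "norm v + Q * x \<le> y + Q * (D * y)"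
        using mult_left_mono[OF x Q(1)] S0 by (simp add: y_def)
    qed
    then have "x + M \<le> (D + \<beta> * (1 + Q * D)) * y" using x by (simp add: algebra_simps)
    then show ?thesis by (simp only: x_def M_def y_def v_def S_def s_def)
  qed
  moreover have "D + \<beta> * (1 + Q * D) > 0"
    using D b Q(1) by (intro add_pos_nonneg mult_nonneg_nonneg) auto
  ultimately show ?thesis using that by blast
qed

text \<open>By linear independence the multipliers are determined by the point: subtracting the limiting
  stationarity condition leaves a small right-hand side as soon as \<open>z\<close> is near \<open>z0\<close>.  Hence
  every stationary point near \<open>z0\<close>, for whatever penalty weight, has multipliers near \<open>\<nu>s w\<close>.\<close>

lemma multiplier_localization:
  assumes \<delta>: "\<delta> > 0"
  obtains e where "e > 0"
    "\<And>r w z \<nu>. linearized e r \<Longrightarrow> w \<in> W \<Longrightarrow> z \<in> cball z0 r \<Longrightarrow>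
       grad (\<Psi> w) z + (\<Sum>k\<in>I. \<nu> k *\<^sub>R grad (c k) z) = 0 \<Longrightarrow> (\<Sum>k\<in>I. \<bar>\<nu> k - \<nu>s w k\<bar>) \<le> \<delta>"
proof -
  obtain N where N: "N \<ge> 0" "\<And>w. w \<in> W \<Longrightarrow> (\<Sum>k\<in>I. \<bar>\<nu>s w k\<bar>) \<le> N"
    using nus_bound by blast
  note b = beta_nonneg
  define e where "e = min (1 / (2 * (\<beta> + 1))) (\<delta> / (2 * \<beta> * (1 + N) + 1))"
  have den: "2 * \<beta> * (1 + N) + 1 > 0" using b N(1) by (intro add_nonneg_pos mult_nonneg_nonneg) auto
  have e: "e > 0" using b N(1) \<delta> den by (simp add: e_def)
  have "\<beta> * e \<le> \<beta> * (1 / (2 * (\<beta> + 1)))" using b by (intro mult_left_mono) (auto simp: e_def)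
  also have "\<dots> \<le> 1 / 2" using b by (simp add: field_simps)
  finally have e1: "\<beta> * e \<le> 1 / 2" .
  have "2 * \<beta> * (1 + N) * e \<le> (2 * \<beta> * (1 + N)) * (\<delta> / (2 * \<beta> * (1 + N) + 1))"
    using b N(1) by (intro mult_left_mono) (auto simp: e_def)
  also have "\<dots> \<le> \<delta>" using den \<delta> by (simp add: field_simps)
  finally have e2: "2 * \<beta> * (1 + N) * e \<le> \<delta>" .
  have "(\<Sum>k\<in>I. \<bar>\<nu> k - \<nu>s w k\<bar>) \<le> \<delta>"
    if lin: "linearized e r" and w: "w \<in> W" and z: "z \<in> cball z0 r"
      and eq: "grad (\<Psi> w) z + (\<Sum>k\<in>I. \<nu> k *\<^sub>R grad (c k) z) = 0" for r w z \<nu>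
  proof -
    define u where "u = (\<Sum>k\<in>I. \<nu>s w k *\<^sub>R (grad (c k) z - grad (c k) z0))"
    define v where "v = grad (\<Psi> w) z - grad (\<Psi> w) z0 + u"
    have "norm u \<le> (\<Sum>k\<in>I. \<bar>\<nu>s w k\<bar> * e)"
      unfolding u_def using linearizedD(8)[OF lin z] by (intro sum_norm_le) (auto intro: mult_left_mono)
    also have "\<dots> \<le> N * e"
      unfolding sum_distrib_right[symmetric] using N(2)[OF w] e by (intro mult_right_mono) auto
    finally have v: "norm v \<le> (1 + N) * e"
      unfolding v_def using linearizedD(7)[OF lin z w] norm_triangle_ineq[of "grad (\<Psi> w) z - grad (\<Psi> w) z0" u]
      by (simp add: algebra_simps)
    have "v + (\<Sum>k\<in>I. (\<nu> k - \<nu>s w k) *\<^sub>R grad (c k) z) =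
        (grad (\<Psi> w) z + (\<Sum>k\<in>I. \<nu> k *\<^sub>R grad (c k) z)) -
        (grad (\<Psi> w) z0 + (\<Sum>k\<in>I. \<nu>s w k *\<^sub>R grad (c k) z0))"
      by (simp add: v_def u_def scaleR_diff_left scaleR_diff_right sum_subtractf)
    then have "v + (\<Sum>k\<in>I. (\<nu> k - \<nu>s w k) *\<^sub>R grad (c k) z) = 0"
      using eq stationary[OF w] by simp
    then have "(\<Sum>k\<in>I. \<bar>\<nu> k - \<nu>s w k\<bar>) \<le> 2 * \<beta> * norm v"
      by (intro perturbed_coefficients_bound[of I dual "\<lambda>k. grad (c k) z0" \<beta> e "\<lambda>k. grad (c k) z"])
        (use I dual e1 linearizedD(8)[OF lin z] in \<open>auto simp: \<beta>_def\<close>)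
    also have "\<dots> \<le> 2 * \<beta> * ((1 + N) * e)" using v b by (intro mult_left_mono) auto
    finally show ?thesis using e2 by (simp add: mult.assoc)
  qed
  with e show ?thesis by (rule that)
qed

text \<open>This estimate replaces the implicit function theorem.  Subtracting two optimality systems
  gives the saddle-point system at \<open>(z0, \<nu>s w)\<close> up to errors that the left-hand side absorbs; for
  \<open>\<eta> = \<theta>\<close> it says that solutions are unique, and for \<open>\<theta> = 0\<close> that they are \<open>O(\<eta>)\<close>-close to the limit.\<close>

lemma kkt_stability:
  obtains e \<eta>0 C where "e > 0" "\<eta>0 > 0" "C > 0"
    "\<And>r w y z \<nu> \<mu> \<eta> \<theta>. linearized e r \<Longrightarrow> w \<in> W \<Longrightarrow> y \<in> cball z0 r \<Longrightarrow> z \<in> cball z0 r \<Longrightarrow>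
       \<eta> \<in> {0..\<eta>0} \<Longrightarrow> \<theta> \<in> {0..\<eta>0} \<Longrightarrow> kkt w \<eta> y \<nu> \<Longrightarrow> kkt w \<theta> z \<mu> \<Longrightarrow>
       norm (y - z) + (\<Sum>k\<in>I. \<bar>\<nu> k - \<mu> k\<bar>) \<le> C * \<bar>\<eta> - \<theta>\<bar>"
proof -
  obtain C where C: "C > 0"
    "\<And>w d m. w \<in> W \<Longrightarrow> norm d + (\<Sum>k\<in>I. \<bar>m k\<bar>) \<le>
       C * (norm (lagr_hess w d + (\<Sum>k\<in>I. m k *\<^sub>R grad (c k) z0)) + (\<Sum>k\<in>I. \<bar>grad (c k) z0 \<bullet> d\<bar>))"
    using saddle_point_estimate by blast
  obtain N where N: "N \<ge> 0" "\<And>w. w \<in> W \<Longrightarrow> (\<Sum>k\<in>I. \<bar>\<nu>s w k\<bar>) \<le> N"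
    using nus_bound by blast
  obtain Q where Q: "Q \<ge> 0" "\<And>k d. k \<in> I \<Longrightarrow> norm (hess (c k) z0 d) \<le> Q * norm d"
    using hess_c_bound by blast
  define n where "n = real (card I)"
  \<comment> \<open>The error terms add up to at most \<open>2 * \<kappa>\<close> times the left-hand side; with this \<open>\<kappa>\<close> a third of it
    has to be absorbed.\<close>
  define \<kappa> where "\<kappa> = 1 / (6 * C)"
  define \<delta> where "\<delta> = min 1 (\<kappa> / (Q + 1))"
  have kappa: "\<kappa> > 0" using C by (simp add: \<kappa>_def)
  have delta: "\<delta> > 0" "\<delta> \<le> 1" using kappa Q by (auto simp: \<delta>_def)
  have "\<delta> * Q \<le> \<kappa> / (Q + 1) * Q" using Q by (intro mult_right_mono) (auto simp: \<delta>_def)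
  also have "\<dots> \<le> \<kappa>" using Q kappa by (simp add: field_simps)
  finally have deltaQ: "\<delta> * Q \<le> \<kappa>" .
  obtain e1 where e1: "e1 > 0" "\<And>r w z \<nu>. linearized e1 r \<Longrightarrow> w \<in> W \<Longrightarrow> z \<in> cball z0 r \<Longrightarrow>
       grad (\<Psi> w) z + (\<Sum>k\<in>I. \<nu> k *\<^sub>R grad (c k) z) = 0 \<Longrightarrow> (\<Sum>k\<in>I. \<bar>\<nu> k - \<nu>s w k\<bar>) \<le> \<delta>"
    using multiplier_localization[OF delta(1)] by blast
  have n0: "n \<ge> 0" by (simp add: n_def)
  define e where "e = min e1 (\<kappa> / (N + 2 + n))"
  have e: "e > 0" "e \<le> e1" using e1 kappa N n0 by (auto simp: e_def)
  have "e \<le> \<kappa> / (N + 2 + n)" by (simp add: e_def)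
  then have eN: "e * (N + 2 + n) \<le> \<kappa>" using N n0 by (simp add: pos_le_divide_eq)
  have "norm (y - z) + (\<Sum>k\<in>I. \<bar>\<nu> k - \<mu> k\<bar>) \<le> (2 * C * (N + 1)) * \<bar>\<eta> - \<theta>\<bar>"
    if lin: "linearized e r" and w: "w \<in> W" and y: "y \<in> cball z0 r" and z: "z \<in> cball z0 r"
      and eta: "\<eta> \<in> {0..\<kappa>}" "\<theta> \<in> {0..\<kappa>}" and ky: "kkt w \<eta> y \<nu>" and kz: "kkt w \<theta> z \<mu>"
    for r w y z \<nu> \<mu> \<eta> \<theta>
  proof -
    define d where "d = y - z"
    define m where "m k = \<nu> k - \<mu> k" for k
    define x where "x = norm d"
    define M where "M = (\<Sum>k\<in>I. \<bar>m k\<bar>)"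
    have M0: "M \<ge> 0" "x \<ge> 0" by (auto simp: M_def x_def intro: sum_nonneg)
    have lin1: "linearized e1 r" using linearized_mono[OF lin e(2)] .
    have loc: "(\<Sum>k\<in>I. \<bar>\<nu> k - \<nu>s w k\<bar>) \<le> \<delta>" "(\<Sum>k\<in>I. \<bar>\<mu> k - \<nu>s w k\<bar>) \<le> \<delta>"
      using ky kz by (auto simp: kkt_def intro: e1(2)[OF lin1 w y] e1(2)[OF lin1 w z])
    have l1: "(\<Sum>k\<in>I. \<bar>\<xi> k\<bar>) \<le> N + 1" if "(\<Sum>k\<in>I. \<bar>\<xi> k - \<nu>s w k\<bar>) \<le> \<delta>" for \<xi>
    proof -
      have "(\<Sum>k\<in>I. \<bar>\<xi> k\<bar>) \<le> (\<Sum>k\<in>I. \<bar>\<xi> k - \<nu>s w k\<bar> + \<bar>\<nu>s w k\<bar>)" by (intro sum_mono) auto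
      then show ?thesis using that N(2)[OF w] delta by (simp add: sum.distrib)
    qed
    define p1 where "p1 = grad (\<Psi> w) y - grad (\<Psi> w) z - hess (\<Psi> w) z0 d"
    define p2 where "p2 = (\<Sum>k\<in>I. \<nu> k *\<^sub>R (grad (c k) y - grad (c k) z - hess (c k) z0 d))"
    define p3 where "p3 = (\<Sum>k\<in>I. (\<nu> k - \<nu>s w k) *\<^sub>R hess (c k) z0 d)"
    define p4 where "p4 = (\<Sum>k\<in>I. m k *\<^sub>R (grad (c k) z - grad (c k) z0))"
    have p1: "norm p1 \<le> e * x"
      unfolding p1_def d_def x_def by (rule linearizedD(4)[OF lin y z w])
    have "norm p2 \<le> (\<Sum>k\<in>I. \<bar>\<nu> k\<bar> * (e * x))"
      unfolding p2_def d_def x_def using linearizedD(5)[OF lin y z]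
      by (intro sum_norm_le) (auto intro: mult_left_mono)
    also have "\<dots> \<le> (N + 1) * (e * x)"
      unfolding sum_distrib_right[symmetric] using l1[OF loc(1)] e M0 by (intro mult_right_mono) auto
    finally have p2: "norm p2 \<le> (N + 1) * (e * x)" .
    have "norm p3 \<le> (\<Sum>k\<in>I. \<bar>\<nu> k - \<nu>s w k\<bar> * (Q * x))"
      unfolding p3_def x_def using Q(2) by (intro sum_norm_le) (auto intro: mult_left_mono)
    also have "\<dots> \<le> \<delta> * (Q * x)"
      unfolding sum_distrib_right[symmetric] using loc(1) Q(1) M0 by (intro mult_right_mono) auto
    also have "\<dots> \<le> \<kappa> * x" using deltaQ M0 by (simp add: mult.assoc[symmetric] mult_right_mono)
    finally have p3: "norm p3 \<le> \<kappa> * x" .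
    have "norm p4 \<le> (\<Sum>k\<in>I. \<bar>m k\<bar> * e)"
      unfolding p4_def using linearizedD(8)[OF lin z] by (intro sum_norm_le) (auto intro: mult_left_mono)
    then have p4: "norm p4 \<le> M * e" by (simp add: M_def sum_distrib_right)
    have "lagr_hess w d + (\<Sum>k\<in>I. m k *\<^sub>R grad (c k) z0) + (p1 + p2 + p3 + p4) =
        (grad (\<Psi> w) y + (\<Sum>k\<in>I. \<nu> k *\<^sub>R grad (c k) y)) - (grad (\<Psi> w) z + (\<Sum>k\<in>I. \<mu> k *\<^sub>R grad (c k) z))"
      by (simp add: lagr_hess_def p1_def p2_def p3_def p4_def m_def scaleR_diff_left scaleR_diff_right
          sum_subtractf sum.distrib algebra_simps)
    also have "\<dots> = 0" using ky kz by (simp add: kkt_def)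
    finally have "lagr_hess w d + (\<Sum>k\<in>I. m k *\<^sub>R grad (c k) z0) = - (p1 + p2 + p3 + p4)"
      by (simp only: eq_neg_iff_add_eq_0)
    then have "norm (lagr_hess w d + (\<Sum>k\<in>I. m k *\<^sub>R grad (c k) z0)) = norm (p1 + p2 + p3 + p4)"
      by (simp only: norm_minus_cancel)
    also have "\<dots> \<le> norm p1 + norm p2 + norm p3 + norm p4"
      by (meson add_mono norm_triangle_le order_refl)
    finally have v: "norm (lagr_hess w d + (\<Sum>k\<in>I. m k *\<^sub>R grad (c k) z0)) \<le>
        e * x + (N + 1) * (e * x) + \<kappa> * x + M * e" using p1 p2 p3 p4 by linarith
    have "\<bar>grad (c k) z0 \<bullet> d\<bar> \<le> e * x + \<kappa> * \<bar>m k\<bar> + \<bar>\<eta> - \<theta>\<bar> * \<bar>\<mu> k\<bar>" if k: "k \<in> I" for k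
    proof -
      have "\<bar>c k y - c k z - d \<bullet> grad (c k) z0\<bar> \<le> e * x"
        using linearizedD(6)[OF lin y z k] by (simp add: d_def x_def)
      moreover have "\<bar>c k y - c k z\<bar> \<le> \<kappa> * \<bar>m k\<bar> + \<bar>\<eta> - \<theta>\<bar> * \<bar>\<mu> k\<bar>"
      proof (cases "k \<in> B")
        case True
        then have "c k y = \<eta> / 2 * \<nu> k" "c k z = \<theta> / 2 * \<mu> k"
          using ky kz unfolding kkt_def by blast+
        then have "c k y - c k z = \<eta> / 2 * m k + (\<eta> - \<theta>) / 2 * \<mu> k"
          by (simp add: m_def field_simps)
        then have "\<bar>c k y - c k z\<bar> \<le> \<bar>\<eta> / 2\<bar> * \<bar>m k\<bar> + \<bar>(\<eta> - \<theta>) / 2\<bar> * \<bar>\<mu> k\<bar>"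
          unfolding abs_mult[symmetric] by linarith
        also have "\<dots> \<le> \<kappa> * \<bar>m k\<bar> + \<bar>\<eta> - \<theta>\<bar> * \<bar>\<mu> k\<bar>"
          using eta by (intro add_mono mult_right_mono) auto
        finally show ?thesis .
      next
        case False
        then show ?thesis using ky kz k kappa by (auto simp: kkt_def intro!: add_nonneg_nonneg)
      qed
      ultimately show ?thesis by (simp add: inner_commute[of d])
    qed
    then have "(\<Sum>k\<in>I. \<bar>grad (c k) z0 \<bullet> d\<bar>) \<le> (\<Sum>k\<in>I. e * x + \<kappa> * \<bar>m k\<bar> + \<bar>\<eta> - \<theta>\<bar> * \<bar>\<mu> k\<bar>)"
      by (rule sum_mono)
    also have "\<dots> = n * (e * x) + \<kappa> * M + \<bar>\<eta> - \<theta>\<bar> * (\<Sum>k\<in>I. \<bar>\<mu> k\<bar>)"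
      by (simp add: sum.distrib sum_distrib_left M_def n_def)
    also have "\<dots> \<le> n * (e * x) + \<kappa> * M + \<bar>\<eta> - \<theta>\<bar> * (N + 1)"
      using l1[OF loc(2)] by (intro add_left_mono mult_left_mono) auto
    finally have s: "(\<Sum>k\<in>I. \<bar>grad (c k) z0 \<bullet> d\<bar>) \<le> n * (e * x) + \<kappa> * M + \<bar>\<eta> - \<theta>\<bar> * (N + 1)" .
    have "x + M \<le> C * ((e * x + (N + 1) * (e * x) + \<kappa> * x + M * e) +
        (n * (e * x) + \<kappa> * M + \<bar>\<eta> - \<theta>\<bar> * (N + 1)))"
      unfolding x_def M_def
      by (rule order_trans[OF C(2)[OF w] mult_left_mono]) (use v s C(1) in \<open>auto simp: x_def M_def\<close>)
    also have "\<dots> = C * ((e * (N + 2 + n) + \<kappa>) * x + (e + \<kappa>) * M + \<bar>\<eta> - \<theta>\<bar> * (N + 1))"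
      by (simp add: algebra_simps)
    also have "\<dots> \<le> C * ((2 * \<kappa>) * x + (2 * \<kappa>) * M + \<bar>\<eta> - \<theta>\<bar> * (N + 1))"
    proof -
      have "e * 1 \<le> e * (N + 2 + n)" using e N n0 by (intro mult_left_mono) auto
      then have "e \<le> \<kappa>" using eN by simp
      then show ?thesis
        using C(1) M0 eN by (intro mult_left_mono add_mono mult_right_mono) auto
    qed
    also have "\<dots> = (x + M) / 3 + C * (N + 1) * \<bar>\<eta> - \<theta>\<bar>"
      using C(1) by (simp add: \<kappa>_def field_simps)
    finally have "x + M \<le> (x + M) / 3 + C * (N + 1) * \<bar>\<eta> - \<theta>\<bar>" .
    moreover have "C * (N + 1) * \<bar>\<eta> - \<theta>\<bar> \<ge> 0" using C N by simp
    moreover have "a \<le> 2 * b" if "a \<le> a / 3 + b" "b \<ge> 0" for a b :: real using that by simp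
    ultimately have "x + M \<le> 2 * (C * (N + 1) * \<bar>\<eta> - \<theta>\<bar>)" by blast
    then show ?thesis by (simp add: x_def M_def d_def m_def mult.assoc)
  qed
  moreover have "2 * C * (N + 1) > 0" using C N by simp
  ultimately show ?thesis using that[of e \<kappa> "2 * C * (N + 1)"] e kappa by blast
qed

subsection \<open>Local minimizers of the penalized objective\<close>

lemma Psi_derivative: "w \<in> W \<Longrightarrow> z \<in> U \<Longrightarrow> (\<Psi> w has_derivative (\<lambda>d. d \<bullet> grad (\<Psi> w) z)) (at z)"
  by (rule C1_onD_derivative[OF C2_imp_C1[OF Psi_C2]])

lemma c_derivative: "k \<in> I \<Longrightarrow> z \<in> U \<Longrightarrow> (c k has_derivative (\<lambda>d. d \<bullet> grad (c k) z)) (at z)"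
  by (rule C1_onD_derivative[OF C2_imp_C1[OF c_C2]])

lemma pen_GDERIV:
  assumes w: "w \<in> W" and z: "z \<in> U"
  shows "GDERIV (pen w \<omega>) z :> grad (\<Psi> w) z + (\<Sum>k\<in>B. (2 * \<omega> * max 0 (c k z)) *\<^sub>R grad (c k) z)"
proof -
  have hinge: "((\<lambda>y. (max 0 (c k y))\<^sup>2) has_derivative (\<lambda>d. d \<bullet> ((2 * max 0 (c k z)) *\<^sub>R grad (c k) z))) (at z)"
    if "k \<in> B" for k
    using GDERIV_DERIV_compose[of "c k" z "grad (c k) z", OF _ DERIV_squared_hinge] c_derivative[of k z] that BI z
    by (auto simp: gderiv_def)
  have "(pen w \<omega> has_derivative (\<lambda>d. d \<bullet> grad (\<Psi> w) z +
      \<omega> * (\<Sum>k\<in>B. d \<bullet> ((2 * max 0 (c k z)) *\<^sub>R grad (c k) z)))) (at z)"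
    unfolding pen_def
    by (intro has_derivative_add Psi_derivative w z has_derivative_mult_right has_derivative_sum hinge)
  moreover have "d \<bullet> grad (\<Psi> w) z + \<omega> * (\<Sum>k\<in>B. d \<bullet> ((2 * max 0 (c k z)) *\<^sub>R grad (c k) z)) =
      d \<bullet> (grad (\<Psi> w) z + (\<Sum>k\<in>B. (2 * \<omega> * max 0 (c k z)) *\<^sub>R grad (c k) z))" for d
    by (simp add: inner_add_right inner_sum_right sum_distrib_left mult_ac)
  ultimately show ?thesis by (simp add: gderiv_def)
qed

lemma c_continuous: "k \<in> I \<Longrightarrow> continuous_on U (c k)"
  by (rule C1_on_continuous[OF C2_imp_C1[OF c_C2]])

lemma pen_C1:
  assumes w: "w \<in> W"
  shows "C1_on U (pen w \<omega>)"
proof -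
  have "pen w \<omega> differentiable (at z)" if "z \<in> U" for z
    using pen_GDERIV[OF w that] unfolding gderiv_def differentiable_def by blast
  moreover have "continuous_on U (\<lambda>z. grad (\<Psi> w) z + (\<Sum>k\<in>B. (2 * \<omega> * max 0 (c k z)) *\<^sub>R grad (c k) z))"
    using BI by (intro continuous_intros grad_continuous Psi_C2 w c_C2 c_continuous) auto
  then have "continuous_on U (grad (pen w \<omega>))"
    by (rule continuous_on_eq) (rule grad_eqI[OF pen_GDERIV[OF w], symmetric])
  ultimately show ?thesis by (simp add: C1_on_def)
qed

text \<open>The hinge derivatives \<open>2 * \<omega> * max 0 (c k z)\<close> act as multipliers.  They are close to the positive
  limiting ones, so every hinge in \<open>B\<close> is strictly violated and the one-sided penalty agrees
  with the two-sided quadratic one, whose optimality system is \<open>kkt\<close>.\<close>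

lemma local_min_imp_kkt:
  obtains e where "e > 0"
    "\<And>r w \<omega> z. linearized e r \<Longrightarrow> w \<in> W \<Longrightarrow> \<omega> > 0 \<Longrightarrow> z \<in> ball z0 r \<Longrightarrow>
       local_min_on (pen w \<omega>) surface z \<Longrightarrow> \<exists>\<nu>. kkt w (1 / \<omega>) z \<nu> \<and> (\<forall>k\<in>B. \<nu> k > 0)"
proof -
  obtain lam0 where lam0: "lam0 > 0" "\<And>w k. w \<in> W \<Longrightarrow> k \<in> B \<Longrightarrow> \<nu>s w k \<ge> lam0"
    using nus_positive by blast
  obtain e1 where e1: "e1 > 0" "\<And>r w z \<nu>. linearized e1 r \<Longrightarrow> w \<in> W \<Longrightarrow> z \<in> cball z0 r \<Longrightarrow>
       grad (\<Psi> w) z + (\<Sum>k\<in>I. \<nu> k *\<^sub>R grad (c k) z) = 0 \<Longrightarrow> (\<Sum>k\<in>I. \<bar>\<nu> k - \<nu>s w k\<bar>) \<le> lam0 / 2"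
    using multiplier_localization[OF half_gt_zero[OF lam0(1)]] by blast
  define e where "e = min e1 (1 / (2 * (\<beta> + 1)))"
  have e: "e > 0" "e \<le> e1" using e1 beta_nonneg by (auto simp: e_def)
  have "\<beta> * e \<le> \<beta> * (1 / (2 * (\<beta> + 1)))" using beta_nonneg by (intro mult_left_mono) (auto simp: e_def)
  also have "\<dots> \<le> 1 / 2" using beta_nonneg by (simp add: field_simps)
  finally have eb: "\<beta> * e \<le> 1 / 2" .
  have "\<exists>\<nu>. kkt w (1 / \<omega>) z \<nu> \<and> (\<forall>k\<in>B. \<nu> k > 0)"
    if lin: "linearized e r" and w: "w \<in> W" and om: "\<omega> > 0" and z: "z \<in> ball z0 r"
      and lm: "local_min_on (pen w \<omega>) surface z" for r w \<omega> z
  proof -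
    have zU: "z \<in> U" using linearizedD(3)[OF lin] z by auto
    have zc: "z \<in> cball z0 r" using z by auto
    obtain T where T: "open T" "z \<in> T" "\<And>y. y \<in> surface \<inter> T \<Longrightarrow> pen w \<omega> z \<le> pen w \<omega> y"
      and zs: "z \<in> surface" using lm unfolding local_min_on_def by blast
    have fin: "finite (I - B)" using I by simp
    have "lin_indep_family (I - B) (\<lambda>k. grad (c k) z)"
      unfolding lin_indep_family_def
    proof (intro allI impI)
      fix m assume m: "(\<Sum>k\<in>I - B. m k *\<^sub>R grad (c k) z) = 0"
      have "(\<Sum>k\<in>I - B. \<bar>m k\<bar>) \<le> 2 * \<beta> * norm (0::'a)"
      proof (rule perturbed_coefficients_bound[of "I - B" dual "\<lambda>k. grad (c k) z0" \<beta> e "\<lambda>k. grad (c k) z"])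
        show "(\<Sum>k\<in>I - B. norm (dual k)) \<le> \<beta>"
          unfolding \<beta>_def using I by (intro sum_mono2) auto
      qed (use fin dual eb m linearizedD(8)[OF lin zc] in auto)
      then have "(\<Sum>k\<in>I - B. \<bar>m k\<bar>) \<le> 0" by simp
      then have "(\<Sum>k\<in>I - B. \<bar>m k\<bar>) = 0" by (intro antisym sum_nonneg) auto
      then show "\<forall>k\<in>I - B. m k = 0" using fin by (simp add: sum_nonneg_eq_0_iff)
    qed
    moreover have "C1_on (U \<inter> T) f" if "C1_on U f" for f :: "'a \<Rightarrow> real"
      using that by (auto simp: C1_on_def intro: continuous_on_subset)
    ultimately have "\<exists>\<mu>. grad (pen w \<omega>) z + (\<Sum>k\<in>I - B. \<mu> k *\<^sub>R grad (c k) z) = 0"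
      using zs T U(1) zU fin pen_C1[OF w] c_C2
      by (intro lagrange_multipliers[of "I - B" "U \<inter> T"]) (auto simp: surface_def C2_imp_C1)
    then obtain \<mu> where mu: "grad (pen w \<omega>) z + (\<Sum>k\<in>I - B. \<mu> k *\<^sub>R grad (c k) z) = 0" ..
    define \<nu> where "\<nu> k = (if k \<in> B then 2 * \<omega> * max 0 (c k z) else \<mu> k)" for k
    have "(\<Sum>k\<in>I. \<nu> k *\<^sub>R grad (c k) z) = (\<Sum>k\<in>I - B. \<nu> k *\<^sub>R grad (c k) z) + (\<Sum>k\<in>B. \<nu> k *\<^sub>R grad (c k) z)"
      by (rule sum.subset_diff[OF BI I])
    also have "\<dots> = (\<Sum>k\<in>I - B. \<mu> k *\<^sub>R grad (c k) z) + (\<Sum>k\<in>B. (2 * \<omega> * max 0 (c k z)) *\<^sub>R grad (c k) z)"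
      by (intro arg_cong2[where f="(+)"] sum.cong) (auto simp: \<nu>_def)
    finally have stat: "grad (\<Psi> w) z + (\<Sum>k\<in>I. \<nu> k *\<^sub>R grad (c k) z) = 0"
      using mu grad_eqI[OF pen_GDERIV[OF w zU]] by (simp add: add_ac)
    have pos: "\<nu> k > 0" if k: "k \<in> B" for k
    proof -
      have "\<bar>\<nu> k - \<nu>s w k\<bar> \<le> (\<Sum>k\<in>I. \<bar>\<nu> k - \<nu>s w k\<bar>)"
        using k BI I by (intro member_le_sum) auto
      also have "\<dots> \<le> lam0 / 2" by (rule e1(2)[OF linearized_mono[OF lin e(2)] w zc stat])
      finally show ?thesis using lam0(1) lam0(2)[OF w k] by linarith
    qed
    have "c k z = 1 / \<omega> / 2 * \<nu> k" if k: "k \<in> B" for k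
    proof -
      have "max 0 (c k z) \<noteq> 0" using pos[OF k] k by (auto simp: \<nu>_def)
      then have "max 0 (c k z) = c k z" by linarith
      then show ?thesis using k om by (simp add: \<nu>_def)
    qed
    then have "kkt w (1 / \<omega>) z \<nu>"
      using stat zs by (auto simp: kkt_def surface_def)
    then show ?thesis using pos by blast
  qed
  with e(1) show ?thesis by (rule that)
qed

text \<open>The Lagrangian has a critical point at \<open>z0\<close> whose Hessian is coercive only after augmentation.  The
  squared constraint derivatives of Finsler's lemma may be replaced by the squared constraint values
  up to an error of higher order.\<close>

lemma quadratic_growth:
  obtains e \<gamma> \<rho> where "e > 0" "\<gamma> > 0" "\<rho> \<ge> 0"
    "\<And>r w z. linearized e r \<Longrightarrow> w \<in> W \<Longrightarrow> z \<in> cball z0 r \<Longrightarrow>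
       \<Psi> w z + (\<Sum>k\<in>I. \<nu>s w k * c k z) + \<rho> * (\<Sum>k\<in>I. (c k z)\<^sup>2) \<ge> \<Psi> w z0 + \<gamma> * (norm (z - z0))\<^sup>2"
proof -
  obtain \<gamma> \<rho> where fin: "\<gamma> > 0" "\<rho> \<ge> 0"
    "\<And>w d. w \<in> W \<Longrightarrow> d \<bullet> lagr_hess w d + \<rho> * (\<Sum>k\<in>I. (grad (c k) z0 \<bullet> d)\<^sup>2) \<ge> \<gamma> * (norm d)\<^sup>2"
    using finsler by blast
  obtain N where N: "N \<ge> 0" "\<And>w. w \<in> W \<Longrightarrow> (\<Sum>k\<in>I. \<bar>\<nu>s w k\<bar>) \<le> N"
    using nus_bound by blast
  define n where "n = real (card I)"
  define D where "D = 2 * \<rho> * n + 1 + N"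
  have "2 * \<rho> * n \<ge> 0" using fin(2) by (simp add: n_def)
  then have D: "D > 0" using N(1) by (simp add: D_def)
  define e where "e = min 1 (\<gamma> / (2 * D))"
  have e: "e > 0" "e \<le> 1" using fin(1) D by (auto simp: e_def)
  have "D * e \<le> D * (\<gamma> / (2 * D))" using D by (intro mult_left_mono) (auto simp: e_def)
  then have De: "D * e \<le> \<gamma> / 2" using D by simp
  have "\<Psi> w z + (\<Sum>k\<in>I. \<nu>s w k * c k z) + \<rho> * (\<Sum>k\<in>I. (c k z)\<^sup>2) \<ge> \<Psi> w z0 + \<gamma> / 4 * (norm (z - z0))\<^sup>2"
    if lin: "linearized e r" and w: "w \<in> W" and z: "z \<in> cball z0 r" for r w z
  proof -
    define d where "d = z - z0"
    define x where "x = norm d"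
    define \<Lambda> where "\<Lambda> y = \<Psi> w y + (\<Sum>k\<in>I. \<nu>s w k * c k y)" for y
    define G where "G y = grad (\<Psi> w) y + (\<Sum>k\<in>I. \<nu>s w k *\<^sub>R grad (c k) y)" for y
    have z0: "z0 \<in> cball z0 r" using linearizedD(1)[OF lin] by simp
    have "\<Lambda> z - \<Lambda> z0 \<ge> ((z - z0) \<bullet> lagr_hess w (z - z0) - ((1 + N) * e) * (norm (z - z0))\<^sup>2) / 2"
    proof (rule quadratic_lower_bound[where G = G and r = r])
      fix y assume y: "y \<in> cball z0 r"
      then have yU: "y \<in> U" using linearizedD(3)[OF lin] by blast
      have "(\<Lambda> has_derivative (\<lambda>d. d \<bullet> grad (\<Psi> w) y + (\<Sum>k\<in>I. \<nu>s w k * (d \<bullet> grad (c k) y)))) (at y)"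
        unfolding \<Lambda>_def
        by (intro has_derivative_add has_derivative_sum has_derivative_mult_right Psi_derivative c_derivative w yU)
      then show "(\<Lambda> has_derivative (\<lambda>d. d \<bullet> G y)) (at y)"
        by (simp add: G_def inner_add_right inner_sum_right)
      define p where "p = (\<Sum>k\<in>I. \<nu>s w k *\<^sub>R (grad (c k) y - grad (c k) z0 - hess (c k) z0 (y - z0)))"
      define q where "q = grad (\<Psi> w) y - grad (\<Psi> w) z0 - hess (\<Psi> w) z0 (y - z0)"
      have "norm p \<le> (\<Sum>k\<in>I. \<bar>\<nu>s w k\<bar> * (e * norm (y - z0)))"
        unfolding p_def using linearizedD(5)[OF lin y z0] by (intro sum_norm_le) (auto intro: mult_left_mono)
      also have "\<dots> \<le> N * (e * norm (y - z0))"
        unfolding sum_distrib_right[symmetric] using N(2)[OF w] e by (intro mult_right_mono) auto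
      finally have p: "norm p \<le> N * (e * norm (y - z0))" .
      have q: "norm q \<le> e * norm (y - z0)" unfolding q_def by (rule linearizedD(4)[OF lin y z0 w])
      have "G y - lagr_hess w (y - z0) = q + p + (grad (\<Psi> w) z0 + (\<Sum>k\<in>I. \<nu>s w k *\<^sub>R grad (c k) z0))"
        by (simp add: G_def lagr_hess_def p_def q_def scaleR_diff_right sum_subtractf sum.distrib algebra_simps)
      then have "norm (G y - lagr_hess w (y - z0)) \<le> norm q + norm p"
        using stationary[OF w] norm_triangle_ineq[of q p] by simp
      then show "norm (G y - lagr_hess w (y - z0)) \<le> ((1 + N) * e) * norm (y - z0)"
        using p q by (simp add: algebra_simps)
    qed (use lagr_hess_linear[OF w] z in auto)
    moreover have "\<Lambda> z0 = \<Psi> w z0" by (simp add: \<Lambda>_def c_z0)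
    ultimately have L: "\<Lambda> z - \<Psi> w z0 \<ge> (d \<bullet> lagr_hess w d - ((1 + N) * e) * x\<^sup>2) / 2"
      by (simp add: d_def x_def)
    have "e * e \<le> e * 1" using e by (intro mult_left_mono) auto
    then have "(e * e) * x\<^sup>2 \<le> e * x\<^sup>2" by (intro mult_right_mono) auto
    then have ex: "(e * x)\<^sup>2 \<le> e * x\<^sup>2" by (simp add: power2_eq_square mult_ac)
    have "(grad (c k) z0 \<bullet> d)\<^sup>2 \<le> 2 * (c k z)\<^sup>2 + 2 * (e * x)\<^sup>2" if k: "k \<in> I" for k
    proof -
      define a where "a = grad (c k) z0 \<bullet> d"
      have "\<bar>c k z - a\<bar> \<le> e * x"
        using linearizedD(6)[OF lin z z0 k] c_z0[OF k] by (simp add: a_def d_def x_def inner_commute)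
      then have "(c k z - a)\<^sup>2 \<le> (e * x)\<^sup>2"
        by (metis abs_ge_zero power2_abs power_mono)
      moreover have "a\<^sup>2 \<le> 2 * (c k z)\<^sup>2 + 2 * (c k z - a)\<^sup>2"
        using zero_le_power2[of "2 * c k z - a"] by (simp add: power2_eq_square algebra_simps)
      ultimately show ?thesis by (simp add: a_def)
    qed
    then have "(\<Sum>k\<in>I. (grad (c k) z0 \<bullet> d)\<^sup>2) \<le> (\<Sum>k\<in>I. 2 * (c k z)\<^sup>2 + 2 * (e * x)\<^sup>2)"
      by (rule sum_mono)
    also have "\<dots> = 2 * (\<Sum>k\<in>I. (c k z)\<^sup>2) + 2 * n * (e * x)\<^sup>2"
      by (simp add: sum.distrib sum_distrib_left n_def)
    also have "\<dots> \<le> 2 * (\<Sum>k\<in>I. (c k z)\<^sup>2) + 2 * n * (e * x\<^sup>2)"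
      using ex by (intro add_left_mono mult_left_mono) (auto simp: n_def)
    finally have "\<rho> * (\<Sum>k\<in>I. (grad (c k) z0 \<bullet> d)\<^sup>2) \<le> \<rho> * (2 * (\<Sum>k\<in>I. (c k z)\<^sup>2) + 2 * n * (e * x\<^sup>2))"
      using fin(2) by (intro mult_left_mono)
    then have "d \<bullet> lagr_hess w d \<ge> \<gamma> * x\<^sup>2 - 2 * \<rho> * (\<Sum>k\<in>I. (c k z)\<^sup>2) - 2 * \<rho> * n * e * x\<^sup>2"
      using fin(3)[OF w, of d] by (simp add: x_def algebra_simps)
    moreover have "2 * (\<Lambda> z - \<Psi> w z0) \<ge> d \<bullet> lagr_hess w d - ((1 + N) * e) * x\<^sup>2"
      using mult_left_mono[OF L, of 2] by simp
    ultimately have "2 * (\<Lambda> z - \<Psi> w z0) \<ge> \<gamma> * x\<^sup>2 - 2 * \<rho> * (\<Sum>k\<in>I. (c k z)\<^sup>2) - (D * e) * x\<^sup>2"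
      by (simp add: D_def algebra_simps)
    moreover have "(D * e) * x\<^sup>2 \<le> \<gamma> / 2 * x\<^sup>2" using De by (intro mult_right_mono) auto
    ultimately have "2 * (\<Lambda> z - \<Psi> w z0) \<ge> 2 * (\<gamma> / 4 * x\<^sup>2 - \<rho> * (\<Sum>k\<in>I. (c k z)\<^sup>2))"
      by (simp add: algebra_simps)
    then have "\<Lambda> z + \<rho> * (\<Sum>k\<in>I. (c k z)\<^sup>2) \<ge> \<Psi> w z0 + \<gamma> / 4 * x\<^sup>2"
      by simp
    then show ?thesis by (simp add: \<Lambda>_def x_def d_def)
  qed
  moreover have "\<gamma> / 4 > 0" using fin by simp
  ultimately show ?thesis using that e(1) fin(2) by blast
qed

text \<open>Completing the square in \<open>\<nu> * x - (\<omega> - \<rho>) * x\<^sup>2\<close> shows that the penalized objective can undercut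
  its value at \<open>z0\<close> only within distance \<open>O((\<omega> - \<rho>) powr (-1/2))\<close>.  On the side \<open>c k z < 0\<close>, where
  the penalty is silent, the positive multiplier does the work: \<open>\<nu> * x + \<rho> * x\<^sup>2 \<le> 0\<close> for small \<open>\<bar>x\<bar>\<close>.\<close>

lemma penalized_minimizer_exists:
  obtains e where "e > 0"
    "\<And>r. linearized e r \<Longrightarrow> \<exists>\<omega>0>0. \<forall>w\<in>W. \<forall>\<omega>\<ge>\<omega>0. \<exists>z\<in>surface \<inter> ball z0 r.
       \<forall>y\<in>surface \<inter> cball z0 r. pen w \<omega> z \<le> pen w \<omega> y"
proof -
  obtain e1 \<gamma> \<rho> where e1: "e1 > 0" and gr: "\<gamma> > 0" "\<rho> \<ge> 0"
    "\<And>r w z. linearized e1 r \<Longrightarrow> w \<in> W \<Longrightarrow> z \<in> cball z0 r \<Longrightarrow>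
       \<Psi> w z + (\<Sum>k\<in>I. \<nu>s w k * c k z) + \<rho> * (\<Sum>k\<in>I. (c k z)\<^sup>2) \<ge> \<Psi> w z0 + \<gamma> * (norm (z - z0))\<^sup>2"
    using quadratic_growth by blast
  obtain lam0 where lam0: "lam0 > 0" "\<And>w k. w \<in> W \<Longrightarrow> k \<in> B \<Longrightarrow> \<nu>s w k \<ge> lam0"
    using nus_positive by blast
  obtain N where N: "N \<ge> 0" "\<And>w. w \<in> W \<Longrightarrow> (\<Sum>k\<in>I. \<bar>\<nu>s w k\<bar>) \<le> N"
    using nus_bound by blast
  define \<alpha> where "\<alpha> = (\<Sum>k\<in>I. norm (grad (c k) z0))"
  have alpha: "\<alpha> \<ge> 0" by (auto simp: \<alpha>_def intro: sum_nonneg)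
  define e where "e = min (min e1 1) (lam0 / ((\<rho> + 1) * (\<alpha> + 1)))"
  have e: "e > 0" "e \<le> e1" "e \<le> 1" "e \<le> lam0 / ((\<rho> + 1) * (\<alpha> + 1))"
    using e1 lam0 gr alpha by (auto simp: e_def)
  have "\<exists>\<omega>0>0. \<forall>w\<in>W. \<forall>\<omega>\<ge>\<omega>0. \<exists>z\<in>surface \<inter> ball z0 r.
       \<forall>y\<in>surface \<inter> cball z0 r. pen w \<omega> z \<le> pen w \<omega> y" if lin: "linearized e r" for r
  proof -
    have r: "r > 0" "r \<le> e" "cball z0 r \<subseteq> U" using linearizedD(1-3)[OF lin] .
    define n where "n = real (card B)"
    \<comment> \<open>The minimizer satisfies \<open>\<gamma> * (norm (z - z0))\<^sup>2 \<le> n * N\<^sup>2 / (4 * (\<omega> - \<rho>))\<close>; the last summand makes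
      the right-hand side smaller than \<open>\<gamma> * r\<^sup>2\<close>.\<close>
    define \<omega>0 where "\<omega>0 = \<rho> + 1 + n * N\<^sup>2 / (\<gamma> * r\<^sup>2)"
    have nN: "n * N\<^sup>2 \<ge> 0" by (simp add: n_def)
    have om0: "\<omega>0 \<ge> \<rho> + 1" using nN gr(1) by (simp add: \<omega>0_def)
    have "\<exists>z\<in>surface \<inter> ball z0 r. \<forall>y\<in>surface \<inter> cball z0 r. pen w \<omega> z \<le> pen w \<omega> y"
      if w: "w \<in> W" and om: "\<omega> \<ge> \<omega>0" for w \<omega>
    proof -
      have "surface \<inter> cball z0 r = {z \<in> cball z0 r. \<forall>k\<in>I - B. c k z = 0}"
        using r(3) by (auto simp: surface_def)
      also have "\<dots> = cball z0 r \<inter> (\<Inter>k\<in>I - B. {z \<in> cball z0 r. c k z = 0})" by auto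
      finally have S: "surface \<inter> cball z0 r = cball z0 r \<inter> (\<Inter>k\<in>I - B. {z \<in> cball z0 r. c k z = 0})" .
      have "closed {z \<in> cball z0 r. c k z = 0}" if "k \<in> I" for k
        by (intro continuous_closed_preimage_constant continuous_on_subset[OF c_continuous r(3)] that closed_cball)
      then have "compact (surface \<inter> cball z0 r)"
        unfolding S by (intro compact_Int_closed closed_INT) auto
      moreover have z0S: "z0 \<in> surface \<inter> cball z0 r"
        using U c_z0 r by (auto simp: surface_def)
      moreover have "continuous_on (surface \<inter> cball z0 r) (pen w \<omega>)"
        by (rule continuous_on_subset[OF C1_on_continuous[OF pen_C1[OF w]]]) (use r in auto)
      ultimately obtain z where z: "z \<in> surface \<inter> cball z0 r"
          "\<And>y. y \<in> surface \<inter> cball z0 r \<Longrightarrow> pen w \<omega> z \<le> pen w \<omega> y"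
        using continuous_attains_inf by (metis empty_iff)
      have zc: "z \<in> cball z0 r" using z by auto
      define \<tau> where "\<tau> = \<omega> - \<rho>"
      have tau: "\<tau> > 0" using om om0 by (simp add: \<tau>_def)
      have tri: "\<nu>s w k * c k z + \<rho> * (c k z)\<^sup>2 - \<omega> * (max 0 (c k z))\<^sup>2 \<le> N\<^sup>2 / (4 * \<tau>)" if k: "k \<in> B" for k
      proof (cases "c k z \<ge> 0")
        case True
        have kI: "k \<in> I" using k BI by auto
        have "\<nu>s w k \<le> (\<Sum>k\<in>I. \<bar>\<nu>s w k\<bar>)"
          using member_le_sum[of k I "\<lambda>k. \<bar>\<nu>s w k\<bar>"] kI I by (auto intro: order_trans[OF abs_ge_self])
        then have "\<nu>s w k \<le> N" using N(2)[OF w] by simp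
        then have "\<nu>s w k * c k z \<le> N * c k z" using True by (intro mult_right_mono)
        moreover have "N * c k z - \<tau> * (c k z)\<^sup>2 \<le> N\<^sup>2 / (4 * \<tau>)"
        proof -
          have "0 \<le> (N - 2 * \<tau> * c k z)\<^sup>2 / (4 * \<tau>)" using tau by simp
          also have "\<dots> = N\<^sup>2 / (4 * \<tau>) - N * c k z + \<tau> * (c k z)\<^sup>2"
            using tau by (simp add: field_simps power2_eq_square)
          finally show ?thesis by simp
        qed
        ultimately show ?thesis using True by (simp add: \<tau>_def algebra_simps)
      next
        case False
        have kI: "k \<in> I" using k BI by auto
        have zn: "norm (z - z0) \<le> e" using zc r by (auto simp: dist_norm norm_minus_commute)
        have "\<bar>c k z\<bar> \<le> \<bar>(z - z0) \<bullet> grad (c k) z0\<bar> + e * norm (z - z0)"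
          using linearizedD(6)[OF lin zc _ kI, of z0] c_z0[OF kI] r(1) by simp
        also have "\<bar>(z - z0) \<bullet> grad (c k) z0\<bar> \<le> norm (z - z0) * norm (grad (c k) z0)"
          by (rule Cauchy_Schwarz_ineq2)
        also have "norm (grad (c k) z0) \<le> \<alpha>"
          unfolding \<alpha>_def using kI I by (intro member_le_sum) auto
        then have "norm (z - z0) * norm (grad (c k) z0) + e * norm (z - z0) \<le> norm (z - z0) * \<alpha> + 1 * norm (z - z0)"
          using e by (intro add_mono mult_left_mono mult_right_mono) auto
        also have "\<dots> = norm (z - z0) * (\<alpha> + 1)" by (simp add: algebra_simps)
        also have "\<dots> \<le> lam0 / ((\<rho> + 1) * (\<alpha> + 1)) * (\<alpha> + 1)"
          using zn e(4) alpha by (intro mult_right_mono) auto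
        also have "\<dots> = lam0 / (\<rho> + 1)" using alpha by simp
        finally have "(\<rho> + 1) * \<bar>c k z\<bar> \<le> lam0" using gr(2) by (simp add: field_simps)
        then have "\<rho> * \<bar>c k z\<bar> \<le> \<nu>s w k" using lam0(2)[OF w k] by (simp add: algebra_simps)
        then have "\<rho> * \<bar>c k z\<bar> * \<bar>c k z\<bar> \<le> \<nu>s w k * \<bar>c k z\<bar>" by (intro mult_right_mono) auto
        then have "\<nu>s w k * c k z + \<rho> * (c k z)\<^sup>2 \<le> 0" using False by (simp add: power2_eq_square)
        moreover have "N\<^sup>2 / (4 * \<tau>) \<ge> 0" using tau by simp
        ultimately show ?thesis using False by simp
      qed
      have off: "(\<Sum>k\<in>I. f k) = (\<Sum>k\<in>B. f k)" if "\<And>k. k \<in> I - B \<Longrightarrow> f k = 0" for f :: "'k \<Rightarrow> real"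
        using that by (intro sum.mono_neutral_right I BI) auto
      have c0: "c k z = 0" if "k \<in> I - B" for k using z(1) that by (auto simp: surface_def)
      have "(\<Sum>k\<in>B. (max 0 (c k z0))\<^sup>2) = 0" using BI by (intro sum.neutral) (auto simp: c_z0)
      then have "pen w \<omega> z0 = \<Psi> w z0" by (simp add: pen_def)
      then have "\<Psi> w z + \<omega> * (\<Sum>k\<in>B. (max 0 (c k z))\<^sup>2) \<le> \<Psi> w z0"
        using z(2)[OF z0S] by (simp add: pen_def[of w \<omega> z])
      also have "\<dots> \<le> \<Psi> w z + (\<Sum>k\<in>B. \<nu>s w k * c k z) + \<rho> * (\<Sum>k\<in>B. (c k z)\<^sup>2) - \<gamma> * (norm (z - z0))\<^sup>2"
      proof -
        have "(\<Sum>k\<in>I. \<nu>s w k * c k z) = (\<Sum>k\<in>B. \<nu>s w k * c k z)" "(\<Sum>k\<in>I. (c k z)\<^sup>2) = (\<Sum>k\<in>B. (c k z)\<^sup>2)"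
          by (rule off, simp add: c0)+
        then show ?thesis using gr(3)[OF linearized_mono[OF lin e(2)] w zc] by simp
      qed
      finally have "\<gamma> * (norm (z - z0))\<^sup>2 \<le>
          (\<Sum>k\<in>B. \<nu>s w k * c k z + \<rho> * (c k z)\<^sup>2 - \<omega> * (max 0 (c k z))\<^sup>2)"
        by (simp add: sum.distrib sum_subtractf sum_distrib_left)
      also have "\<dots> \<le> (\<Sum>k\<in>B. N\<^sup>2 / (4 * \<tau>))" by (rule sum_mono[OF tri])
      also have "\<dots> = n * N\<^sup>2 / (4 * \<tau>)" by (simp add: n_def)
      also have "\<dots> < \<gamma> * r\<^sup>2"
      proof -
        have "n * N\<^sup>2 / (\<gamma> * r\<^sup>2) < \<tau>" using om by (simp add: \<omega>0_def \<tau>_def)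
        then have "n * N\<^sup>2 < \<tau> * (\<gamma> * r\<^sup>2)" using gr(1) r(1) by (simp add: pos_divide_less_eq)
        moreover have "\<tau> * (\<gamma> * r\<^sup>2) > 0" using tau gr(1) r(1) by simp
        ultimately show ?thesis using tau by (simp add: pos_divide_less_eq mult_ac)
      qed
      finally have "(norm (z - z0))\<^sup>2 < r\<^sup>2" using gr(1) by simp
      then have "norm (z - z0) < r" using r(1) by (simp add: power2_less_imp_less)
      then have "z \<in> ball z0 r" by (simp add: dist_norm norm_minus_commute)
      then show ?thesis using z by blast
    qed
    moreover have "\<omega>0 > 0" using om0 gr(2) by simp
    ultimately show ?thesis by blast
  qed
  with e(1) show ?thesis by (rule that)
qed

text \<open>Existence comes from compactness and uniqueness from \<open>kkt_stability\<close>.  Uniqueness also gives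
  strictness: a point of the ball with the same value would be another local minimizer.\<close>

theorem local_branch:
  obtains r \<omega>0 C zl where "r > 0" "cball z0 r \<subseteq> U" "\<omega>0 > 0" "C > 0"
    "\<And>w \<omega>. w \<in> W \<Longrightarrow> \<omega> \<ge> \<omega>0 \<Longrightarrow> zl \<omega> w \<in> ball z0 r"
    "\<And>w \<omega>. w \<in> W \<Longrightarrow> \<omega> \<ge> \<omega>0 \<Longrightarrow> strict_local_min_on (pen w \<omega>) surface (zl \<omega> w)"
    "\<And>w \<omega> z. w \<in> W \<Longrightarrow> \<omega> \<ge> \<omega>0 \<Longrightarrow> z \<in> ball z0 r \<Longrightarrow> local_min_on (pen w \<omega>) surface z \<Longrightarrow> z = zl \<omega> w"
    "\<And>w \<omega> \<omega>'. w \<in> W \<Longrightarrow> \<omega> \<ge> \<omega>0 \<Longrightarrow> \<omega>' \<ge> \<omega>0 \<Longrightarrow> norm (zl \<omega> w - zl \<omega>' w) \<le> C * \<bar>1 / \<omega> - 1 / \<omega>'\<bar>"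
    "\<And>w \<omega>. w \<in> W \<Longrightarrow> \<omega> \<ge> \<omega>0 \<Longrightarrow> norm (zl \<omega> w - z0) \<le> C / \<omega>"
    "\<And>w \<omega> k. w \<in> W \<Longrightarrow> \<omega> \<ge> \<omega>0 \<Longrightarrow> k \<in> B \<Longrightarrow> c k (zl \<omega> w) > 0 \<and>
       \<bar>c k (zl \<omega> w) - \<nu>s w k / (2 * \<omega>)\<bar> \<le> C / \<omega>\<^sup>2"
proof -
  obtain e1 \<eta>0 C where st: "e1 > 0" "\<eta>0 > 0" "C > 0"
    "\<And>r w y z \<nu> \<mu> \<eta> \<theta>. linearized e1 r \<Longrightarrow> w \<in> W \<Longrightarrow> y \<in> cball z0 r \<Longrightarrow> z \<in> cball z0 r \<Longrightarrow>
       \<eta> \<in> {0..\<eta>0} \<Longrightarrow> \<theta> \<in> {0..\<eta>0} \<Longrightarrow> kkt w \<eta> y \<nu> \<Longrightarrow> kkt w \<theta> z \<mu> \<Longrightarrow>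
       norm (y - z) + (\<Sum>k\<in>I. \<bar>\<nu> k - \<mu> k\<bar>) \<le> C * \<bar>\<eta> - \<theta>\<bar>"
    using kkt_stability by blast
  obtain e2 where e2: "e2 > 0"
    "\<And>r w \<omega> z. linearized e2 r \<Longrightarrow> w \<in> W \<Longrightarrow> \<omega> > 0 \<Longrightarrow> z \<in> ball z0 r \<Longrightarrow>
       local_min_on (pen w \<omega>) surface z \<Longrightarrow> \<exists>\<nu>. kkt w (1 / \<omega>) z \<nu> \<and> (\<forall>k\<in>B. \<nu> k > 0)"
    using local_min_imp_kkt by blast
  obtain e3 where e3: "e3 > 0"
    "\<And>r. linearized e3 r \<Longrightarrow> \<exists>\<omega>0>0. \<forall>w\<in>W. \<forall>\<omega>\<ge>\<omega>0. \<exists>z\<in>surface \<inter> ball z0 r.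
       \<forall>y\<in>surface \<inter> cball z0 r. pen w \<omega> z \<le> pen w \<omega> y"
    using penalized_minimizer_exists by blast
  obtain r where "linearized (min e1 (min e2 e3)) r"
    using linearized_exists[of "min e1 (min e2 e3)"] st(1) e2(1) e3(1) by auto
  then have lin: "linearized e1 r" "linearized e2 r" "linearized e3 r"
    by (auto elim: linearized_mono)
  have r: "r > 0" "cball z0 r \<subseteq> U" using linearizedD(1,3)[OF lin(1)] .
  obtain \<omega>1 where om1: "\<omega>1 > 0" "\<And>w \<omega>. w \<in> W \<Longrightarrow> \<omega> \<ge> \<omega>1 \<Longrightarrow>
      \<exists>z\<in>surface \<inter> ball z0 r. \<forall>y\<in>surface \<inter> cball z0 r. pen w \<omega> z \<le> pen w \<omega> y"
    using e3(2)[OF lin(3)] by blast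
  define \<omega>0 where "\<omega>0 = max \<omega>1 (1 / \<eta>0)"
  have om0: "\<omega>0 > 0" using om1 by (simp add: \<omega>0_def)
  have eta: "1 / \<omega> \<in> {0..\<eta>0}" if "\<omega> \<ge> \<omega>0" for \<omega>
  proof -
    have "\<omega> > 0" "1 / \<eta>0 \<le> \<omega>" using that om0 by (auto simp: \<omega>0_def)
    then show ?thesis using st(2) by (simp add: field_simps)
  qed
  have "\<exists>z. z \<in> surface \<inter> ball z0 r \<and> (\<forall>y\<in>surface \<inter> cball z0 r. pen w \<omega> z \<le> pen w \<omega> y)"
    if "w \<in> W" "\<omega> \<ge> \<omega>0" for w \<omega>
    using om1(2)[of w \<omega>] that by (auto simp: \<omega>0_def)
  note ex = this
  define zl where "zl \<omega> w = (SOME z. z \<in> surface \<inter> ball z0 r \<and>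
      (\<forall>y\<in>surface \<inter> cball z0 r. pen w \<omega> z \<le> pen w \<omega> y))" for \<omega> w
  have zl: "zl \<omega> w \<in> surface \<inter> ball z0 r \<and> (\<forall>y\<in>surface \<inter> cball z0 r. pen w \<omega> (zl \<omega> w) \<le> pen w \<omega> y)"
    if "w \<in> W" "\<omega> \<ge> \<omega>0" for w \<omega>
    unfolding zl_def by (rule someI_ex[OF ex[OF that]])
  have lmin: "local_min_on (pen w \<omega>) surface z"
    if "w \<in> W" "\<omega> \<ge> \<omega>0" "z \<in> surface \<inter> ball z0 r" "pen w \<omega> z \<le> pen w \<omega> (zl \<omega> w)" for w \<omega> z
    unfolding local_min_on_def
  proof (intro conjI exI[of _ "ball z0 r"] ballI)
    fix y assume "y \<in> surface \<inter> ball z0 r"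
    then have "pen w \<omega> (zl \<omega> w) \<le> pen w \<omega> y" using zl[OF that(1,2)] by auto
    then show "pen w \<omega> z \<le> pen w \<omega> y" using that(4) by simp
  qed (use that in auto)
  have kkt: "\<exists>\<nu>. kkt w (1 / \<omega>) z \<nu> \<and> (\<forall>k\<in>B. \<nu> k > 0)"
    if "w \<in> W" "\<omega> \<ge> \<omega>0" "z \<in> ball z0 r" "local_min_on (pen w \<omega>) surface z" for w \<omega> z
    using e2(2)[OF lin(2) that(1) _ that(3,4)] that(2) om0 by simp
  have uniq: "z = zl \<omega> w"
    if w: "w \<in> W" "\<omega> \<ge> \<omega>0" and z: "z \<in> ball z0 r" "local_min_on (pen w \<omega>) surface z" for w \<omega> z
  proof -
    have zlb: "zl \<omega> w \<in> ball z0 r" using zl[OF w] by blast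
    obtain \<nu> where "kkt w (1 / \<omega>) z \<nu>" using kkt[OF w z] by blast
    moreover obtain \<mu> where "kkt w (1 / \<omega>) (zl \<omega> w) \<mu>"
      using kkt[OF w zlb lmin[OF w]] zl[OF w] by blast
    ultimately have "norm (z - zl \<omega> w) + (\<Sum>k\<in>I. \<bar>\<nu> k - \<mu> k\<bar>) \<le> C * \<bar>1 / \<omega> - 1 / \<omega>\<bar>"
      using z zlb by (intro st(4)[OF lin(1) w(1) _ _ eta[OF w(2)] eta[OF w(2)]]) auto
    moreover have "(\<Sum>k\<in>I. \<bar>\<nu> k - \<mu> k\<bar>) \<ge> 0" by (intro sum_nonneg) auto
    ultimately have "norm (z - zl \<omega> w) \<le> C * \<bar>1 / \<omega> - 1 / \<omega>\<bar>" by linarith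
    then show ?thesis by simp
  qed
  define \<nu>l where "\<nu>l \<omega> w = (SOME \<nu>. kkt w (1 / \<omega>) (zl \<omega> w) \<nu> \<and> (\<forall>k\<in>B. \<nu> k > 0))" for \<omega> w
  have \<nu>l: "kkt w (1 / \<omega>) (zl \<omega> w) (\<nu>l \<omega> w) \<and> (\<forall>k\<in>B. \<nu>l \<omega> w k > 0)"
    if "w \<in> W" "\<omega> \<ge> \<omega>0" for w \<omega>
  proof -
    have "\<exists>\<nu>. kkt w (1 / \<omega>) (zl \<omega> w) \<nu> \<and> (\<forall>k\<in>B. \<nu> k > 0)"
      using kkt[OF that _ lmin[OF that]] zl[OF that] by blast
    then show ?thesis unfolding \<nu>l_def by (rule someI_ex)
  qed
  have strict: "strict_local_min_on (pen w \<omega>) surface (zl \<omega> w)" if w: "w \<in> W" "\<omega> \<ge> \<omega>0" for w \<omega>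
    unfolding strict_local_min_on_def
  proof (intro conjI exI[of _ "ball z0 r"] ballI impI)
    fix y assume y: "y \<in> surface \<inter> ball z0 r" "y \<noteq> zl \<omega> w"
    show "pen w \<omega> (zl \<omega> w) < pen w \<omega> y"
    proof (rule ccontr)
      assume "\<not> pen w \<omega> (zl \<omega> w) < pen w \<omega> y"
      then have "y = zl \<omega> w" using y by (intro uniq[OF w _ lmin[OF w]]) auto
      then show False using y by simp
    qed
  qed (use zl[OF w] in auto)
  have zlc: "zl \<omega> w \<in> cball z0 r" if "w \<in> W" "\<omega> \<ge> \<omega>0" for w \<omega>
    using zl[OF that] by auto
  have lip: "norm (zl \<omega> w - zl \<omega>' w) \<le> C * \<bar>1 / \<omega> - 1 / \<omega>'\<bar>"
    if "w \<in> W" "\<omega> \<ge> \<omega>0" "\<omega>' \<ge> \<omega>0" for w \<omega> \<omega>'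
  proof -
    have "norm (zl \<omega> w - zl \<omega>' w) + (\<Sum>k\<in>I. \<bar>\<nu>l \<omega> w k - \<nu>l \<omega>' w k\<bar>) \<le> C * \<bar>1 / \<omega> - 1 / \<omega>'\<bar>"
      using \<nu>l that by (intro st(4)[OF lin(1) that(1) zlc zlc eta eta]) auto
    moreover have "(\<Sum>k\<in>I. \<bar>\<nu>l \<omega> w k - \<nu>l \<omega>' w k\<bar>) \<ge> 0" by (intro sum_nonneg) auto
    ultimately show ?thesis by linarith
  qed
  have lim: "norm (zl \<omega> w - z0) + (\<Sum>k\<in>I. \<bar>\<nu>l \<omega> w k - \<nu>s w k\<bar>) \<le> C / \<omega>"
    if w: "w \<in> W" "\<omega> \<ge> \<omega>0" for w \<omega>
  proof -
    have "kkt w 0 z0 (\<nu>s w)" using stationary[OF w(1)] c_z0 BI by (auto simp: kkt_def)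
    then have "norm (zl \<omega> w - z0) + (\<Sum>k\<in>I. \<bar>\<nu>l \<omega> w k - \<nu>s w k\<bar>) \<le> C * \<bar>1 / \<omega> - 0\<bar>"
      using \<nu>l[OF w] r st(2) by (intro st(4)[OF lin(1) w(1) zlc[OF w] _ eta[OF w(2)]]) auto
    then show ?thesis using w(2) om0 by simp
  qed
  have "c k (zl \<omega> w) > 0 \<and> \<bar>c k (zl \<omega> w) - \<nu>s w k / (2 * \<omega>)\<bar> \<le> C / \<omega>\<^sup>2"
    if w: "w \<in> W" "\<omega> \<ge> \<omega>0" and k: "k \<in> B" for w \<omega> k
  proof -
    have om: "\<omega> > 0" using w om0 by simp
    have ceq: "c k (zl \<omega> w) = \<nu>l \<omega> w k / (2 * \<omega>)" and pos: "\<nu>l \<omega> w k > 0"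
      using \<nu>l[OF w] k by (auto simp: kkt_def)
    have "\<bar>\<nu>l \<omega> w k - \<nu>s w k\<bar> \<le> (\<Sum>k\<in>I. \<bar>\<nu>l \<omega> w k - \<nu>s w k\<bar>)"
      using k BI I by (intro member_le_sum) auto
    also have "\<dots> \<le> C / \<omega>" using lim[OF w] norm_ge_zero[of "zl \<omega> w - z0"] by linarith
    finally have "\<bar>\<nu>l \<omega> w k - \<nu>s w k\<bar> / (2 * \<omega>) \<le> (C / \<omega>) / (2 * \<omega>)" using om by (intro divide_right_mono) auto
    also have "\<dots> \<le> C / \<omega>\<^sup>2" using om st(3) by (simp add: field_simps power2_eq_square)
    finally have "\<bar>\<nu>l \<omega> w k - \<nu>s w k\<bar> / (2 * \<omega>) \<le> C / \<omega>\<^sup>2" .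
    moreover have "\<bar>c k (zl \<omega> w) - \<nu>s w k / (2 * \<omega>)\<bar> = \<bar>\<nu>l \<omega> w k - \<nu>s w k\<bar> / (2 * \<omega>)"
      unfolding ceq diff_divide_distrib[symmetric] abs_divide using om by simp
    ultimately show ?thesis using ceq pos om by simp
  qed
  moreover have "norm (zl \<omega> w - z0) \<le> C / \<omega>" if w: "w \<in> W" "\<omega> \<ge> \<omega>0" for w \<omega>
  proof -
    have "(\<Sum>k\<in>I. \<bar>\<nu>l \<omega> w k - \<nu>s w k\<bar>) \<ge> 0" by (intro sum_nonneg) auto
    then show ?thesis using lim[OF w] by linarith
  qed
  ultimately show ?thesis
    using that[of r \<omega>0 C zl] r om0 st(3) zl strict uniq lip by blast
qed

end

section \<open>Reduction of the priority cascade to the regular penalty problem\<close>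

text \<open>Gaussian elimination: the vectors of \<open>K\<close> lie in a finite-dimensional space spanned by members of
  \<open>K\<close>, with coefficients that are linear functions of the vector.\<close>

lemma finite_spanning_members:
  fixes K :: "('k \<Rightarrow> real) set"
  assumes "finite I"
  shows "\<exists>n a s. (\<forall>p<n. a p \<in> K) \<and>
    (\<forall>w\<in>K. \<forall>k\<in>I. w k = (\<Sum>p<(n::nat). (\<Sum>m\<in>I. s p m * w m) * a p k))"
  using assms
proof (induction I rule: finite_induct)
  case empty
  show ?case by (intro exI[of _ 0]) auto
next
  case (insert k0 I)
  obtain n a s where IH: "\<And>p. p < n \<Longrightarrow> a p \<in> K"
      "\<And>w k. w \<in> K \<Longrightarrow> k \<in> I \<Longrightarrow> w k = (\<Sum>p<(n::nat). (\<Sum>m\<in>I. s p m * w m) * a p k)"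
    using insert.IH by blast
  define t where "t p w = (\<Sum>m\<in>I. s p m * w m)" for p and w :: "'k \<Rightarrow> real"
  \<comment> \<open>\<open>R w\<close> is the defect of the old representation in the new coordinate.  If it does not vanish
    identically, a member \<open>b\<close> with \<open>R b \<noteq> 0\<close> serves as the pivot.\<close>
  define R where "R w = w k0 - (\<Sum>p<n. t p w * a p k0)" for w
  show ?case
  proof (cases "\<forall>w\<in>K. R w = 0")
    case True
    define s' where "s' p m = (if m = k0 then 0 else s p m)" for p m
    have "(\<Sum>m\<in>insert k0 I. s' p m * w m) = t p w" for p w
      using insert.hyps by (auto simp: t_def s'_def intro!: sum.cong)
    moreover have "w k = (\<Sum>p<n. t p w * a p k)" if "w \<in> K" "k \<in> insert k0 I" for w k
      using IH(2)[of w k] True that by (auto simp: t_def R_def)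
    ultimately show ?thesis
      using IH(1) by (intro exI[of _ n] exI[of _ a] exI[of _ s']) auto
  next
    case False
    then obtain b where b: "b \<in> K" "R b \<noteq> 0" by blast
    define s' where "s' p m = (if m = k0 then 0 else s p m)" for p m
    define r where "r m = (if m = k0 then 1 else - (\<Sum>p<n. s p m * a p k0)) / R b" for m
    define a' where "a' p = (if p < n then a p else b)" for p
    define s'' where "s'' p m = (if p < n then s' p m - t p b * r m else r m)" for p m
    have t': "(\<Sum>m\<in>insert k0 I. s' p m * w m) = t p w" for p w
      using insert.hyps by (auto simp: t_def s'_def intro!: sum.cong)
    have r: "(\<Sum>m\<in>insert k0 I. r m * w m) = R w / R b" for w
    proof -
      have "(\<Sum>m\<in>I. r m * w m) = (\<Sum>m\<in>I. - (\<Sum>p<n. s p m * a p k0 * w m) / R b)"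
        using insert.hyps by (intro sum.cong) (auto simp: r_def sum_distrib_right)
      also have "\<dots> = - (\<Sum>m\<in>I. \<Sum>p<n. s p m * a p k0 * w m) / R b"
        by (simp add: sum_divide_distrib sum_negf)
      also have "(\<Sum>m\<in>I. \<Sum>p<n. s p m * a p k0 * w m) = (\<Sum>p<n. t p w * a p k0)"
        by (subst sum.swap) (simp add: t_def sum_distrib_right sum_distrib_left mult_ac)
      finally show ?thesis
        using insert.hyps by (simp add: r_def R_def diff_divide_distrib)
    qed
    have s'': "(\<Sum>m\<in>insert k0 I. s'' p m * w m) = (if p < n then t p w - t p b * (R w / R b) else R w / R b)" for p w
    proof (cases "p < n")
      case True
      have "(\<Sum>m\<in>insert k0 I. s'' p m * w m) =
          (\<Sum>m\<in>insert k0 I. s' p m * w m) - t p b * (\<Sum>m\<in>insert k0 I. r m * w m)"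
        using True by (simp only: s''_def if_True sum_distrib_left sum_subtractf[symmetric] left_diff_distrib mult.assoc)
      then show ?thesis using True by (simp only: t' r if_True)
    next
      case False
      then have "(\<Sum>m\<in>insert k0 I. s'' p m * w m) = (\<Sum>m\<in>insert k0 I. r m * w m)"
        by (simp only: s''_def if_False)
      then show ?thesis using False by (simp only: r if_False)
    qed
    have "w k = (\<Sum>p<Suc n. (\<Sum>m\<in>insert k0 I. s'' p m * w m) * a' p k)"
      if w: "w \<in> K" and k: "k \<in> insert k0 I" for w k
    proof -
      have "(\<Sum>p<Suc n. (\<Sum>m\<in>insert k0 I. s'' p m * w m) * a' p k) =
          (\<Sum>p<n. (t p w - t p b * (R w / R b)) * a p k) + R w / R b * b k"
        unfolding s'' by (simp add: a'_def)
      also have "\<dots> = (\<Sum>p<n. t p w * a p k) + R w / R b * (b k - (\<Sum>p<n. t p b * a p k))"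
        by (simp add: left_diff_distrib sum_subtractf sum_distrib_left right_diff_distrib mult_ac)
      also have "\<dots> = w k"
      proof (cases "k = k0")
        case True
        then show ?thesis using b by (simp add: R_def[symmetric]) (simp add: R_def)
      next
        case False
        then have "k \<in> I" using k by simp
        then show ?thesis using IH(2)[OF w] IH(2)[OF b(1)] by (simp add: t_def[symmetric])
      qed
      finally show ?thesis by simp
    qed
    moreover have "\<forall>p<Suc n. a' p \<in> K" using IH(1) b(1) by (auto simp: a'_def)
    ultimately show ?thesis by blast
  qed
qed

lemma local_min_on_transfer:
  assumes U: "open U" "z \<in> U" and S: "S \<inter> U = S' \<inter> U" and F: "\<And>y. y \<in> U \<Longrightarrow> F y = F' y"
    and "local_min_on F S z"
  shows "local_min_on F' S' z"
proof -
  obtain T where T: "open T" "z \<in> T" "\<And>y. y \<in> S \<inter> T \<Longrightarrow> F z \<le> F y" and z: "z \<in> S"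
    using assms(5) unfolding local_min_on_def by blast
  have "F' z \<le> F' y" if "y \<in> S' \<inter> (T \<inter> U)" for y
    using T(3)[of y] that S F U by auto
  then show ?thesis
    unfolding local_min_on_def using T U z S by (intro conjI exI[of _ "T \<inter> U"]) auto
qed

lemma strict_local_min_on_transfer:
  assumes U: "open U" "z \<in> U" and S: "S \<inter> U = S' \<inter> U" and F: "\<And>y. y \<in> U \<Longrightarrow> F y = F' y"
    and "strict_local_min_on F S z"
  shows "strict_local_min_on F' S' z"
proof -
  obtain T where T: "open T" "z \<in> T" "\<And>y. y \<in> S \<inter> T \<Longrightarrow> y \<noteq> z \<Longrightarrow> F z < F y" and z: "z \<in> S"
    using assms(5) unfolding strict_local_min_on_def by blast
  have "F' z < F' y" if "y \<in> S' \<inter> (T \<inter> U)" "y \<noteq> z" for y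
    using T(3)[of y] that S F U by auto
  then show ?thesis
    unfolding strict_local_min_on_def using T U z S by (intro conjI exI[of _ "T \<inter> U"]) auto
qed

lemma weighted_sum_split:
  assumes "i \<in> {1..L}"
  shows "weighted_sum J V L (w(i := \<omega>)) z = Psi J V L i w z + \<omega> * V i z"
proof -
  have "(\<Sum>k=1..L. (w(i := \<omega>)) k * V k z) = \<omega> * V i z + (\<Sum>k\<in>{1..L} - {i}. (w(i := \<omega>)) k * V k z)"
    using assms by (subst sum.remove[of _ i]) auto
  also have "(\<Sum>k\<in>{1..L} - {i}. (w(i := \<omega>)) k * V k z) = (\<Sum>k\<in>{1..L} - {i}. w k * V k z)"
    by (rule sum.cong) auto
  finally show ?thesis by (simp add: weighted_sum_def Psi_def)
qed

text \<open>The coordinate \<open>i\<close>, which does not enter \<open>Psi\<close>, is set to \<open>1\<close> and stands for the coefficient of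
  \<open>J\<close>; linear relations between the modified weight vectors are then relations between the functions
  \<open>Psi J V L i w\<close>.  Combining members of the family rather than \<open>J\<close> and the \<open>V k\<close> is essential, because the
  latter may fail to be twice differentiable individually.\<close>

lemma Psi_finite_combination:
  assumes i: "i \<in> {1..L}"
  obtains n :: nat and a t where
    "\<And>p. p < n \<Longrightarrow> a p \<in> K" "\<And>p. continuous_on K (t p)"
    "\<And>w. w \<in> K \<Longrightarrow> Psi J V L i w = (\<lambda>z. \<Sum>p<n. t p w * Psi J V L i (a p) z)"
proof -
  define x where "x w = w(i := 1 :: real)" for w :: "nat \<Rightarrow> real"
  obtain n a s where a: "\<And>p. p < n \<Longrightarrow> a p \<in> x ` K"
    and s: "\<And>w k. w \<in> x ` K \<Longrightarrow> k \<in> {1..L} \<Longrightarrow> w k = (\<Sum>p<(n::nat). (\<Sum>m\<in>{1..L}. s p m * w m) * a p k)"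
    using finite_spanning_members[of "{1..L}" "x ` K", OF finite_atLeastAtMost] by blast
  have "\<forall>p. \<exists>y. p < n \<longrightarrow> y \<in> K \<and> a p = x y"
    using a by blast
  from choice[OF this] obtain b where b: "\<And>p. p < n \<Longrightarrow> b p \<in> K" "\<And>p. p < n \<Longrightarrow> a p = x (b p)" by blast
  define t where "t p w = (\<Sum>m\<in>{1..L}. s p m * x w m)" for p w
  have rep: "x w k = (\<Sum>p<n. t p w * x (b p) k)" if "w \<in> K" "k \<in> {1..L}" for w k
  proof -
    have "x w k = (\<Sum>p<n. t p w * a p k)" unfolding t_def by (rule s) (use that in auto)
    then show ?thesis using b(2) by simp
  qed
  have "continuous_on K (t p)" for p
  proof -
    have "continuous_on K (\<lambda>w. w m)" for m
      by (rule continuous_on_subset[OF continuous_on_product_coordinates]) auto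
    then have "continuous_on K (\<lambda>w. x w m)" for m
      by (cases "m = i") (simp_all add: x_def)
    then show ?thesis unfolding t_def by (intro continuous_intros)
  qed
  moreover have "Psi J V L i w z = (\<Sum>p<n. t p w * Psi J V L i (b p) z)" if w: "w \<in> K" for w z
  proof -
    have one: "(\<Sum>p<n. t p w) = 1" using rep[OF w i] by (simp add: x_def)
    have wk: "w k = (\<Sum>p<n. t p w * b p k)" if "k \<in> {1..L} - {i}" for k
      using rep[OF w, of k] that by (simp add: x_def)
    have "(\<Sum>k\<in>{1..L} - {i}. w k * V k z) = (\<Sum>k\<in>{1..L} - {i}. (\<Sum>p<n. t p w * b p k) * V k z)"
      by (rule sum.cong[OF refl]) (simp only: wk)
    also have "\<dots> = (\<Sum>p<n. \<Sum>k\<in>{1..L} - {i}. t p w * b p k * V k z)"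
      by (simp only: sum_distrib_right) (rule sum.swap)
    also have "\<dots> = (\<Sum>p<n. t p w * (\<Sum>k\<in>{1..L} - {i}. b p k * V k z))"
      by (simp only: sum_distrib_left mult.assoc)
    finally have sumV: "(\<Sum>k\<in>{1..L} - {i}. w k * V k z) = (\<Sum>p<n. t p w * (\<Sum>k\<in>{1..L} - {i}. b p k * V k z))" .
    have "(\<Sum>p<n. t p w * J z) = J z" using one by (simp only: sum_distrib_right[symmetric] mult_1)
    then show ?thesis
      unfolding Psi_def sumV by (simp add: distrib_left sum.distrib)
  qed
  then have "\<And>w. w \<in> K \<Longrightarrow> Psi J V L i w = (\<lambda>z. \<Sum>p<n. t p w * Psi J V L i (b p) z)" by blast
  ultimately show ?thesis using that[of n b t] b(1) by blast
qed

lemma hess_Lagrangian: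
  fixes \<Psi> :: "'a::euclidean_space \<Rightarrow> real"
  assumes U: "open U" "z \<in> U" and fin: "finite B" "finite C" and C2: "C2_on U \<Psi>" "\<And>j. j \<in> B \<Longrightarrow> C2_on U (gi j)" "\<And>c. c \<in> C \<Longrightarrow> C2_on U (h c)"
  shows "hess (\<lambda>y. \<Psi> y + (\<Sum>j\<in>B. lam j * gi j y) + (\<Sum>c\<in>C. \<mu> c * h c y)) z d =
    hess \<Psi> z d + (\<Sum>j\<in>B. lam j *\<^sub>R hess (gi j) z d) + (\<Sum>c\<in>C. \<mu> c *\<^sub>R hess (h c) z d)"
proof -
  \<comment> \<open>The Lagrangian is one linear combination, with the index \<open>None\<close> for \<open>\<Psi>\<close> and its coefficient \<open>1\<close>.\<close>
  define f where "f = case_option \<Psi> (case_sum gi h)"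
  define s where "s = case_option 1 (case_sum lam \<mu>)"
  let ?I = "insert None (Some ` (B <+> C))"
  have split: "(\<Sum>k\<in>?I. F k) = F None + (\<Sum>j\<in>B. F (Some (Inl j))) + (\<Sum>c\<in>C. F (Some (Inr c)))"
    for F :: "('b + 'c) option \<Rightarrow> 'v::comm_monoid_add"
    using fin by (simp add: sum.reindex sum.Plus o_def add.assoc)
  have "C2_on U (f k)" if "k \<in> ?I" for k
    using that C2 by (auto simp: f_def)
  from hess_linear_combination[of U z ?I f s d, OF U this] show ?thesis
    unfolding split by (simp add: f_def s_def)
qed

lemma violation_near:
  assumes B: "B = binding ms g i zs" and neg: "\<And>j. j \<in> {1..ms i} - B \<Longrightarrow> g i j z < 0"
  shows "violation ms g i z = (\<Sum>j\<in>B. (max 0 (g i j z))\<^sup>2)"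
proof -
  have "B \<subseteq> {1..ms i}" using B by (auto simp: binding_def)
  moreover have "\<forall>j\<in>{1..ms i} - B. (max 0 (g i j z))\<^sup>2 = 0"
    using neg by (simp add: max_absorb1 less_imp_le)
  ultimately show ?thesis
    unfolding violation_def by (intro sum.mono_neutral_right) auto
qed

theorem mainTheorem6:
  fixes N L i :: nat
    and sx :: "nat \<Rightarrow> 'p::finite" and su :: "nat \<Rightarrow> 'q::finite"
    and f :: "real^'n::finite \<Rightarrow> real^'m::finite \<Rightarrow> real^'n"
    and x0 :: "real^'n" and Uhard :: "(real^'m) set"
    and l :: "real^'n \<Rightarrow> real^'m \<Rightarrow> real" and lf :: "real^'n \<Rightarrow> real"
    and ms :: "nat \<Rightarrow> nat"
    and g :: "nat \<Rightarrow> nat \<Rightarrow> ('n, 'm, 'p, 'q) traj \<Rightarrow> real"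
    and Z M :: "('n, 'm, 'p, 'q) traj set"
    and J :: "('n, 'm, 'p, 'q) traj \<Rightarrow> real"
    and V :: "nat \<Rightarrow> ('n, 'm, 'p, 'q) traj \<Rightarrow> real"
    and zs :: "('n, 'm, 'p, 'q) traj"
    and B E A :: "nat set"
    and h :: "nat \<Rightarrow> ('n, 'm, 'p, 'q) traj \<Rightarrow> real"
    and K :: "(nat \<Rightarrow> real) set"
    and lams mus :: "(nat \<Rightarrow> real) \<Rightarrow> nat \<Rightarrow> real"
  assumes time_states: "bij_betw sx {0..N} UNIV"
    and time_inputs: "bij_betw su {..<N} UNIV"
    and Z: "Z = dyn_feasible sx su N f x0 Uhard"
    and J: "J = performance sx su N l lf"
    and V: "V = violation ms g"
    and V_C1: "\<forall>k\<in>{1..L}. C1_on UNIV (V k)"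
    and Z_compact: "compact Z"
    and cascade_attained: "\<forall>k\<in>{1..L}. \<exists>z. is_arg_min (V k) (\<lambda>z. z \<in> cascade V Z (k - 1)) z"
    and lex_attained: "\<exists>z. is_arg_min J (\<lambda>z. z \<in> cascade V Z L) z"
    and weighted_attained:
      "\<forall>w. (\<forall>k\<in>{1..L}. w k > 0) \<longrightarrow> (\<exists>z. is_arg_min (weighted_sum J V L w) (\<lambda>z. z \<in> Z) z)"
    and zs_lex: "\<forall>z. is_arg_min J (\<lambda>z. z \<in> cascade V Z L) z \<longleftrightarrow> z = zs"
    and Z_convex: "convex Z"
    and g_convex: "\<forall>k\<in>{1..L}. \<forall>j\<in>{1..ms k}. convex_on UNIV (g k j)"
    and J_convex: "convex_on UNIV J"
    and level: "i \<in> {1..L}" "V i zs = 0"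
    and B: "B = binding ms g i zs"
    and K_pos: "K \<subseteq> ({1..L} - {i}) \<rightarrow>\<^sub>E {0<..}"
    and K_compact: "compact K"
    and hard: "active_hard_constraints Z E A h zs"
    and M: "M = active_manifold Z A h"
    and gh_C2: "\<exists>U. open U \<and> zs \<in> U \<and> (\<forall>j\<in>B. C2_on U (g i j)) \<and> (\<forall>c\<in>E \<union> A. C2_on U (h c))"
    and R1: "\<exists>U. open U \<and> zs \<in> U \<and>
      (\<forall>w\<in>K. C2_on U (Psi J V L i w) \<and>
        stable_sign_classes (Psi J V L i w) B (E \<union> A) h L ms g i zs (lams w) U)"
    and R2: "lin_indep_family (B <+> (E \<union> A))
      (case_sum (\<lambda>j. grad (g i j) zs) (\<lambda>c. grad (h c) zs))"
    and limit_solution: "\<forall>w\<in>K. strict_local_min_on (Psi J V L i w) {z \<in> M. \<forall>j\<in>B. g i j z \<le> 0} zs"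
    and limit_mult: "\<forall>w\<in>K. limit_multipliers (Psi J V L i w) B (g i) (E \<union> A) h zs (lams w) (mus w)"
    and limit_mult_unique: "\<forall>w\<in>K. \<forall>lam \<mu>.
      limit_multipliers (Psi J V L i w) B (g i) (E \<union> A) h zs lam \<mu> \<longrightarrow>
        (\<forall>j\<in>B. lam j = lams w j) \<and> (\<forall>c\<in>E \<union> A. \<mu> c = mus w c)"
    and second_order: "\<forall>w\<in>K.
      second_order_sufficient (Psi J V L i w) B (g i) (E \<union> A) h zs (lams w) (mus w)"
    and strict_compl: "\<forall>w\<in>K. \<forall>j\<in>B. lams w j > 0"
  shows "\<exists>wbar>0. \<exists>zloc U.
    open U \<and> zs \<in> U \<and>
    (\<forall>w\<in>K. \<forall>wi\<ge>wbar.
       zloc wi w \<in> U \<and>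
       strict_local_min_on (weighted_sum J V L (w(i := wi))) M (zloc wi w) \<and>
       (\<forall>z\<in>U. local_min_on (weighted_sum J V L (w(i := wi))) M z \<longrightarrow> z = zloc wi w)) \<and>
    (\<forall>w\<in>K. continuous_on {wbar..} (\<lambda>wi. zloc wi w)) \<and>
    uniform_limit K zloc (\<lambda>w. zs) at_top \<and>
    (\<exists>c. \<forall>w\<in>K. \<forall>wi\<ge>wbar. \<forall>j\<in>B.
       \<bar>g i j (zloc wi w) - lams w j / (2 * wi)\<bar> \<le> c / wi^2) \<and>
    (\<exists>c. \<forall>w\<in>K. \<forall>wi\<ge>wbar.
       \<bar>V i (zloc wi w) - (\<Sum>j\<in>B. (lams w j)\<^sup>2) / (4 * wi^2)\<bar> \<le> c / wi^3) \<and>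
    (\<forall>w\<in>K. (\<exists>j\<in>B. lams w j \<noteq> 0) \<longrightarrow>
       (\<forall>wi>0. \<not> stationary_on (E \<union> A) h (weighted_sum J V L (w(i := wi))) zs) \<and>
       (\<forall>j\<in>B. lams w j > 0 \<longrightarrow> (\<forall>\<^sub>F wi in at_top. g i j (zloc wi w) > 0)))"
proof -
  define C where "C = E \<union> A"
  define I where "I = B <+> C"
  define B' where "B' = (Inl ` B :: (nat + nat) set)"
  define c where "c = case_sum (g i) h"
  define \<nu>s where "\<nu>s w = case_sum (lams w) (mus w)" for w
  have finB: "finite B" using B by (simp add: binding_def)
  have finC: "finite C" using hard by (simp add: C_def active_hard_constraints_def)
  have sumI: "(\<Sum>k\<in>I. F k) = (\<Sum>j\<in>B. F (Inl j)) + (\<Sum>c\<in>C. F (Inr c))" for F :: "nat + nat \<Rightarrow> 'v::comm_monoid_add"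
    using finB finC by (simp add: I_def sum.Plus o_def)
  obtain n a t where at: "\<And>p. p < n \<Longrightarrow> a p \<in> K" "\<And>p. continuous_on K (t p)"
      "\<And>w. w \<in> K \<Longrightarrow> Psi J V L i w = (\<lambda>z. \<Sum>p<(n::nat). t p w * Psi J V L i (a p) z)"
    using Psi_finite_combination[OF level(1)] by blast

  obtain U1 where U1: "open U1" "zs \<in> U1" "\<And>j. j \<in> B \<Longrightarrow> C2_on U1 (g i j)" "\<And>c. c \<in> C \<Longrightarrow> C2_on U1 (h c)"
    using gh_C2 unfolding C_def by blast
  obtain U2 where U2: "open U2" "zs \<in> U2" "\<And>w. w \<in> K \<Longrightarrow> C2_on U2 (Psi J V L i w)"
    using R1 by blast
  obtain U3 where U3: "open U3" "zs \<in> U3"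
      "Z \<inter> U3 = {z \<in> U3. (\<forall>c\<in>E. h c z = 0) \<and> (\<forall>c\<in>A. h c z \<le> 0)}"
    and zsZ: "zs \<in> Z" and hA: "\<And>c. c \<in> A \<Longrightarrow> h c zs = 0"
    using hard unfolding active_hard_constraints_def by blast
  define U4 where "U4 = (\<Inter>j\<in>{1..ms i} - B. {z. g i j z < 0})"
  have g_cont: "continuous_on UNIV (g i j)" if "j \<in> {1..ms i}" for j
    using g_convex level(1) that by (intro convex_on_continuous open_UNIV) auto
  have "open U4"
    unfolding U4_def using g_cont
    by (intro open_INT ballI open_Collect_less continuous_on_const) auto
  have "(max 0 (g i j zs))\<^sup>2 = 0" if "j \<in> {1..ms i}" for j
    using level(2) that sum_nonneg_eq_0_iff[of "{1..ms i}" "\<lambda>j. (max 0 (g i j zs))\<^sup>2"]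
    by (auto simp: V violation_def)
  then have "zs \<in> U4" by (force simp: U4_def B binding_def max_def split: if_splits)
  \<comment> \<open>On \<open>U4\<close> the hinges of level \<open>i\<close> outside \<open>B\<close> vanish, so that \<open>V i\<close> is the penalty of the binding
    ones alone; on \<open>U3\<close> the manifold \<open>M\<close> is the zero set of the \<open>h k\<close>.\<close>
  define U where "U = U1 \<inter> U2 \<inter> U3 \<inter> U4"
  have U: "open U" "zs \<in> U"
    using U1 U2 U3 \<open>open U4\<close> \<open>zs \<in> U4\<close> by (auto simp: U_def)
  have Psi_C2: "C2_on U (Psi J V L i w)" if "w \<in> K" for w
    by (rule C2_on_subset[OF U2(3)[OF that]]) (auto simp: U_def)
  have g_C2: "C2_on U (g i j)" if "j \<in> B" for j
    by (rule C2_on_subset[OF U1(3)[OF that]]) (auto simp: U_def)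
  have h_C2: "C2_on U (h k)" if "k \<in> C" for k
    by (rule C2_on_subset[OF U1(4)[OF that]]) (auto simp: U_def)
  have hz: "h k zs = 0" if "k \<in> C" for k
    using that zsZ U3 hA by (auto simp: C_def)
  have gz: "g i j zs = 0" if "j \<in> B" for j
    using that by (simp add: B binding_def)

  interpret RP: regular_penalty U zs "Psi J V L i" K "{..<n}" "\<lambda>p. Psi J V L i (a p)" t I B' c \<nu>s
  proof
    show "C2_on U (c k)" if "k \<in> I" for k
      using that g_C2 h_C2 by (auto simp: c_def I_def)
    show "c k zs = 0" if "k \<in> I" for k
      using that gz hz by (auto simp: c_def I_def)
    have "(\<lambda>k. grad (c k) zs) = case_sum (\<lambda>j. grad (g i j) zs) (\<lambda>c. grad (h c) zs)"
      by (auto simp: c_def fun_eq_iff split: sum.split)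
    then show "lin_indep_family I (\<lambda>k. grad (c k) zs)"
      using R2 by (simp add: I_def C_def)
    fix w assume w: "w \<in> K"
    show "grad (Psi J V L i w) zs + (\<Sum>k\<in>I. \<nu>s w k *\<^sub>R grad (c k) zs) = 0"
      using limit_mult w
      by (simp add: sumI limit_multipliers_def Lagrangian_stationary_def C_def \<nu>s_def c_def add.assoc)
    show "\<nu>s w k > 0" if "k \<in> B'" for k
      using that strict_compl w by (auto simp: B'_def \<nu>s_def)
    fix d :: "('n, 'm, 'p, 'q) traj"
    assume d: "d \<noteq> 0" "\<And>k. k \<in> I \<Longrightarrow> grad (c k) zs \<bullet> d = 0"
    have "grad (g i j) zs \<bullet> d = 0" if "j \<in> B" for j using d(2)[unfolded I_def, OF InlI[OF that]] by (simp add: c_def)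
    moreover have "grad (h k) zs \<bullet> d = 0" if "k \<in> C" for k using d(2)[unfolded I_def, OF InrI[OF that]] by (simp add: c_def)
    ultimately have "d \<bullet> hess (\<lambda>y. Psi J V L i w y + (\<Sum>j\<in>B. lams w j * g i j y) + (\<Sum>c\<in>C. mus w c * h c y)) zs d > 0"
      using second_order w d(1) unfolding second_order_sufficient_def C_def by blast
    also have "hess (\<lambda>y. Psi J V L i w y + (\<Sum>j\<in>B. lams w j * g i j y) + (\<Sum>c\<in>C. mus w c * h c y)) zs d =
        hess (Psi J V L i w) zs d + (\<Sum>j\<in>B. lams w j *\<^sub>R hess (g i j) zs d) + (\<Sum>c\<in>C. mus w c *\<^sub>R hess (h c) zs d)"
      by (rule hess_Lagrangian[OF U finB finC Psi_C2[OF w] g_C2 h_C2])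
    finally show "d \<bullet> (hess (Psi J V L i w) zs d + (\<Sum>k\<in>I. \<nu>s w k *\<^sub>R hess (c k) zs d)) > 0"
      by (simp add: sumI \<nu>s_def c_def add.assoc)
  qed (use U K_compact finB finC at Psi_C2 in \<open>auto simp: I_def B'_def\<close>)

  have IB: "I - B' = Inr ` C" by (auto simp: I_def B'_def)
  have V_near: "V i z = (\<Sum>j\<in>B. (max 0 (g i j z))\<^sup>2)" if "z \<in> U" for z
    unfolding V by (rule violation_near[OF B]) (use that in \<open>auto simp: U_def U4_def\<close>)
  have pen: "weighted_sum J V L (w(i := \<omega>)) z = RP.pen w \<omega> z" if "z \<in> U" for w \<omega> z
    unfolding weighted_sum_split[OF level(1)] RP.pen_def V_near[OF that]
    by (simp add: B'_def sum.reindex c_def)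
  have surf: "M \<inter> U = RP.surface \<inter> U"
  proof -
    have "z \<in> M \<longleftrightarrow> (\<forall>k\<in>C. h k z = 0)" if "z \<in> U" for z
    proof -
      have "z \<in> U3" using that by (simp add: U_def)
      then have "z \<in> Z \<longleftrightarrow> (\<forall>c\<in>E. h c z = 0) \<and> (\<forall>c\<in>A. h c z \<le> 0)" using U3(3) by blast
      then show ?thesis by (auto simp: M active_manifold_def C_def)
    qed
    then show ?thesis unfolding RP.surface_def IB by (auto simp: c_def)
  qed

  obtain r \<omega>0 D zl where r: "r > 0" "cball zs r \<subseteq> U" and om0: "\<omega>0 > 0" and D: "D > 0"
    and zl_ball: "\<And>w \<omega>. w \<in> K \<Longrightarrow> \<omega> \<ge> \<omega>0 \<Longrightarrow> zl \<omega> w \<in> ball zs r"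
    and zl_strict: "\<And>w \<omega>. w \<in> K \<Longrightarrow> \<omega> \<ge> \<omega>0 \<Longrightarrow> strict_local_min_on (RP.pen w \<omega>) RP.surface (zl \<omega> w)"
    and zl_unique: "\<And>w \<omega> z. w \<in> K \<Longrightarrow> \<omega> \<ge> \<omega>0 \<Longrightarrow> z \<in> ball zs r \<Longrightarrow> local_min_on (RP.pen w \<omega>) RP.surface z \<Longrightarrow> z = zl \<omega> w"
    and zl_lip: "\<And>w \<omega> \<omega>'. w \<in> K \<Longrightarrow> \<omega> \<ge> \<omega>0 \<Longrightarrow> \<omega>' \<ge> \<omega>0 \<Longrightarrow> norm (zl \<omega> w - zl \<omega>' w) \<le> D * \<bar>1 / \<omega> - 1 / \<omega>'\<bar>"
    and zl_lim: "\<And>w \<omega>. w \<in> K \<Longrightarrow> \<omega> \<ge> \<omega>0 \<Longrightarrow> norm (zl \<omega> w - zs) \<le> D / \<omega>"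
    and zl_c: "\<And>w \<omega> k. w \<in> K \<Longrightarrow> \<omega> \<ge> \<omega>0 \<Longrightarrow> k \<in> B' \<Longrightarrow> c k (zl \<omega> w) > 0 \<and>
       \<bar>c k (zl \<omega> w) - \<nu>s w k / (2 * \<omega>)\<bar> \<le> D / \<omega>\<^sup>2"
    using RP.local_branch by blast
  have zlU: "zl \<omega> w \<in> U" if "w \<in> K" "\<omega> \<ge> \<omega>0" for w \<omega>
    using zl_ball[OF that] r(2) by auto
  have g_pos: "g i j (zl \<omega> w) > 0"
    and g_err: "\<bar>g i j (zl \<omega> w) - lams w j / (2 * \<omega>)\<bar> \<le> D / \<omega>\<^sup>2"
    if "w \<in> K" "\<omega> \<ge> \<omega>0" "j \<in> B" for w \<omega> j
    using zl_c[OF that(1,2), of "Inl j"] that(3) by (auto simp: B'_def c_def \<nu>s_def)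

  have strict: "strict_local_min_on (weighted_sum J V L (w(i := \<omega>))) M (zl \<omega> w)" if "w \<in> K" "\<omega> \<ge> \<omega>0" for w \<omega>
    by (rule strict_local_min_on_transfer[OF U(1) zlU[OF that] surf[symmetric] pen[symmetric] zl_strict[OF that]])
  have unique: "z = zl \<omega> w"
    if "w \<in> K" "\<omega> \<ge> \<omega>0" "z \<in> ball zs r" "local_min_on (weighted_sum J V L (w(i := \<omega>))) M z" for w \<omega> z
  proof (rule zl_unique[OF that(1-3)])
    have "z \<in> U" using that(3) r(2) by auto
    then show "local_min_on (RP.pen w \<omega>) RP.surface z"
      by (rule local_min_on_transfer[OF U(1) _ surf pen that(4)])
  qed
  have cont: "continuous_on {\<omega>0..} (\<lambda>\<omega>. zl \<omega> w)" if w: "w \<in> K" for w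
    unfolding continuous_on_def
  proof
    fix x assume x: "x \<in> {\<omega>0..}"
    have "((\<lambda>\<omega>. zl \<omega> w - zl x w) \<longlongrightarrow> 0) (at x within {\<omega>0..})"
    proof (rule Lim_null_comparison)
      show "\<forall>\<^sub>F \<omega> in at x within {\<omega>0..}. norm (zl \<omega> w - zl x w) \<le> D * \<bar>1 / \<omega> - 1 / x\<bar>"
        unfolding eventually_at_filter using zl_lip[OF w] x by simp
      have "((\<lambda>\<omega>. D * \<bar>1 / \<omega> - 1 / x\<bar>) \<longlongrightarrow> D * \<bar>1 / x - 1 / x\<bar>) (at x within {\<omega>0..})"
        using x om0 by (intro tendsto_intros) auto
      then show "((\<lambda>\<omega>. D * \<bar>1 / \<omega> - 1 / x\<bar>) \<longlongrightarrow> 0) (at x within {\<omega>0..})" by simp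
    qed
    then show "((\<lambda>\<omega>. zl \<omega> w) \<longlongrightarrow> zl x w) (at x within {\<omega>0..})"
      by (simp add: LIM_zero_iff)
  qed
  have ulim: "uniform_limit K zl (\<lambda>w. zs) at_top"
    unfolding uniform_limit_iff
  proof (intro allI impI)
    fix e :: real assume e: "e > 0"
    show "\<forall>\<^sub>F \<omega> in at_top. \<forall>w\<in>K. dist (zl \<omega> w) zs < e"
      using eventually_gt_at_top[of "max \<omega>0 (D / e)"]
    proof eventually_elim
      case (elim \<omega>)
      then have om: "\<omega> \<ge> \<omega>0" "\<omega> > 0" "D / e < \<omega>" using om0 by auto
      then have "D / \<omega> < e" using e by (simp add: field_simps)
      then show ?case using zl_lim om(1) by (fastforce simp: dist_norm)
    qed
  qed

  obtain N where N: "N \<ge> 0" "\<And>w. w \<in> K \<Longrightarrow> (\<Sum>k\<in>I. \<bar>\<nu>s w k\<bar>) \<le> N"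
    using RP.nus_bound by blast
  have lam_le: "\<bar>lams w j\<bar> \<le> N" if "w \<in> K" "j \<in> B" for w j
  proof -
    have "\<bar>\<nu>s w (Inl j)\<bar> \<le> (\<Sum>k\<in>I. \<bar>\<nu>s w k\<bar>)"
      using that(2) finB finC by (intro member_le_sum) (auto simp: I_def)
    then show ?thesis using N(2)[OF that(1)] by (simp add: \<nu>s_def)
  qed
  define c2 where "c2 = real (card B) * (D * (D / \<omega>0 + N))"
  have V_err: "\<bar>V i (zl \<omega> w) - (\<Sum>j\<in>B. (lams w j)\<^sup>2) / (4 * \<omega>^2)\<bar> \<le> c2 / \<omega>^3"
    if w: "w \<in> K" and om: "\<omega> \<ge> \<omega>0" for w \<omega>
  proof -
    have om1: "\<omega> > 0" using om om0 by simp
    have "\<bar>(g i j (zl \<omega> w))\<^sup>2 - (lams w j)\<^sup>2 / (4 * \<omega>\<^sup>2)\<bar> \<le> D * (D / \<omega>0 + N) / \<omega>^3" if j: "j \<in> B" for j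
    proof -
      define x where "x = g i j (zl \<omega> w)"
      define y where "y = lams w j / (2 * \<omega>)"
      have xy: "\<bar>x - y\<bar> \<le> D / \<omega>\<^sup>2" using g_err[OF w om j] by (simp add: x_def y_def)
      have "\<bar>y\<bar> \<le> N / (2 * \<omega>)"
        using lam_le[OF w j] om1 by (simp add: y_def abs_divide divide_right_mono)
      then have "\<bar>x + y\<bar> \<le> D / \<omega>\<^sup>2 + 2 * (N / (2 * \<omega>))" using xy by linarith
      also have "D / \<omega>\<^sup>2 \<le> D / \<omega>0 / \<omega>"
        using om om0 om1 D by (simp add: power2_eq_square frac_le)
      finally have sum: "\<bar>x + y\<bar> \<le> (D / \<omega>0 + N) / \<omega>" using om1 by (simp add: add_divide_distrib)
      have "x\<^sup>2 - (lams w j)\<^sup>2 / (4 * \<omega>\<^sup>2) = (x - y) * (x + y)"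
        by (simp add: y_def power2_eq_square algebra_simps)
      then have "\<bar>x\<^sup>2 - (lams w j)\<^sup>2 / (4 * \<omega>\<^sup>2)\<bar> = \<bar>x - y\<bar> * \<bar>x + y\<bar>" by (simp add: abs_mult)
      also have "\<dots> \<le> (D / \<omega>\<^sup>2) * ((D / \<omega>0 + N) / \<omega>)"
        using xy sum D om1 by (intro mult_mono) auto
      also have "\<dots> = D * (D / \<omega>0 + N) / \<omega>^3" by (simp add: power2_eq_square power3_eq_cube)
      finally show ?thesis by (simp add: x_def)
    qed
    then have "(\<Sum>j\<in>B. \<bar>(g i j (zl \<omega> w))\<^sup>2 - (lams w j)\<^sup>2 / (4 * \<omega>\<^sup>2)\<bar>) \<le> c2 / \<omega>^3"
      using sum_bounded_above[of B "\<lambda>j. \<bar>(g i j (zl \<omega> w))\<^sup>2 - (lams w j)\<^sup>2 / (4 * \<omega>\<^sup>2)\<bar>" "D * (D / \<omega>0 + N) / \<omega>^3"]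
      by (simp add: c2_def)
    moreover have "V i (zl \<omega> w) = (\<Sum>j\<in>B. (g i j (zl \<omega> w))\<^sup>2)"
      unfolding V_near[OF zlU[OF w om]] using g_pos[OF w om] by (intro sum.cong) (auto simp: max_def dest: less_imp_le)
    then have "V i (zl \<omega> w) - (\<Sum>j\<in>B. (lams w j)\<^sup>2) / (4 * \<omega>^2) = (\<Sum>j\<in>B. (g i j (zl \<omega> w))\<^sup>2 - (lams w j)\<^sup>2 / (4 * \<omega>\<^sup>2))"
      by (simp add: sum_subtractf sum_divide_distrib)
    ultimately show ?thesis by (simp only:) (rule order_trans[OF sum_abs])
  qed

  have nonstat: "\<not> stationary_on (E \<union> A) h (weighted_sum J V L (w(i := \<omega>))) zs"
    if w: "w \<in> K" and ex: "\<exists>j\<in>B. lams w j \<noteq> 0" for w \<omega>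
  proof
    assume "stationary_on (E \<union> A) h (weighted_sum J V L (w(i := \<omega>))) zs"
    then obtain \<mu> where mu: "grad (weighted_sum J V L (w(i := \<omega>))) zs + (\<Sum>c\<in>E \<union> A. \<mu> c *\<^sub>R grad (h c) zs) = 0"
      unfolding stationary_on_def by blast
    have dP: "(Psi J V L i w has_derivative (\<lambda>d. d \<bullet> grad (Psi J V L i w) zs)) (at zs)"
      by (rule RP.Psi_derivative[OF w U(2)])
    have dV: "(V i has_derivative (\<lambda>d. d \<bullet> grad (V i) zs)) (at zs)"
      using C1_onD_derivative[of UNIV "V i" zs] V_C1 level(1) by auto
    \<comment> \<open>The nonnegative \<open>V i\<close> vanishes at \<open>zs\<close>, hence so does its gradient, and stationarity of the penalized
      objective would make \<open>0\<close> a limiting multiplier.\<close>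
    have "V i y \<ge> V i zs" for y
      unfolding level(2) by (auto simp: V violation_def intro: sum_nonneg)
    then have dV0: "(\<lambda>d. d \<bullet> grad (V i) zs) = (\<lambda>d. 0)"
      by (intro differential_zero_maxmin[OF _ open_UNIV dV]) auto
    have "((\<lambda>z. Psi J V L i w z + \<omega> * V i z) has_derivative
        (\<lambda>d. d \<bullet> grad (Psi J V L i w) zs + \<omega> * 0)) (at zs)"
      using dV unfolding dV0 by (intro has_derivative_add has_derivative_mult_right dP)
    then have "GDERIV (weighted_sum J V L (w(i := \<omega>))) zs :> grad (Psi J V L i w) zs"
      unfolding gderiv_def weighted_sum_split[OF level(1), abs_def] by simp
    from grad_eqI[OF this] mu have "limit_multipliers (Psi J V L i w) B (g i) (E \<union> A) h zs (\<lambda>_. 0) \<mu>"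
      by (simp add: limit_multipliers_def Lagrangian_stationary_def)
    then show False using limit_mult_unique w ex by fastforce
  qed

  show ?thesis
  proof (rule exI[of _ \<omega>0], intro conjI exI[of _ zl] exI[of _ "ball zs r"])
    show "\<omega>0 > 0" by (rule om0)
    show "open (ball zs r)" "zs \<in> ball zs r" using r by auto
    show "\<forall>w\<in>K. \<forall>wi\<ge>\<omega>0. zl wi w \<in> ball zs r \<and>
        strict_local_min_on (weighted_sum J V L (w(i := wi))) M (zl wi w) \<and>
        (\<forall>z\<in>ball zs r. local_min_on (weighted_sum J V L (w(i := wi))) M z \<longrightarrow> z = zl wi w)"
      using zl_ball strict unique by blast
    show "\<forall>w\<in>K. continuous_on {\<omega>0..} (\<lambda>wi. zl wi w)" using cont by blast
    show "uniform_limit K zl (\<lambda>w. zs) at_top" by (rule ulim)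
    show "\<exists>c. \<forall>w\<in>K. \<forall>wi\<ge>\<omega>0. \<forall>j\<in>B. \<bar>g i j (zl wi w) - lams w j / (2 * wi)\<bar> \<le> c / wi^2"
      using g_err by blast
    show "\<exists>c. \<forall>w\<in>K. \<forall>wi\<ge>\<omega>0. \<bar>V i (zl wi w) - (\<Sum>j\<in>B. (lams w j)\<^sup>2) / (4 * wi^2)\<bar> \<le> c / wi^3"
      using V_err by blast
    have "\<forall>\<^sub>F wi in at_top. g i j (zl wi w) > 0" if "w \<in> K" "j \<in> B" for w j
      using eventually_ge_at_top[of \<omega>0] by eventually_elim (rule g_pos[OF that(1) _ that(2)])
    then show "\<forall>w\<in>K. (\<exists>j\<in>B. lams w j \<noteq> 0) \<longrightarrow>
       (\<forall>wi>0. \<not> stationary_on (E \<union> A) h (weighted_sum J V L (w(i := wi))) zs) \<and>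
       (\<forall>j\<in>B. lams w j > 0 \<longrightarrow> (\<forall>\<^sub>F wi in at_top. g i j (zl wi w) > 0))"
      using nonstat by blast
  qed
qed

end
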